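(* Let $\Gamma$ be a finitely generated virtually nilpotent group. Then the following are equivalent: (1) $\Gamma$ is virtually abelian; (2) there exists a finite symmetric set of generators $S\subseteq\Gamma$ with $e\notin S$ such that the Cayley graph of $\Gamma$ with respect to $S$ has non-negative Ollivier--Ricci curvature.
   Context: A group is virtually nilpotent (resp. virtually abelian) if it has a normal nilpotent (resp. abelian) subgroup of finite index. A subset $S\subseteq\Gamma$ is symmetric if $S=S^{-1}$. The Cayley graph of $\Gamma$ with respect to $S$ is the undirected graph with vertex set $\Gamma$ and $g\sim h$ iff $g^{-1}h\in S$; $d$ denotes its shortest-path distance. For $g\in\Gamma$ let $\mu_g$ be the law of the $1/2$-lazy symmetric random walk from $g$: $\mu_g(g)=\tfrac12$, $\mu_g(k)=\tfrac{1}{2|S|}$ for $k\sim g$, and $\mu_g(k)=0$ otherwise. For finitely supported probability measures $\mu,\nu$ on $\Gamma$, $W_1(\mu,\nu)=\inf_\pi\sum_{g,h}d(g,h)\pi(g,h)$, where the infimum is over all probability measures $\pi$ on $\Gamma\times\Gamma$ with marginals $\mu$ and $\nu$. The Ollivier--Ricci curvature is $\kappa(g,h)=1-\frac{W_1(\mu_g,\mu_h)}{d(g,h)}$ for $g\neq h$. The Cayley graph has non-negative Ollivier--Ricci curvature if $\kappa(g,h)\ge 0$ for all $g\sim h$. *)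

theory Defs
  imports "HOL-Probability.Probability" "HOL-Algebra.Algebra"
begin

section \<open>Nilpotency and virtual properties of groups\<close>

definition finitely_generated_group :: "('a, 'b) monoid_scheme \<Rightarrow> bool" where
  "finitely_generated_group G \<longleftrightarrow>
     group G \<and> (\<exists>S. finite S \<and> S \<subseteq> carrier G \<and> generate G S = carrier G)"

definition commutator_subgroup :: "('a, 'b) monoid_scheme \<Rightarrow> 'a set \<Rightarrow> 'a set \<Rightarrow> 'a set" where
  "commutator_subgroup G H K =
     generate G (\<Union>h\<in>H. \<Union>k\<in>K. {h \<otimes>\<^bsub>G\<^esub> k \<otimes>\<^bsub>G\<^esub> inv\<^bsub>G\<^esub> h \<otimes>\<^bsub>G\<^esub> inv\<^bsub>G\<^esub> k})"

primrec lower_central :: "('a, 'b) monoid_scheme \<Rightarrow> nat \<Rightarrow> 'a set" where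
  "lower_central G 0 = carrier G"
| "lower_central G (Suc n) = commutator_subgroup G (lower_central G n) (carrier G)"

definition nilpotent_group :: "('a, 'b) monoid_scheme \<Rightarrow> bool" where
  "nilpotent_group G \<longleftrightarrow> group G \<and> (\<exists>n. lower_central G n = {\<one>\<^bsub>G\<^esub>})"

definition virtually_nilpotent :: "('a, 'b) monoid_scheme \<Rightarrow> bool" where
  "virtually_nilpotent G \<longleftrightarrow>
     (\<exists>H. H \<lhd> G \<and> finite (rcosets\<^bsub>G\<^esub> H) \<and> nilpotent_group (G\<lparr>carrier := H\<rparr>))"

definition virtually_abelian :: "('a, 'b) monoid_scheme \<Rightarrow> bool" where
  "virtually_abelian G \<longleftrightarrow>
     (\<exists>H. H \<lhd> G \<and> finite (rcosets\<^bsub>G\<^esub> H) \<and> comm_group (G\<lparr>carrier := H\<rparr>))"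

section \<open>Cayley graphs and Ollivier--Ricci curvature\<close>

definition symmetric_subset :: "('a, 'b) monoid_scheme \<Rightarrow> 'a set \<Rightarrow> bool" where
  "symmetric_subset G S \<longleftrightarrow> S \<subseteq> carrier G \<and> S = (\<lambda>s. inv\<^bsub>G\<^esub> s) ` S"

definition cayley_edges :: "('a, 'b) monoid_scheme \<Rightarrow> 'a set \<Rightarrow> ('a \<times> 'a) set" where
  "cayley_edges G S =
     {(g, h). g \<in> carrier G \<and> h \<in> carrier G \<and> inv\<^bsub>G\<^esub> g \<otimes>\<^bsub>G\<^esub> h \<in> S}"

text \<open>A pair lies in the \<open>n\<close>-th relational power of the edge relation iff its components are
  joined by a walk with \<open>n\<close> edges. The value is meaningful only for vertices in the same
  connected component, hence for all vertices when \<open>S\<close> is a symmetric generating set.\<close>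

definition cayley_dist :: "('a, 'b) monoid_scheme \<Rightarrow> 'a set \<Rightarrow> 'a \<Rightarrow> 'a \<Rightarrow> nat" where
  "cayley_dist G S g h = (LEAST n. (g, h) \<in> cayley_edges G S ^^ n)"

definition lazy_walk_weight ::
    "('a, 'b) monoid_scheme \<Rightarrow> 'a set \<Rightarrow> 'a \<Rightarrow> 'a \<Rightarrow> real" where
  "lazy_walk_weight G S g k =
     (if k = g then 1 / 2
      else if (g, k) \<in> cayley_edges G S then 1 / (2 * real (card S))
      else 0)"

text \<open>The weights sum to one if \<open>S\<close> is finite, non-empty and does not contain the identity (see
  \<open>pmf_lazy_walk\<close> below). For empty \<open>S\<close> this measure is unspecified, but then the Cayley graph has
  no edges and non-negativity of the curvature is vacuous.\<close>

definition lazy_walk :: "('a, 'b) monoid_scheme \<Rightarrow> 'a set \<Rightarrow> 'a \<Rightarrow> 'a pmf" where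
  "lazy_walk G S g = embed_pmf (lazy_walk_weight G S g)"

definition couplings :: "'a pmf \<Rightarrow> 'a pmf \<Rightarrow> ('a \<times> 'a) pmf set" where
  "couplings \<mu> \<nu> = {\<pi>. map_pmf fst \<pi> = \<mu> \<and> map_pmf snd \<pi> = \<nu>}"

text \<open>Only used for finitely supported \<open>\<mu>\<close> and \<open>\<nu>\<close>; every coupling is then finitely supported and
  the expectation is a finite sum. Couplings of measures supported in the carrier are
  automatically supported in the square of the carrier.\<close>

definition W1 ::
    "('a, 'b) monoid_scheme \<Rightarrow> 'a set \<Rightarrow> 'a pmf \<Rightarrow> 'a pmf \<Rightarrow> real" where
  "W1 G S \<mu> \<nu> =
     (INF \<pi> \<in> couplings \<mu> \<nu>.
        measure_pmf.expectation \<pi> (\<lambda>(g, h). real (cayley_dist G S g h)))"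

text \<open>Meaningful for \<open>g \<noteq> h\<close> only, which holds for all edges if \<open>S\<close> omits the identity.\<close>

definition ollivier_ricci :: "('a, 'b) monoid_scheme \<Rightarrow> 'a set \<Rightarrow> 'a \<Rightarrow> 'a \<Rightarrow> real" where
  "ollivier_ricci G S g h =
     1 - W1 G S (lazy_walk G S g) (lazy_walk G S h) / real (cayley_dist G S g h)"

definition nonneg_ollivier_ricci :: "('a, 'b) monoid_scheme \<Rightarrow> 'a set \<Rightarrow> bool" where
  "nonneg_ollivier_ricci G S \<longleftrightarrow>
     (\<forall>(g, h) \<in> cayley_edges G S. 0 \<le> ollivier_ricci G S g h)"

lemma pmf_lazy_walk:
  fixes G :: "('a, 'b) monoid_scheme"
  assumes "group G" "S \<subseteq> carrier G" "finite S" "S \<noteq> {}" "\<one>\<^bsub>G\<^esub> \<notin> S" "g \<in> carrier G"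
  shows "pmf (lazy_walk G S g) k = lazy_walk_weight G S g k"
proof -
  interpret group G by fact
  let ?N = "(\<lambda>s. g \<otimes>\<^bsub>G\<^esub> s) ` S"
  let ?f = "lazy_walk_weight G S g"
  have nbr: "(g, x) \<in> cayley_edges G S \<longleftrightarrow> x \<in> ?N" for x
  proof
    assume "(g, x) \<in> cayley_edges G S"
    then have x: "x \<in> carrier G" and s: "inv\<^bsub>G\<^esub> g \<otimes>\<^bsub>G\<^esub> x \<in> S"
      by (auto simp: cayley_edges_def)
    have "x = g \<otimes>\<^bsub>G\<^esub> (inv\<^bsub>G\<^esub> g \<otimes>\<^bsub>G\<^esub> x)"
      using x assms(6) by (simp add: m_assoc[symmetric])
    with s show "x \<in> ?N" by blast
  next
    assume "x \<in> ?N"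
    then obtain s where "s \<in> S" "x = g \<otimes>\<^bsub>G\<^esub> s" by blast
    moreover from this have "s \<in> carrier G" using assms(2) by blast
    ultimately show "(g, x) \<in> cayley_edges G S"
      using assms(6) by (simp add: cayley_edges_def m_assoc[symmetric])
  qed
  have g: "g \<notin> ?N"
    using nbr[of g] assms(5,6) by (simp add: cayley_edges_def)
  have card: "card ?N = card S"
    using assms(2,6) by (intro card_image) (auto simp: inj_on_def subset_eq)
  have S: "card S > 0" using assms(3,4) by (simp add: card_gt_0_iff)
  have fin: "finite (insert g ?N)" using assms(3) by simp
  have nonneg: "0 \<le> ?f x" for x by (simp add: lazy_walk_weight_def)
  have "sum ?f (insert g ?N) = ?f g + sum ?f ?N"
    using g assms(3) by simp
  also have "sum ?f ?N = (\<Sum>x\<in>?N. 1 / (2 * real (card S)))"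
  proof (rule sum.cong)
    fix x assume "x \<in> ?N"
    then have "(g, x) \<in> cayley_edges G S" "x \<noteq> g" using nbr g by blast+
    then show "?f x = 1 / (2 * real (card S))" by (simp add: lazy_walk_weight_def)
  qed simp
  also have "\<dots> = 1 / 2" using S card by simp
  finally have one: "sum ?f (insert g ?N) = 1" by (simp add: lazy_walk_weight_def)
  have "(\<integral>\<^sup>+x. ennreal (?f x) \<partial>count_space UNIV) = (\<Sum>x\<in>insert g ?N. ennreal (?f x))"
    using fin nbr by (intro nn_integral_count_space') (auto simp: lazy_walk_weight_def)
  also have "\<dots> = ennreal (sum ?f (insert g ?N))" using nonneg by (intro sum_ennreal)
  finally have "(\<integral>\<^sup>+x. ennreal (?f x) \<partial>count_space UNIV) = 1" using one by simp
  then show ?thesis unfolding lazy_walk_def using nonneg by (intro pmf_embed_pmf)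
qed

end

theory Submission
  imports Defs
begin

text \<open>
  Non-negative curvature means that the lazy walks at the two ends of an edge can be coupled so
  that the expected distance is (almost) at most one.

  Suppose first that the curvature is non-negative for some generating set, and let \<open>N\<close> be a
  nilpotent normal subgroup of finite index. If the commutator subgroup of \<open>N\<close> is torsion modulo
  the next term of the lower central series, then the centre of \<open>N\<close> has finite index and the group
  is virtually abelian. Otherwise an additive function \<open>f\<close> on the commutator subgroup yields a
  non-zero alternating form \<open>f [x, y]\<close> on \<open>N\<close> (\<open>nilpotent_center_or_form\<close>), and curvature has to
  rule this out.

  Fixing one argument of the form gives finitely many additive functions on \<open>N\<close>, hence a
  Euclidean seminorm, invariant under conjugation by the whole group, whose kernel lies in the
  radical of the form. The ratio of seminorm and word length has a maximum (\<open>max_slope\<close>). Let \<open>c\<close>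
  be a conjugate of an element that attains it, chosen so that \<open>f [c, y]\<close> is not zero for some
  \<open>y\<close>; then the maximum is attained by the displacement of some vertex \<open>b\<close> under \<open>c\<close>. Pairing with
  \<open>c\<close> gives an additive function \<open>\<phi>\<close>, which extends to a function on the group that is equivariant
  under \<open>N\<close> and Lipschitz, and that grows at the maximal rate along a geodesic from \<open>b\<close> to \<open>c b\<close>.
  Along an edge on such a geodesic the mean of the function also grows at the maximal rate, so
  almost optimal couplings move mass only along paths of maximal growth (\<open>mass_moves_up\<close>). A
  recurrence argument along the periodic geodesic shows that every vertex \<open>x\<close> lies on a periodic
  path of maximal growth: some power of \<open>c\<close> moves \<open>x\<close> as little as it moves \<open>b\<close>
  (\<open>maximal_slope_everywhere\<close>). Thus the conjugates of powers of \<open>c\<close> by \<open>x\<^sup>i\<close> have the same length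
  as these powers, for all \<open>i\<close>. On the other hand conjugation by \<open>x\<^sup>i\<close> shears \<open>c\<close> by \<open>i\<close> times \<open>f
  [c, x]\<close>, while on elements of maximal slope every additive function is bounded by the length
  (\<open>additive_le_length\<close>). Hence \<open>f [c, x] = 0\<close> for all \<open>x\<close>, which contradicts the choice of \<open>c\<close>
  (\<open>form_zero_of_nonneg_curvature\<close>).

  Conversely, let \<open>A\<close> be an abelian normal subgroup of finite index. The generating set consists
  of a small set \<open>T\<close>, closed under inverses and with the same number of elements in each coset
  other than \<open>A\<close>, and of a finite subset \<open>B\<close> of \<open>A\<close> that is closed under conjugation and contains
  all short products of elements of \<open>T\<close> that lie in \<open>A\<close>. The lazy walks at \<open>1\<close> and \<open>s\<close> are coupled
  by a bijection that moves points by distance at most one. For \<open>s\<close> in \<open>B\<close> this is \<open>x \<mapsto> s x\<close>. For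
  \<open>s\<close> in \<open>T\<close> it is \<open>x \<mapsto> x s\<close> on \<open>B\<close>, and on \<open>T\<close> it is a matching of \<open>T\<close> with \<open>s T\<close> inside the
  cosets of \<open>A\<close>, up to a correction at the elements of \<open>T\<close> in the coset of \<open>s\<close>, which stay fixed
  (\<open>transport_bijection\<close>).
\<close>

section \<open>Additive real functions on groups\<close>

definition commutator :: "('a, 'b) monoid_scheme \<Rightarrow> 'a \<Rightarrow> 'a \<Rightarrow> 'a" where
  "commutator G x y = x \<otimes>\<^bsub>G\<^esub> y \<otimes>\<^bsub>G\<^esub> inv\<^bsub>G\<^esub> x \<otimes>\<^bsub>G\<^esub> inv\<^bsub>G\<^esub> y"

definition additive_on :: "('a, 'b) monoid_scheme \<Rightarrow> 'a set \<Rightarrow> ('a \<Rightarrow> real) \<Rightarrow> bool" where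
  "additive_on G K f \<longleftrightarrow> (\<forall>x\<in>K. \<forall>y\<in>K. f (x \<otimes>\<^bsub>G\<^esub> y) = f x + f y)"

lemma (in group) inv_mult_cancel [simp]:
  assumes "x \<in> carrier G" "y \<in> carrier G"
  shows "inv x \<otimes> (x \<otimes> y) = y" "x \<otimes> (inv x \<otimes> y) = y"
  using assms by (simp_all add: m_assoc [symmetric])

lemmas (in group) group_word_simps = m_assoc inv_mult_group

lemma (in group) commutator_closed [simp, intro]:
  "x \<in> carrier G \<Longrightarrow> y \<in> carrier G \<Longrightarrow> commutator G x y \<in> carrier G"
  by (simp add: commutator_def)

lemma (in group) conj_eq_commutator_mult:
  "x \<in> carrier G \<Longrightarrow> y \<in> carrier G \<Longrightarrow> x \<otimes> y \<otimes> inv x = commutator G x y \<otimes> y"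
  by (simp add: commutator_def group_word_simps)

lemma (in group) inv_commutator:
  "x \<in> carrier G \<Longrightarrow> y \<in> carrier G \<Longrightarrow> inv (commutator G x y) = commutator G y x"
  by (simp add: commutator_def group_word_simps)

lemma additive_on_mult:
  "additive_on G K f \<Longrightarrow> x \<in> K \<Longrightarrow> y \<in> K \<Longrightarrow> f (x \<otimes>\<^bsub>G\<^esub> y) = f x + f y"
  by (simp add: additive_on_def)

lemma (in group) additive_on_one:
  assumes "additive_on G K f" "subgroup K G" shows "f \<one> = 0"
  using additive_on_mult[OF assms(1), of \<one> \<one>] subgroup.one_closed[OF assms(2)] by simp

lemma (in group) additive_on_inv:
  assumes "additive_on G K f" "subgroup K G" "x \<in> K" shows "f (inv x) = - f x"
proof -
  have "x \<in> carrier G" using assms by (meson subgroup.mem_carrier)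
  then show ?thesis
    using additive_on_mult[OF assms(1), of x "inv x"] assms additive_on_one[OF assms(1,2)]
    by (simp add: subgroup.m_inv_closed)
qed

lemma (in subgroup) pow_mem: assumes "group G" "x \<in> H" shows "x [^]\<^bsub>G\<^esub> (k::nat) \<in> H"
proof (induction k)
  case 0
  interpret group G by fact
  show ?case by simp
next
  case (Suc k)
  interpret group G by fact
  show ?case using Suc assms(2) by simp
qed

lemma (in group) additive_on_pow:
  assumes "additive_on G K f" "subgroup K G" "x \<in> K"
  shows "x [^] (n::nat) \<in> K" "f (x [^] (n::nat)) = real n * f x"
proof -
  have *: "x [^] (n::nat) \<in> K" for n using subgroup.pow_mem[OF assms(2) is_group assms(3)] .
  show "x [^] (n::nat) \<in> K" by (rule *)
  show "f (x [^] (n::nat)) = real n * f x"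
    by (induction n) (use * assms in \<open>auto simp: additive_on_one additive_on_mult algebra_simps\<close>)
qed

lemma (in group) additive_on_conj:
  assumes "additive_on G K f" "subgroup K G" "x \<in> K" "y \<in> K"
  shows "f (x \<otimes> y \<otimes> inv x) = f y"
  using assms by (simp add: additive_on_mult additive_on_inv subgroup.m_closed subgroup.m_inv_closed)

lemma (in group) additive_on_commutator:
  assumes "additive_on G K f" "subgroup K G" "x \<in> K" "y \<in> K"
  shows "f (commutator G x y) = 0"
  using assms
  by (simp add: commutator_def additive_on_mult additive_on_inv subgroup.m_closed subgroup.m_inv_closed)

text \<open>Graphs of additive functions are subgroups of the product of the group with the reals. They
  are single-valued as soon as the fibre over the identity is, and in this form unions of chains are
  immediate. Since the commutators have value zero, the graphs are closed under conjugation, so adjoining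
  the powers of one element again gives a graph.\<close>

definition additive_graph :: "('a, 'b) monoid_scheme \<Rightarrow> ('a \<times> real) set \<Rightarrow> bool" where
  "additive_graph G R \<longleftrightarrow>
     fst ` R \<subseteq> carrier G \<and> (\<one>\<^bsub>G\<^esub>, 0) \<in> R \<and>
     (\<forall>x u y v. (x, u) \<in> R \<longrightarrow> (y, v) \<in> R \<longrightarrow> (x \<otimes>\<^bsub>G\<^esub> y, u + v) \<in> R) \<and>
     (\<forall>x u. (x, u) \<in> R \<longrightarrow> (inv\<^bsub>G\<^esub> x, - u) \<in> R) \<and>
     (\<forall>u. (\<one>\<^bsub>G\<^esub>, u) \<in> R \<longrightarrow> u = 0) \<and>
     (\<forall>x\<in>carrier G. \<forall>y\<in>carrier G. (commutator G x y, 0) \<in> R)"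

lemma additive_graphD:
  assumes "additive_graph G R"
  shows "(x, u) \<in> R \<Longrightarrow> x \<in> carrier G" "(\<one>\<^bsub>G\<^esub>, 0) \<in> R"
    "(x, u) \<in> R \<Longrightarrow> (y, v) \<in> R \<Longrightarrow> (x \<otimes>\<^bsub>G\<^esub> y, u + v) \<in> R"
    "(x, u) \<in> R \<Longrightarrow> (inv\<^bsub>G\<^esub> x, - u) \<in> R"
    "(\<one>\<^bsub>G\<^esub>, u) \<in> R \<Longrightarrow> u = 0"
    "x \<in> carrier G \<Longrightarrow> y \<in> carrier G \<Longrightarrow> (commutator G x y, 0) \<in> R"
proof -
  note * = assms [unfolded additive_graph_def]
  show "(x, u) \<in> R \<Longrightarrow> x \<in> carrier G" using conjunct1[OF *] by force
  show "(\<one>\<^bsub>G\<^esub>, 0) \<in> R" "(x, u) \<in> R \<Longrightarrow> (y, v) \<in> R \<Longrightarrow> (x \<otimes>\<^bsub>G\<^esub> y, u + v) \<in> R"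
    "(x, u) \<in> R \<Longrightarrow> (inv\<^bsub>G\<^esub> x, - u) \<in> R" "(\<one>\<^bsub>G\<^esub>, u) \<in> R \<Longrightarrow> u = 0"
    "x \<in> carrier G \<Longrightarrow> y \<in> carrier G \<Longrightarrow> (commutator G x y, 0) \<in> R"
    using conjunct2[OF *] by blast+
qed

lemma (in group) additive_graph_unique:
  assumes "additive_graph G R" "(x, u) \<in> R" "(x, v) \<in> R" shows "u = v"
proof -
  have "(x \<otimes> inv x, u + - v) \<in> R" using assms additive_graphD by metis
  moreover have "x \<in> carrier G" using additive_graphD(1) assms by metis
  ultimately show ?thesis using additive_graphD(5)[OF assms(1)] by fastforce
qed

lemma (in group) additive_graph_conj:
  assumes "additive_graph G R" "(x, u) \<in> R" "g \<in> carrier G"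
  shows "(g \<otimes> x \<otimes> inv g, u) \<in> R"
proof -
  have "x \<in> carrier G" using additive_graphD(1) assms by metis
  then show ?thesis
    using additive_graphD(3)[OF assms(1) additive_graphD(6)[OF assms(1), of g x] assms(2)] assms
    by (simp add: conj_eq_commutator_mult)
qed

lemma (in group) additive_graph_extend_by_element:
  assumes R: "additive_graph G R" and a: "a \<in> carrier G"
    and compat: "\<And>(i::int) u. (a [^] i, u) \<in> R \<Longrightarrow> u = of_int i * r"
  obtains R' where "additive_graph G R'" "R \<subseteq> R'" "(a, r) \<in> R'"
proof
  define R' where "R' = {(x \<otimes> a [^] i, u + of_int i * r) | x u (i::int). (x, u) \<in> R}"
  note c = additive_graphD(1)[OF R]
  have R'I: "(z, w) \<in> R'" if "(x, u) \<in> R" "z = x \<otimes> a [^] i" "w = u + of_int i * r"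
    for z w x u and i :: int using that unfolding R'_def by blast
  show sub: "R \<subseteq> R'"
  proof
    fix p assume p: "p \<in> R"
    obtain x u where "p = (x, u)" by fastforce
    then show "p \<in> R'" using R'I[of x u "fst p" 0 "snd p"] p c by simp
  qed
  show "(a, r) \<in> R'" using R'I[OF additive_graphD(2)[OF R], of a 1 r] a by simp
  show "additive_graph G R'"
    unfolding additive_graph_def
  proof (intro conjI allI impI ballI)
    show "fst ` R' \<subseteq> carrier G" using c a unfolding R'_def by auto
    show "(\<one>, 0) \<in> R'" using sub additive_graphD(2)[OF R] by blast
    show "(commutator G x y, 0) \<in> R'" if "x \<in> carrier G" "y \<in> carrier G" for x y
      using sub additive_graphD(6)[OF R] that by blast
  next
    fix z w z' w' assume "(z, w) \<in> R'" "(z', w') \<in> R'"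
    then obtain x u x' u' and i i' :: int where x: "(x, u) \<in> R" "z = x \<otimes> a [^] i" "w = u + of_int i * r"
      and x': "(x', u') \<in> R" "z' = x' \<otimes> a [^] i'" "w' = u' + of_int i' * r"
      unfolding R'_def by blast
    have "(x \<otimes> (a [^] i \<otimes> x' \<otimes> inv (a [^] i)), u + u') \<in> R"
      using additive_graphD(3)[OF R] x(1) additive_graph_conj[OF R x'(1), of "a [^] i"] a by simp
    then show "(z \<otimes> z', w + w') \<in> R'"
    proof (rule R'I)
      show "z \<otimes> z' = x \<otimes> (a [^] i \<otimes> x' \<otimes> inv (a [^] i)) \<otimes> a [^] (i + i')"
        using c[OF x(1)] c[OF x'(1)] a x x' by (simp add: group_word_simps int_pow_mult)
      show "w + w' = u + u' + of_int (i + i') * r" using x x' by (simp add: algebra_simps)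
    qed
  next
    fix z w assume "(z, w) \<in> R'"
    then obtain x u and i :: int where x: "(x, u) \<in> R" "z = x \<otimes> a [^] i" "w = u + of_int i * r"
      unfolding R'_def by blast
    have "(inv (a [^] i) \<otimes> inv x \<otimes> inv (inv (a [^] i)), - u) \<in> R"
      using additive_graph_conj[OF R additive_graphD(4)[OF R x(1)], of "inv (a [^] i)"] a by simp
    then show "(inv z, - w) \<in> R'"
    proof (rule R'I)
      show "inv z = inv (a [^] i) \<otimes> inv x \<otimes> inv (inv (a [^] i)) \<otimes> a [^] (- i)"
        using c[OF x(1)] a x by (simp add: group_word_simps int_pow_neg)
      show "- w = - u + of_int (- i) * r" using x by simp
    qed
  next
    fix w assume "(\<one>, w) \<in> R'"
    then obtain x u and i :: int where x: "(x, u) \<in> R" "\<one> = x \<otimes> a [^] i" "w = u + of_int i * r"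
      unfolding R'_def by blast
    have "x = a [^] (- i)"
      using c[OF x(1)] a x(2) by (metis int_pow_closed int_pow_neg inv_equality inv_inv)
    then show "w = 0" using compat[of "-i" u] x by simp
  qed
qed

text \<open>The reals are divisible and torsion-free, so a compatible value on a new element exists: it is
  forced if some positive power of the element is already in the domain, and arbitrary otherwise.\<close>

lemma (in group) additive_graph_extend:
  assumes R: "additive_graph G R"
  obtains f where "additive_on G (carrier G) f" "\<And>x u. (x, u) \<in> R \<Longrightarrow> f x = u"
proof -
  have "\<exists>M\<in>{R'. additive_graph G R' \<and> R \<subseteq> R'}. \<forall>P\<in>{R'. additive_graph G R' \<and> R \<subseteq> R'}.
      M \<subseteq> P \<longrightarrow> P = M"
    (is "\<exists>M\<in>?A. _")
  proof (rule subset_Zorn_nonempty)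
    show "?A \<noteq> {}" using R by blast
  next
    fix C assume C: "C \<noteq> {}" "subset.chain ?A C"
    then have CA: "\<And>P. P \<in> C \<Longrightarrow> additive_graph G P" "\<And>P. P \<in> C \<Longrightarrow> R \<subseteq> P"
      and ch: "\<And>P Q. P \<in> C \<Longrightarrow> Q \<in> C \<Longrightarrow> P \<subseteq> Q \<or> Q \<subseteq> P"
      by (auto simp: subset_chain_def)
    obtain P0 where P0: "P0 \<in> C" using C by blast
    have "additive_graph G (\<Union>C)"
      unfolding additive_graph_def
    proof (intro conjI allI impI ballI)
      show "fst ` \<Union>C \<subseteq> carrier G" using additive_graphD(1)[OF CA(1)] by force
      show "(\<one>, 0) \<in> \<Union>C" using P0 additive_graphD(2)[OF CA(1)] by blast
      show "(commutator G x y, 0) \<in> \<Union>C" if "x \<in> carrier G" "y \<in> carrier G" for x y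
        using P0 additive_graphD(6)[OF CA(1)] that by blast
      show "(inv x, - u) \<in> \<Union>C" if "(x, u) \<in> \<Union>C" for x u
        using that additive_graphD(4)[OF CA(1)] by blast
      show "u = 0" if "(\<one>, u) \<in> \<Union>C" for u
        using that additive_graphD(5)[OF CA(1)] by blast
      fix x u y v assume "(x, u) \<in> \<Union>C" "(y, v) \<in> \<Union>C"
      then obtain P Q where "(x, u) \<in> P" "P \<in> C" "(y, v) \<in> Q" "Q \<in> C" by blast
      then show "(x \<otimes> y, u + v) \<in> \<Union>C"
        using ch[of P Q] additive_graphD(3)[OF CA(1)] by (metis UnionI subsetD)
    qed
    moreover have "R \<subseteq> \<Union>C" using P0 CA(2) by blast
    ultimately show "\<Union>C \<in> ?A" by blast
  qed
  then obtain M where M: "additive_graph G M" "R \<subseteq> M"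
    and max: "\<And>P. additive_graph G P \<Longrightarrow> M \<subseteq> P \<Longrightarrow> P = M" by force
  have total: "\<exists>u. (a, u) \<in> M" if a: "a \<in> carrier G" for a
  proof -
    have "\<exists>r. \<forall>(i::int) u. (a [^] i, u) \<in> M \<longrightarrow> u = of_int i * r"
    proof (cases "\<exists>(j::int) v. j \<noteq> 0 \<and> (a [^] j, v) \<in> M")
      case False
      then show ?thesis using additive_graphD(5)[OF M(1)] by (metis int_pow_0 mult_zero_left of_int_0)
    next
      case True
      then obtain v and j :: int where j: "j \<noteq> 0" "(a [^] j, v) \<in> M" by blast
      have pow: "(x [^] i, of_int i * u) \<in> M" if x: "(x, u) \<in> M" for x u and i :: int
      proof -
        have xc: "x \<in> carrier G" using additive_graphD(1)[OF M(1) x] .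
        have nat: "(x [^] n, of_nat n * u) \<in> M" for n :: nat
        proof (induction n)
          case 0 show ?case using additive_graphD(2)[OF M(1)] by simp
        next
          case (Suc n) show ?case using additive_graphD(3)[OF M(1) Suc x] by (simp add: algebra_simps)
        qed
        show ?thesis
        proof (cases i)
          case (nonneg n) then show ?thesis using nat[of n] by (simp add: int_pow_int)
        next
          case (neg n)
          then show ?thesis using additive_graphD(4)[OF M(1) nat[of "Suc n"]] xc
            by (simp add: int_pow_neg_int del: of_nat_Suc nat_pow_Suc)
        qed
      qed
      have "u = of_int i * (v / of_int j)" if u: "(a [^] i, u) \<in> M" for i :: int and u
      proof -
        have "(a [^] (i * j), of_int j * u) \<in> M" "(a [^] (j * i), of_int i * v) \<in> M"
          using pow[OF u, of j] pow[OF j(2), of i] a by (simp_all add: int_pow_pow)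
        then have "of_int j * u = of_int i * v"
          using additive_graph_unique[OF M(1)] by (simp add: mult.commute)
        then show ?thesis using j(1) by (simp add: field_simps)
      qed
      then show ?thesis by blast
    qed
    then obtain r where "\<And>(i::int) u. (a [^] i, u) \<in> M \<Longrightarrow> u = of_int i * r" by blast
    then obtain R' where "additive_graph G R'" "M \<subseteq> R'" "(a, r) \<in> R'"
      using additive_graph_extend_by_element[OF M(1) a] by metis
    then show ?thesis using max by blast
  qed
  define f where "f x = (THE u. (x, u) \<in> M)" for x
  have f: "f x = u" if "(x, u) \<in> M" for x u
    unfolding f_def using that additive_graph_unique[OF M(1)] by blast
  have "additive_on G (carrier G) f"
    unfolding additive_on_def
  proof (intro ballI)
    fix x y assume "x \<in> carrier G" "y \<in> carrier G"
    then obtain u v where "(x, u) \<in> M" "(y, v) \<in> M" using total by blast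
    then show "f (x \<otimes> y) = f x + f y" using f additive_graphD(3)[OF M(1)] by metis
  qed
  then show thesis using that f M(2) by blast
qed

lemma (in group) additive_graph_of_additive_on:
  assumes K: "subgroup K G" and f: "additive_on G K f"
    and comm: "\<And>x y. x \<in> carrier G \<Longrightarrow> y \<in> carrier G \<Longrightarrow> commutator G x y \<in> K \<and> f (commutator G x y) = 0"
  shows "additive_graph G ((\<lambda>x. (x, f x)) ` K)" (is "additive_graph G ?R")
  unfolding additive_graph_def
proof (intro conjI allI impI ballI)
  show "fst ` ?R \<subseteq> carrier G" using subgroup.subset[OF K] by auto
  show "(\<one>, 0) \<in> ?R"
    using additive_on_one[OF f K] subgroup.one_closed[OF K] by force
  show "(commutator G x y, 0) \<in> ?R" if "x \<in> carrier G" "y \<in> carrier G" for x y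
    using comm[OF that] by force
  show "(inv x, - u) \<in> ?R" if "(x, u) \<in> ?R" for x u
    using that additive_on_inv[OF f K] subgroup.m_inv_closed[OF K] by (auto simp: image_iff)
  show "u = 0" if "(\<one>, u) \<in> ?R" for u
    using that additive_on_one[OF f K] by auto
  show "(x \<otimes> y, u + v) \<in> ?R"
    if "(x, u) \<in> ?R" "(y, v) \<in> ?R" for x u y v
    using that additive_on_mult[OF f] subgroup.m_closed[OF K] by (auto simp: image_iff)
qed

lemma (in group) additive_on_extend:
  assumes "subgroup K G" "additive_on G K f"
    and "\<And>x y. x \<in> carrier G \<Longrightarrow> y \<in> carrier G \<Longrightarrow> commutator G x y \<in> K \<and> f (commutator G x y) = 0"
  obtains F where "additive_on G (carrier G) F" "\<And>x. x \<in> K \<Longrightarrow> F x = f x"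
proof -
  obtain F where F: "additive_on G (carrier G) F" "\<And>x u. (x, u) \<in> (\<lambda>x. (x, f x)) ` K \<Longrightarrow> F x = u"
    using additive_graph_extend[OF additive_graph_of_additive_on[OF assms]] by blast
  show thesis by (rule that[OF F(1)]) (use F(2) in blast)
qed

lemma (in group) additive_on_detecting_infinite_order:
  assumes K: "subgroup K G" and comm: "\<And>x y. x \<in> carrier G \<Longrightarrow> y \<in> carrier G \<Longrightarrow> commutator G x y \<in> K"
    and a: "a \<in> carrier G" and inf: "\<And>k::nat. k > 0 \<Longrightarrow> a [^] k \<notin> K"
  obtains f where "additive_on G (carrier G) f" "\<And>x. x \<in> K \<Longrightarrow> f x = 0" "f a = 1"
proof -
  have R: "additive_graph G ((\<lambda>x. (x, 0)) ` K)"
    using additive_graph_of_additive_on[OF K, of "\<lambda>_. 0"] comm by (simp add: additive_on_def)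
  have "u = of_int i * 1" if "(a [^] i, u) \<in> (\<lambda>x. (x, 0)) ` K" for i :: int and u
  proof -
    have i: "a [^] i \<in> K" "u = 0" using that by auto
    have "i = 0"
    proof (rule ccontr)
      assume "i \<noteq> 0"
      moreover have "a [^] (nat \<bar>i\<bar>) \<in> K"
      proof (cases "i \<ge> 0")
        case True then show ?thesis using i by (simp flip: int_pow_int)
      next
        case False
        then have "a [^] (nat \<bar>i\<bar>) = inv (a [^] i)" using a
          by (simp flip: int_pow_int add: int_pow_neg)
        then show ?thesis using i K by (simp add: subgroup.m_inv_closed)
      qed
      ultimately show False using inf[of "nat \<bar>i\<bar>"] by simp
    qed
    then show ?thesis using i by simp
  qed
  then obtain R' where R': "additive_graph G R'" "(\<lambda>x. (x, 0)) ` K \<subseteq> R'" "(a, 1) \<in> R'"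
    using additive_graph_extend_by_element[OF R a, of 1] by blast
  obtain F where F: "additive_on G (carrier G) F" "\<And>x u. (x, u) \<in> R' \<Longrightarrow> F x = u"
    using additive_graph_extend[OF R'(1)] by blast
  show thesis by (rule that[OF F(1)]) (use F(2) R'(2,3) in blast)+
qed

section \<open>Subgroups of finite index\<close>

definition finite_index_in :: "('a, 'b) monoid_scheme \<Rightarrow> 'a set \<Rightarrow> 'a set \<Rightarrow> bool" where
  "finite_index_in G B K \<longleftrightarrow> (\<exists>R. finite R \<and> R \<subseteq> K \<and> (\<forall>k\<in>K. \<exists>r\<in>R. \<exists>b\<in>B. k = b \<otimes>\<^bsub>G\<^esub> r))"

lemma (in group) finite_index_in_refl:
  assumes "subgroup K G" shows "finite_index_in G K K"
  unfolding finite_index_in_def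
  by (rule exI[of _ "{\<one>}"]) (use assms in \<open>auto simp: subgroup.one_closed subgroup.mem_carrier\<close>)

lemma (in group) finite_index_in_trans:
  assumes BK: "finite_index_in G B K" and KL: "finite_index_in G K L"
    and sub: "K \<subseteq> L" "B \<subseteq> carrier G" "subgroup L G"
  shows "finite_index_in G B L"
proof -
  obtain R where R: "finite R" "R \<subseteq> K" "\<And>k. k \<in> K \<Longrightarrow> \<exists>r\<in>R. \<exists>b\<in>B. k = b \<otimes> r"
    using BK unfolding finite_index_in_def by blast
  obtain Q where Q: "finite Q" "Q \<subseteq> L" "\<And>k. k \<in> L \<Longrightarrow> \<exists>r\<in>Q. \<exists>b\<in>K. k = b \<otimes> r"
    using KL unfolding finite_index_in_def by blast
  let ?P = "(\<lambda>(r, q). r \<otimes> q) ` (R \<times> Q)"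
  have "\<exists>p\<in>?P. \<exists>b\<in>B. k = b \<otimes> p" if "k \<in> L" for k
  proof -
    obtain q a where q: "q \<in> Q" "a \<in> K" "k = a \<otimes> q" using Q(3)[OF \<open>k \<in> L\<close>] by blast
    obtain r b where r: "r \<in> R" "b \<in> B" "a = b \<otimes> r" using R(3)[OF q(2)] by blast
    have "b \<in> carrier G" "r \<in> carrier G" "q \<in> carrier G"
      using r q R(2) Q(2) sub subgroup.subset[OF sub(3)] by blast+
    then have "k = b \<otimes> (r \<otimes> q)" using q r by (simp add: m_assoc)
    moreover have "r \<otimes> q \<in> ?P" using r(1) q(1) by force
    ultimately show ?thesis using r(2) by blast
  qed
  moreover have "?P \<subseteq> L" using R(2) Q(2) sub(1) subgroup.m_closed[OF sub(3)] by (fastforce simp: subset_iff)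
  ultimately show ?thesis unfolding finite_index_in_def using R(1) Q(1)
    by (intro exI[of _ ?P]) auto
qed

lemma (in group) finite_index_in_iff_finite_rcosets:
  assumes H: "subgroup H G"
  shows "finite_index_in G H (carrier G) \<longleftrightarrow> finite (rcosets H)"
proof
  assume "finite_index_in G H (carrier G)"
  then obtain R where R: "finite R" "R \<subseteq> carrier G" "\<forall>k\<in>carrier G. \<exists>r\<in>R. \<exists>b\<in>H. k = b \<otimes> r"
    unfolding finite_index_in_def by blast
  have "rcosets H \<subseteq> (\<lambda>r. H #> r) ` R"
  proof
    fix C assume "C \<in> rcosets H"
    then obtain k where k: "k \<in> carrier G" "C = H #> k" by (auto simp: RCOSETS_def)
    then obtain r b where r: "r \<in> R" "b \<in> H" "k = b \<otimes> r" using R(3) by blast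
    then have "k \<in> H #> r" by (auto simp: r_coset_def)
    then have "H #> k = H #> r" using repr_independence[OF _ _ H] r(1) R(2) by blast
    then show "C \<in> (\<lambda>r. H #> r) ` R" using k r by blast
  qed
  then show "finite (rcosets H)" using R(1) finite_surj by blast
next
  assume fin: "finite (rcosets H)"
  define rep where "rep C = (SOME r. r \<in> C)" for C :: "'a set"
  have rep: "rep C \<in> C" if "C \<in> rcosets H" for C
    unfolding rep_def by (rule someI_ex)
      (metis that H is_group ex_in_conv subgroup.rcosets_non_empty)
  have "\<exists>r\<in>rep ` (rcosets H). \<exists>b\<in>H. k = b \<otimes> r" if k: "k \<in> carrier G" for k
  proof -
    have C: "H #> k \<in> rcosets H" using k subgroup.subset[OF H] by (auto simp: RCOSETS_def)
    then have "rep (H #> k) \<in> H #> k" using rep by blast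
    then obtain h where h: "h \<in> H" "rep (H #> k) = h \<otimes> k" by (auto simp: r_coset_def)
    then have "k = inv h \<otimes> rep (H #> k)" using k H by (simp add: subgroup.mem_carrier)
    then show ?thesis using C h H by (meson image_eqI subgroup.m_inv_closed bexI)
  qed
  moreover have "rep ` (rcosets H) \<subseteq> carrier G"
    using rep rcosets_part_G[OF H] by blast
  ultimately show "finite_index_in G H (carrier G)"
    unfolding finite_index_in_def using fin by blast
qed

lemma (in subgroup) coset_representatives:
  assumes "group G" "finite (rcosets H)"
  obtains R where "finite R" "R \<subseteq> carrier G" "\<forall>k\<in>carrier G. \<exists>r\<in>R. \<exists>b\<in>H. k = b \<otimes> r"
  using group.finite_index_in_iff_finite_rcosets[OF assms(1) subgroup_axioms] assms(2)
  unfolding finite_index_in_def by blast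

text \<open>Schreier's lemma: if \<open>R\<close> represents the cosets, then moving a representative by a generator
  and returning to a representative produces finitely many elements of the subgroup, and
  these generate it.\<close>

lemma (in group) schreier:
  assumes gens: "finite X'" "X' \<subseteq> carrier G" and K: "K = generate G X'"
    and B: "subgroup B G" "B \<subseteq> K" and fin: "finite_index_in G B K"
  obtains Y' where "finite Y'" "Y' \<subseteq> B" "generate G Y' = B"
proof -
  have KG: "subgroup K G" using K gens generate_is_subgroup by simp
  obtain R0 where R0: "finite R0" "R0 \<subseteq> K" "\<forall>k\<in>K. \<exists>r\<in>R0. \<exists>b\<in>B. k = b \<otimes> r"
    using fin unfolding finite_index_in_def by blast
  \<comment> \<open>With \<open>\<one>\<close> among the representatives, the argument below can start from it.\<close>
  define R where "R = insert \<one> R0"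
  have R: "finite R" "R \<subseteq> K" "\<And>k. k \<in> K \<Longrightarrow> \<exists>r\<in>R. \<exists>b\<in>B. k = b \<otimes> r" "\<one> \<in> R"
    using R0 subgroup.one_closed[OF KG] unfolding R_def by auto
  have Rc: "R \<subseteq> carrier G" and Bc: "B \<subseteq> carrier G"
    using R(2) subgroup.subset[OF KG] subgroup.subset[OF B(1)] by blast+
  define Z' where "Z' = X' \<union> (\<lambda>x. inv x) ` X'"
  have ZK: "Z' \<subseteq> K" unfolding Z'_def K by (auto intro: generate.incl generate.inv)
  have "\<exists>\<beta> \<rho>. \<forall>k\<in>K. \<rho> k \<in> R \<and> \<beta> k \<in> B \<and> k = \<beta> k \<otimes> \<rho> k"
    using R(3) by (metis (no_types))
  then obtain \<beta> \<rho> where \<beta>: "\<And>k. k \<in> K \<Longrightarrow> \<rho> k \<in> R \<and> \<beta> k \<in> B \<and> k = \<beta> k \<otimes> \<rho> k" by blast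
  define Y' where "Y' = (\<lambda>(r, z). \<beta> (r \<otimes> z)) ` (R \<times> Z') \<union> (R \<inter> B)"
  have RZ: "r \<otimes> z \<in> K" if "r \<in> R" "z \<in> Z'" for r z
    using that R(2) ZK subgroup.m_closed[OF KG] by blast
  have Y: "finite Y'" "Y' \<subseteq> B"
    using R(1) gens(1) \<beta> RZ unfolding Y'_def Z'_def by auto
  have YG: "subgroup (generate G Y') G" using Y(2) Bc by (intro generate_is_subgroup) blast
  have step: "\<exists>r'\<in>R. \<exists>y\<in>generate G Y'. r \<otimes> z = y \<otimes> r'" if "r \<in> R" "z \<in> Z'" for r z
    using that \<beta>[OF RZ[OF that]] unfolding Y'_def
    by (intro bexI[of _ "\<rho> (r \<otimes> z)"] bexI[of _ "\<beta> (r \<otimes> z)"]) (auto intro!: generate.incl)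
  have all: "\<forall>r\<in>R. \<exists>r'\<in>R. \<exists>y\<in>generate G Y'. r \<otimes> k = y \<otimes> r'" if "k \<in> generate G X'" for k
    using that
  proof (induction rule: generate.induct)
    case one
    show ?case
    proof
      fix r assume "r \<in> R"
      then show "\<exists>r'\<in>R. \<exists>y\<in>generate G Y'. r \<otimes> \<one> = y \<otimes> r'"
        using Rc subgroup.one_closed[OF YG] by (intro bexI[of _ r] bexI[of _ \<one>]) auto
    qed
  next
    case (incl h) then show ?case using step unfolding Z'_def by blast
  next
    case (inv h) then show ?case using step unfolding Z'_def by blast
  next
    case (eng h1 h2)
    show ?case
    proof
      fix r assume r: "r \<in> R"
      obtain r1 y1 where 1: "r1 \<in> R" "y1 \<in> generate G Y'" "r \<otimes> h1 = y1 \<otimes> r1"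
        using eng.IH(1) r by blast
      obtain r2 y2 where 2: "r2 \<in> R" "y2 \<in> generate G Y'" "r1 \<otimes> h2 = y2 \<otimes> r2"
        using eng.IH(2) 1(1) by blast
      have c: "h1 \<in> carrier G" "h2 \<in> carrier G" "y1 \<in> carrier G" "y2 \<in> carrier G"
          "r \<in> carrier G" "r1 \<in> carrier G" "r2 \<in> carrier G"
        using eng.hyps gens(2) 1 2 r Rc subgroup.subset[OF YG] generate_in_carrier by blast+
      have "r \<otimes> (h1 \<otimes> h2) = (y1 \<otimes> r1) \<otimes> h2" using c 1(3) by (simp add: m_assoc [symmetric])
      also have "\<dots> = y1 \<otimes> (y2 \<otimes> r2)" using c 2(3) by (simp add: m_assoc)
      also have "\<dots> = (y1 \<otimes> y2) \<otimes> r2" using c by (simp add: m_assoc)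
      finally have "r \<otimes> (h1 \<otimes> h2) = (y1 \<otimes> y2) \<otimes> r2" .
      then show "\<exists>r'\<in>R. \<exists>y\<in>generate G Y'. r \<otimes> (h1 \<otimes> h2) = y \<otimes> r'"
        using 2(1) generate.eng[OF 1(2) 2(2)] by blast
    qed
  qed
  have "B \<subseteq> generate G Y'"
  proof
    fix b assume b: "b \<in> B"
    then have bc: "b \<in> carrier G" using Bc by blast
    obtain r y where r: "r \<in> R" "y \<in> generate G Y'" "b = y \<otimes> r"
      using all[of b] b B(2) K R(4) bc by force
    have yB: "y \<in> B" using r(2) generate_subgroup_incl[OF Y(2) B(1)] by blast
    have "r = inv y \<otimes> b" using r yB Bc Rc by (simp add: subset_iff)
    then have "r \<in> B" using yB b B(1) by (simp add: subgroup.m_closed subgroup.m_inv_closed)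
    then have "r \<in> generate G Y'" using r(1) unfolding Y'_def by (intro generate.incl) blast
    then show "b \<in> generate G Y'" using r generate.eng by metis
  qed
  moreover have "generate G Y' \<subseteq> B" using generate_subgroup_incl[OF Y(2) B(1)] .
  ultimately show thesis using that[of Y'] Y by blast
qed

lemma (in group) finite_index_in_adjoin_element:
  assumes H: "subgroup H G" and x: "x \<in> carrier G"
    and norm: "\<And>h. h \<in> H \<Longrightarrow> x \<otimes> h \<otimes> inv x \<in> H \<and> inv x \<otimes> h \<otimes> x \<in> H"
    and j: "(j::nat) > 0" "x [^] j \<in> H"
  shows "finite_index_in G H (generate G (insert x H))"
proof -
  let ?K = "generate G (insert x H)"
  have Hc: "h \<in> H \<Longrightarrow> h \<in> carrier G" for h using subgroup.subset[OF H] by blast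
  have KG: "subgroup ?K G" using Hc x by (intro generate_is_subgroup) blast
  have HK: "h \<in> H \<Longrightarrow> h \<in> ?K" for h by (simp add: generate.incl)
  have xK: "x [^] (n::nat) \<in> ?K" for n
    by (rule subgroup.pow_mem[OF KG is_group]) (simp add: generate.incl)
  have conj: "x [^] (n::nat) \<otimes> h \<otimes> inv (x [^] n) \<in> H" if h: "h \<in> H" for h n
  proof (induction n)
    case 0 then show ?case using h Hc by simp
  next
    case (Suc n)
    have "x [^] Suc n \<otimes> h \<otimes> inv (x [^] Suc n) = x \<otimes> (x [^] n \<otimes> h \<otimes> inv (x [^] n)) \<otimes> inv x"
      using x h Hc by (simp only: nat_pow_Suc2) (simp add: group_word_simps)
    then show ?case using norm[OF Suc] by metis
  qed
  have xjq: "x [^] (j * q) \<in> H" for q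
    using subgroup.pow_mem[OF H is_group j(2), of q] x by (simp add: nat_pow_pow)
  have all: "\<exists>n::nat. \<exists>h\<in>H. k = h \<otimes> x [^] n" if "k \<in> ?K" for k
    using that
  proof (induction rule: generate.induct)
    case one
    show ?case using subgroup.one_closed[OF H] by (intro exI[of _ 0] bexI[of _ \<one>]) auto
  next
    case (incl h)
    show ?case
    proof (cases "h = x")
      case True
      then show ?thesis using subgroup.one_closed[OF H] x by (intro exI[of _ 1] bexI[of _ \<one>]) auto
    next
      case False
      then show ?thesis using incl Hc by (intro exI[of _ 0] bexI[of _ h]) auto
    qed
  next
    case (inv h)
    show ?case
    proof (cases "h = x")
      case True
      have "x [^] j = x \<otimes> x [^] (j - 1)" using j(1) x nat_pow_Suc2[of x "j - 1"] by simp
      then have "inv x = inv (x [^] j) \<otimes> x [^] (j - 1)"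
        using x by (metis inv_mult_cancel(1) nat_pow_closed inv_closed inv_comm inv_mult_group
            m_assoc m_closed nat_pow_Suc2 nat_pow_Suc r_inv r_one)
      then show ?thesis using True subgroup.m_inv_closed[OF H j(2)] by blast
    next
      case False
      then show ?thesis using inv Hc subgroup.m_inv_closed[OF H]
        by (intro exI[of _ 0] bexI[of _ "inv h"]) auto
    qed
  next
    case (eng k1 k2)
    then obtain n1 n2 :: nat and h1 h2 where k: "h1 \<in> H" "k1 = h1 \<otimes> x [^] n1"
      "h2 \<in> H" "k2 = h2 \<otimes> x [^] n2" by blast
    have "k1 \<otimes> k2 = (h1 \<otimes> (x [^] n1 \<otimes> h2 \<otimes> inv (x [^] n1))) \<otimes> x [^] (n1 + n2)"
      using k x Hc by (simp add: group_word_simps nat_pow_mult [symmetric])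
    then show ?case using conj[OF k(3)] subgroup.m_closed[OF H k(1)] by blast
  qed
  have "\<exists>r\<in>(\<lambda>i. x [^] i) ` {..<j}. \<exists>b\<in>H. k = b \<otimes> r" if "k \<in> ?K" for k
  proof -
    obtain n h where n: "h \<in> H" "k = h \<otimes> x [^] (n::nat)" using all[OF \<open>k \<in> ?K\<close>] by blast
    have "x [^] n = x [^] (j * (n div j)) \<otimes> x [^] (n mod j)" using x by (simp add: nat_pow_mult)
    then have "k = (h \<otimes> x [^] (j * (n div j))) \<otimes> x [^] (n mod j)"
      using n x Hc by (simp add: m_assoc)
    moreover have "x [^] (n mod j) \<in> (\<lambda>i. x [^] i) ` {..<j}" using j(1) by simp
    ultimately show ?thesis using subgroup.m_closed[OF H n(1) xjq] by blast
  qed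
  then show ?thesis unfolding finite_index_in_def using xK
    by (intro exI[of _ "(\<lambda>i. x [^] i) ` {..<j}"]) auto
qed

lemma (in group) finite_index_in_of_abelian_torsion_quotient:
  assumes gens: "finite X'" "X' \<subseteq> carrier G" and K: "K = generate G X'"
    and B: "subgroup B G" "B \<subseteq> K"
    and comm: "\<And>x y. x \<in> K \<Longrightarrow> y \<in> K \<Longrightarrow> commutator G x y \<in> B"
    and tors: "\<And>x. x \<in> K \<Longrightarrow> \<exists>j::nat. j > 0 \<and> x [^] j \<in> B"
  shows "finite_index_in G B K"
proof -
  have Bc: "B \<subseteq> carrier G" using subgroup.subset[OF B(1)] .
  have KG: "subgroup K G" using K gens generate_is_subgroup by simp
  have Kc: "k \<in> K \<Longrightarrow> k \<in> carrier G" for k using subgroup.subset[OF KG] by blast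
  have XK: "X' \<subseteq> K" unfolding K by (auto intro: generate.incl)
  have "finite_index_in G B (generate G (B \<union> F))" if "finite F" "F \<subseteq> X'" for F
    using that
  proof (induction rule: finite_induct)
    case empty
    have "generate G B = B" using generateI[OF B(1)] by blast
    then show ?case using finite_index_in_refl[OF B(1)] by simp
  next
    case (insert x F)
    let ?H = "generate G (B \<union> F)"
    have Fc: "F \<subseteq> carrier G" using insert.prems gens(2) by blast
    have H: "subgroup ?H G" using Bc Fc by (intro generate_is_subgroup) blast
    have HK: "?H \<subseteq> K" using generate_subgroup_incl[OF _ KG, of "B \<union> F"] B(2) XK insert.prems by blast
    have BH: "B \<subseteq> ?H" by (auto intro: generate.incl)
    have xK: "x \<in> K" and xc: "x \<in> carrier G" using insert.prems XK gens(2) by blast+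
    have conj: "k \<otimes> h \<otimes> inv k \<in> ?H" if "k \<in> K" "h \<in> ?H" for k h
      using conj_eq_commutator_mult[OF Kc[OF that(1)], of h] that HK Kc comm[of k h] BH
        subgroup.m_closed[OF H] by (metis subsetD)
    obtain j where j: "(j::nat) > 0" "x [^] j \<in> B" using tors[OF xK] by blast
    have "finite_index_in G ?H (generate G (insert x ?H))"
    proof (rule finite_index_in_adjoin_element[OF H xc _ j(1)])
      show "x [^] j \<in> ?H" using j(2) BH by blast
      show "x \<otimes> h \<otimes> inv x \<in> ?H \<and> inv x \<otimes> h \<otimes> x \<in> ?H" if "h \<in> ?H" for h
        using conj[OF xK that] conj[OF subgroup.m_inv_closed[OF KG xK] that] xc by simp
    qed
    moreover have "generate G (insert x ?H) = generate G (B \<union> insert x F)"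
    proof
      have S: "subgroup (generate G (B \<union> insert x F)) G"
        using Bc Fc xc by (intro generate_is_subgroup) blast
      have "?H \<subseteq> generate G (B \<union> insert x F)" using mono_generate[of "B \<union> F" "B \<union> insert x F"] by blast
      then show "generate G (insert x ?H) \<subseteq> generate G (B \<union> insert x F)"
        using generate_subgroup_incl[OF _ S, of "insert x ?H"] by (simp add: generate.incl)
      show "generate G (B \<union> insert x F) \<subseteq> generate G (insert x ?H)"
        by (rule mono_generate) (auto intro: generate.incl)
    qed
    ultimately have 1: "finite_index_in G ?H (generate G (B \<union> insert x F))" by simp
    show ?case
    proof (rule finite_index_in_trans[OF _ 1 _ Bc])
      show "finite_index_in G B ?H" using insert by blast
      show "?H \<subseteq> generate G (B \<union> insert x F)" by (rule mono_generate) blast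
      show "subgroup (generate G (B \<union> insert x F)) G"
        using Bc Fc xc by (intro generate_is_subgroup) blast
    qed
  qed
  from this[OF gens(1) subset_refl] have "finite_index_in G B (generate G (B \<union> X'))" .
  moreover have "generate G (B \<union> X') = K"
    using generate_subgroup_incl[OF _ KG, of "B \<union> X'"] B(2) XK mono_generate[of X' "B \<union> X'"] K by blast
  ultimately show ?thesis by simp
qed

section \<open>Bilinear forms from the lower central series\<close>

declare lower_central.simps(2) [simp del]

lemma (in group) lower_central_Suc:
  "lower_central G (Suc i) = generate G {commutator G z y | z y. z \<in> lower_central G i \<and> y \<in> carrier G}"
  by (auto simp: lower_central.simps(2) commutator_subgroup_def commutator_def intro!: arg_cong[of _ _ "generate G"])

lemma (in group) normal_lower_central: "lower_central G i \<lhd> G"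
proof (induction i)
  case 0
  then show ?case by (simp add: normal_inv_iff subgroup_self)
next
  case (Suc i)
  then interpret N: normal "lower_central G i" G .
  let ?C = "{commutator G z y | z y. z \<in> lower_central G i \<and> y \<in> carrier G}"
  have c: "z \<in> carrier G" if "z \<in> lower_central G i" for z using that N.subset by blast
  show ?case unfolding lower_central_Suc
  proof (rule normal_generateI)
    show "?C \<subseteq> carrier G" using c by auto
    fix h g assume h: "h \<in> ?C" and g: "g \<in> carrier G"
    then obtain z y where z: "z \<in> lower_central G i" "y \<in> carrier G" "h = commutator G z y" by blast
    have "g \<otimes> h \<otimes> inv g = commutator G (g \<otimes> z \<otimes> inv g) (g \<otimes> y \<otimes> inv g)"
      using z c g by (simp add: commutator_def group_word_simps)
    then show "g \<otimes> h \<otimes> inv g \<in> ?C" using N.inv_op_closed2[OF g z(1)] z(2) g by blast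
  qed
qed

lemma (in group) lower_central_subgroup: "subgroup (lower_central G i) G"
  using normal_lower_central normal_imp_subgroup by blast

lemma (in group) lower_central_closed: "z \<in> lower_central G i \<Longrightarrow> z \<in> carrier G"
  using lower_central_subgroup subgroup.mem_carrier by metis

lemma (in group) commutator_in_lower_central:
  assumes "z \<in> lower_central G i" "y \<in> carrier G"
  shows "commutator G z y \<in> lower_central G (Suc i)" "commutator G y z \<in> lower_central G (Suc i)"
proof -
  show 1: "commutator G z y \<in> lower_central G (Suc i)"
    unfolding lower_central_Suc using assms by (blast intro: generate.incl)
  show "commutator G y z \<in> lower_central G (Suc i)"
    using subgroup.m_inv_closed[OF lower_central_subgroup 1] assms lower_central_closed
    by (simp add: inv_commutator)
qed

lemma (in group) lower_central_antimono: "lower_central G (Suc i) \<subseteq> lower_central G i"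
proof -
  interpret N: normal "lower_central G i" G by (rule normal_lower_central)
  show ?thesis unfolding lower_central_Suc
  proof (rule generate_subgroup_incl[OF _ N.subgroup_axioms], safe)
    fix z y assume z: "z \<in> lower_central G i" "y \<in> carrier G"
    have "commutator G z y = z \<otimes> (y \<otimes> inv z \<otimes> inv y)"
      using z lower_central_closed by (simp add: commutator_def m_assoc)
    then show "commutator G z y \<in> lower_central G i"
      using N.inv_op_closed2[OF z(2) N.m_inv_closed[OF z(1)]] z(1) by simp
  qed
qed

lemma (in group) commutator_mult_left:
  assumes "x \<in> carrier G" "x' \<in> carrier G" "y \<in> carrier G"
  shows "commutator G (x \<otimes> x') y = x \<otimes> commutator G x' y \<otimes> inv x \<otimes> commutator G x y"
  using assms by (simp add: commutator_def group_word_simps)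

lemma (in group) commutator_mult_right:
  assumes "x \<in> carrier G" "y \<in> carrier G" "y' \<in> carrier G"
  shows "commutator G x (y \<otimes> y') = commutator G x y \<otimes> (y \<otimes> commutator G x y' \<otimes> inv y)"
  using assms by (simp add: commutator_def group_word_simps)

lemma (in group) commutator_inv_left:
  assumes "x \<in> carrier G" "y \<in> carrier G"
  shows "commutator G (inv x) y = inv x \<otimes> inv (commutator G x y) \<otimes> x"
  using assms by (simp add: commutator_def group_word_simps)

lemma (in group) commutator_inv_right:
  assumes "x \<in> carrier G" "y \<in> carrier G"
  shows "commutator G x (inv y) = inv y \<otimes> inv (commutator G x y) \<otimes> y"
  using assms by (simp add: commutator_def group_word_simps)

lemma (in group) commutator_pow_of_commuting:
  assumes x: "x \<in> carrier G" and y: "y \<in> carrier G"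
    and comm: "x \<otimes> commutator G x y = commutator G x y \<otimes> x"
  shows "commutator G (x [^] (k::nat)) y = commutator G x y [^] k"
proof (induction k)
  case 0
  then show ?case using y by (simp add: commutator_def)
next
  case (Suc k)
  let ?z = "commutator G x y"
  have z: "?z \<in> carrier G" using x y by simp
  have xz: "x [^] k \<otimes> ?z = ?z \<otimes> x [^] k" for k :: nat
  proof (induction k)
    case 0 then show ?case using z by simp
  next
    case (Suc k)
    have "x [^] Suc k \<otimes> ?z = x [^] k \<otimes> (x \<otimes> ?z)" using x z by (simp add: m_assoc)
    also have "\<dots> = (x [^] k \<otimes> ?z) \<otimes> x" using x z comm by (simp add: m_assoc)
    finally show ?case using Suc x z by (simp add: m_assoc)
  qed
  have "commutator G (x [^] Suc k) y = (x [^] k \<otimes> ?z) \<otimes> inv (x [^] k) \<otimes> commutator G (x [^] k) y"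
    using x y by (simp add: commutator_mult_left)
  also have "\<dots> = ?z \<otimes> ?z [^] k" using xz Suc x z by (simp add: m_assoc)
  finally show ?case using nat_pow_Suc2[OF z, of k] by simp
qed

lemma (in group) commuting_if_commutator_one:
  assumes "x \<in> carrier G" "y \<in> carrier G"
  shows "commutator G x y = \<one> \<longleftrightarrow> x \<otimes> y = y \<otimes> x"
proof -
  have 1: "commutator G x y \<otimes> (y \<otimes> x) = x \<otimes> y"
    using assms by (simp add: commutator_def group_word_simps)
  have 2: "commutator G x y = (x \<otimes> y) \<otimes> inv (y \<otimes> x)"
    using assms by (simp add: commutator_def group_word_simps)
  show ?thesis
  proof
    assume "commutator G x y = \<one>"
    then show "x \<otimes> y = y \<otimes> x" using 1 assms by simp
  next
    assume "x \<otimes> y = y \<otimes> x"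
    then show "commutator G x y = \<one>" using 2 assms by simp
  qed
qed

lemma (in normal) quotient_map:
  "group_hom G (G Mod H) ((#>) H)" "x \<in> carrier G \<Longrightarrow> H #> x = \<one>\<^bsub>G Mod H\<^esub> \<longleftrightarrow> x \<in> H"
proof -
  show "group_hom G (G Mod H) ((#>) H)"
    using r_coset_hom_Mod factorgroup_is_group by (simp add: group_hom.intro group_hom_axioms_def)
  show "x \<in> carrier G \<Longrightarrow> H #> x = \<one>\<^bsub>G Mod H\<^esub> \<longleftrightarrow> x \<in> H"
    unfolding one_FactGroup
    using coset_join1[OF _ _ subgroup_axioms, of x] coset_join2[OF _ subgroup_axioms, of x] by blast
qed

lemma (in group_hom) hom_commutator:
  "x \<in> carrier G \<Longrightarrow> y \<in> carrier G \<Longrightarrow> h (commutator G x y) = commutator H (h x) (h y)"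
  by (simp add: commutator_def)

lemma (in normal) commutator_pow_mod:
  assumes x: "x \<in> carrier G" and y: "y \<in> carrier G"
    and comm: "commutator G x (commutator G x y) \<in> H"
  shows "commutator G (x [^] (k::nat)) y \<in> H \<longleftrightarrow> commutator G x y [^] k \<in> H"
proof -
  interpret q: group_hom G "G Mod H" "(#>) H" by (rule quotient_map)
  let ?z = "commutator G x y"
  have "commutator (G Mod H) (H #> x) (H #> ?z) = \<one>\<^bsub>G Mod H\<^esub>"
    using quotient_map(2)[of "commutator G x ?z"] comm x y q.hom_commutator
    by (simp del: one_FactGroup mult_FactGroup)
  then have "commutator (G Mod H) ((H #> x) [^]\<^bsub>G Mod H\<^esub> k) (H #> y) = (H #> ?z) [^]\<^bsub>G Mod H\<^esub> k"
    using q.H.commutator_pow_of_commuting[of "H #> x" "H #> y" k] x y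
    by (simp add: q.H.commuting_if_commutator_one q.hom_commutator del: q.hom_mult one_FactGroup mult_FactGroup)
  then have "H #> commutator G (x [^] k) y = H #> (?z [^] k)"
    using x y by (simp add: q.hom_commutator q.hom_nat_pow del: one_FactGroup mult_FactGroup)
  then show ?thesis using quotient_map(2)[of "commutator G (x [^] k) y"] quotient_map(2)[of "?z [^] k"]
    x y by simp
qed

lemma (in normal) pow_mult_mod:
  assumes x: "x \<in> carrier G" and y: "y \<in> carrier G" and comm: "commutator G x y \<in> H"
    and k: "x [^] (k::nat) \<in> H" "y [^] k \<in> H"
  shows "(x \<otimes> y) [^] k \<in> H"
proof -
  interpret q: group_hom G "G Mod H" "(#>) H" by (rule quotient_map)
  have "commutator (G Mod H) (H #> x) (H #> y) = \<one>\<^bsub>G Mod H\<^esub>"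
    using quotient_map(2)[of "commutator G x y"] comm x y q.hom_commutator
    by (simp del: one_FactGroup mult_FactGroup)
  then have "(H #> x) \<otimes>\<^bsub>G Mod H\<^esub> (H #> y) = (H #> y) \<otimes>\<^bsub>G Mod H\<^esub> (H #> x)"
    using x y by (simp add: q.H.commuting_if_commutator_one del: q.hom_mult one_FactGroup mult_FactGroup)
  then have "H #> ((x \<otimes> y) [^] k) = (H #> (x [^] k)) \<otimes>\<^bsub>G Mod H\<^esub> (H #> (y [^] k))"
    using x y q.H.pow_mult_distrib[of "H #> x" "H #> y" k] by (simp add: q.hom_nat_pow del: one_FactGroup mult_FactGroup)
  also have "\<dots> = \<one>\<^bsub>G Mod H\<^esub>"
  proof -
    have "H #> (x [^] k) = \<one>\<^bsub>G Mod H\<^esub>" "H #> (y [^] k) = \<one>\<^bsub>G Mod H\<^esub>"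
      using quotient_map(2)[of "x [^] k"] quotient_map(2)[of "y [^] k"] k x y by blast+
    then show ?thesis using q.H.l_one[OF q.H.one_closed] by metis
  qed
  finally show ?thesis using quotient_map(2)[of "(x \<otimes> y) [^] k"] x y by blast
qed

lemma (in subgroup) pow_multiple_mem:
  assumes "group G" "x \<in> carrier G" "x [^]\<^bsub>G\<^esub> (k::nat) \<in> H" shows "x [^]\<^bsub>G\<^esub> (k * l) \<in> H"
proof -
  interpret group G by fact
  show ?thesis using pow_mem[OF assms(1,3), of l] assms(2) by (simp add: nat_pow_pow)
qed

text \<open>Modulo the next term of the lower central series, the commutator is multiplicative in its first
  argument. So a power that brings \<open>z\<close> one term down also brings \<open>commutator G z y\<close> one term down.\<close>

lemma (in group) lower_central_torsion:
  assumes tors: "\<And>z. z \<in> lower_central G 1 \<Longrightarrow> \<exists>k::nat. k > 0 \<and> z [^] k \<in> lower_central G 2"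
    and z: "z \<in> lower_central G (Suc i)"
  shows "\<exists>k::nat. k > 0 \<and> z [^] k \<in> lower_central G (Suc (Suc i))"
  using z
proof (induction i arbitrary: z)
  case 0
  then show ?case using tors by (simp add: numeral_2_eq_2)
next
  case (Suc i)
  let ?M = "lower_central G (Suc (Suc (Suc i)))"
  interpret M: normal ?M G by (rule normal_lower_central)
  have c: "z \<in> carrier G" if "z \<in> lower_central G j" for z j using that by (rule lower_central_closed)
  have gen: "\<exists>k::nat. k > 0 \<and> commutator G z y [^] k \<in> ?M"
    if z: "z \<in> lower_central G (Suc i)" and y: "y \<in> carrier G" for z y
  proof -
    obtain k where k: "(k::nat) > 0" "z [^] k \<in> lower_central G (Suc (Suc i))"
      using Suc.IH[OF z] by blast
    have "commutator G (z [^] k) y \<in> ?M" using commutator_in_lower_central(1)[OF k(2) y] .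
    moreover have "commutator G z (commutator G z y) \<in> ?M"
      by (rule commutator_in_lower_central(2)[OF commutator_in_lower_central(1)[OF z y] c[OF z]])
    ultimately show ?thesis using M.commutator_pow_mod[OF c[OF z] y, of k] k(1) by blast
  qed
  have "z \<in> generate G {commutator G z y | z y. z \<in> lower_central G (Suc i) \<and> y \<in> carrier G}"
    using Suc.prems unfolding lower_central_Suc[of "Suc i"] .
  then have "z \<in> lower_central G (Suc (Suc i)) \<and> (\<exists>k::nat. k > 0 \<and> z [^] k \<in> ?M)"
  proof (induction rule: generate.induct)
    case one
    show ?case using subgroup.one_closed[OF lower_central_subgroup]
      by (auto intro: exI[of _ 1])
  next
    case (incl h) then show ?case using gen commutator_in_lower_central(1) by blast
  next
    case (inv h)
    then have h: "h \<in> lower_central G (Suc (Suc i))" using commutator_in_lower_central(1) by blast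
    obtain k where k: "(k::nat) > 0" "h [^] k \<in> ?M" using inv gen by blast
    have "inv h [^] k \<in> ?M" using M.m_inv_closed[OF k(2)] c[OF h] by (simp add: nat_pow_inv)
    then show ?case using subgroup.m_inv_closed[OF lower_central_subgroup h] k(1) by blast
  next
    case (eng h1 h2)
    then obtain k1 k2 :: nat where k: "k1 > 0" "h1 [^] k1 \<in> ?M" "k2 > 0" "h2 [^] k2 \<in> ?M" by blast
    have h: "h1 \<in> lower_central G (Suc (Suc i))" "h2 \<in> lower_central G (Suc (Suc i))"
      using eng.IH by blast+
    have "(h1 \<otimes> h2) [^] (k1 * k2) \<in> ?M"
    proof (rule M.pow_mult_mod)
      show "commutator G h1 h2 \<in> ?M" using commutator_in_lower_central(1)[OF h(1) c[OF h(2)]] .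
      show "h1 [^] (k1 * k2) \<in> ?M" using M.pow_multiple_mem[OF is_group c[OF h(1)] k(2)] .
      show "h2 [^] (k1 * k2) \<in> ?M" using M.pow_multiple_mem[OF is_group c[OF h(2)] k(4), of k1]
        by (simp add: mult.commute)
      show "h1 \<in> carrier G" "h2 \<in> carrier G" using h c by blast+
    qed
    then show ?case using k subgroup.m_closed[OF lower_central_subgroup h] by (meson nat_0_less_mult_iff)
  qed
  then show ?case by blast
qed

text \<open>For normal \<open>M\<close> this is the preimage of the centre of the quotient by \<open>M\<close>.\<close>

definition central_mod :: "('a, 'b) monoid_scheme \<Rightarrow> 'a set \<Rightarrow> 'a set" where
  "central_mod G M = {x \<in> carrier G. \<forall>y\<in>carrier G. commutator G x y \<in> M}"

lemma (in normal) central_mod_subgroup: "subgroup (central_mod G H) G"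
proof (rule subgroupI)
  show "central_mod G H \<subseteq> carrier G" by (auto simp: central_mod_def)
  have "commutator G \<one> y \<in> H" if "y \<in> carrier G" for y using that by (simp add: commutator_def)
  then show "central_mod G H \<noteq> {}" unfolding central_mod_def by blast
  fix x assume x: "x \<in> central_mod G H"
  have "commutator G (inv x) y \<in> H" if "y \<in> carrier G" for y
    using inv_op_closed1[of x "inv (commutator G x y)"] x that
    by (simp add: commutator_inv_left central_mod_def)
  then show "inv x \<in> central_mod G H" using x by (simp add: central_mod_def)
  fix x' assume x': "x' \<in> central_mod G H"
  have "commutator G (x \<otimes> x') y \<in> H" if "y \<in> carrier G" for y
    using inv_op_closed2[of x "commutator G x' y"] x x' that
    by (simp add: commutator_mult_left central_mod_def)
  then show "x \<otimes> x' \<in> central_mod G H" using x x' by (simp add: central_mod_def)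
qed

lemma (in normal) commutator_mem_of_generators:
  assumes x: "x \<in> carrier G" and Y': "Y' \<subseteq> carrier G"
    and comm: "\<And>y. y \<in> Y' \<Longrightarrow> commutator G x y \<in> H" and y: "y \<in> generate G Y'"
  shows "commutator G x y \<in> H"
  using y
proof (induction rule: generate.induct)
  case one show ?case using x by (simp add: commutator_def)
next
  case (incl h) then show ?case by (rule comm)
next
  case (inv h)
  then show ?case using inv_op_closed1[of h "inv (commutator G x h)"] comm[OF inv] x Y'
    by (simp add: commutator_inv_right subset_iff)
next
  case (eng h1 h2)
  then have "h1 \<in> carrier G" "h2 \<in> carrier G" using generate_in_carrier[OF Y'] by blast+
  then show ?case using inv_op_closed2[of h1 "commutator G x h2"] eng.IH x
    by (simp add: commutator_mult_right)
qed

text \<open>The preimages of the centres of the quotients by the terms of the lower central series form a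
  descending chain. It starts at the whole group, and each step has a finitely generated abelian
  torsion group as quotient, which is finite. Schreier's lemma carries finite generation along the chain.\<close>

lemma (in group) central_mod_finite_index:
  assumes gens: "finite Y'" "Y' \<subseteq> carrier G" "generate G Y' = carrier G"
    and tors: "\<And>z. z \<in> lower_central G 1 \<Longrightarrow> \<exists>k::nat. k > 0 \<and> z [^] k \<in> lower_central G 2"
  shows "finite_index_in G (central_mod G (lower_central G (Suc i))) (carrier G)"
proof (induction i)
  case 0
  have "central_mod G (lower_central G (Suc 0)) = carrier G"
    using commutator_in_lower_central(1)[of _ 0] by (auto simp: central_mod_def)
  then show ?case using finite_index_in_refl[OF subgroup_self] by simp
next
  case (Suc i)
  let ?M = "lower_central G (Suc i)" and ?M' = "lower_central G (Suc (Suc i))"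
  let ?K = "central_mod G ?M" and ?B = "central_mod G ?M'"
  interpret M: normal ?M G by (rule normal_lower_central)
  interpret M': normal ?M' G by (rule normal_lower_central)
  have BK: "?B \<subseteq> ?K" using lower_central_antimono[of "Suc i"] unfolding central_mod_def by blast
  obtain X' where X': "finite X'" "X' \<subseteq> ?K" "generate G X' = ?K"
    using schreier[OF gens(1,2) gens(3)[symmetric] M.central_mod_subgroup _ Suc]
    by (auto simp: central_mod_def)
  have Kc: "?K \<subseteq> carrier G" by (auto simp: central_mod_def)
  have Kcomm: "commutator G x y \<in> ?M" if "x \<in> ?K" "y \<in> carrier G" for x y
    using that by (simp add: central_mod_def)
  have "finite_index_in G ?B ?K"
  proof (rule finite_index_in_of_abelian_torsion_quotient[OF X'(1) _ X'(3)[symmetric] M'.central_mod_subgroup BK])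
    show "X' \<subseteq> carrier G" using X'(2) Kc by blast
    fix x assume x: "x \<in> ?K"
    have xc: "x \<in> carrier G" using x Kc by blast
    {
      fix y assume y: "y \<in> ?K"
      then have yc: "y \<in> carrier G" using Kc by blast
      show "commutator G x y \<in> ?B" unfolding central_mod_def
        using commutator_in_lower_central(1)[OF Kcomm[OF x yc]] xc yc
        by simp
    }
    have "\<exists>k::nat. k > 0 \<and> commutator G x y [^] k \<in> ?M'" if "y \<in> carrier G" for y
      using lower_central_torsion[OF tors Kcomm[OF x that]] by blast
    then have "\<exists>k. \<forall>y\<in>Y'. k y > (0::nat) \<and> commutator G x y [^] k y \<in> ?M'"
      using gens(2) by (intro bchoice) blast
    then obtain k where k: "\<And>y. y \<in> Y' \<Longrightarrow> k y > (0::nat) \<and> commutator G x y [^] k y \<in> ?M'" by blast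
    define j where "j = prod k Y'"
    have "commutator G (x [^] j) y \<in> ?M'" if y: "y \<in> Y'" for y
    proof -
      have yc: "y \<in> carrier G" using y gens(2) by blast
      have "k y dvd j" unfolding j_def using gens(1) y by (rule dvd_prodI)
      then obtain l where "j = k y * l" by blast
      then have "commutator G x y [^] j \<in> ?M'"
        using M'.pow_multiple_mem[OF is_group commutator_closed[OF xc yc]] k[OF y] by blast
      moreover have "commutator G x (commutator G x y) \<in> ?M'"
        by (rule commutator_in_lower_central(2)[OF Kcomm[OF x yc] xc])
      ultimately show ?thesis using M'.commutator_pow_mod[OF xc yc, of j] by blast
    qed
    then have "commutator G (x [^] j) y \<in> ?M'" if "y \<in> carrier G" for y
      using M'.commutator_mem_of_generators[OF _ gens(2), of "x [^] j" y] xc that gens(3) by simp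
    then have "x [^] j \<in> ?B" using xc by (simp add: central_mod_def)
    moreover have "j > 0" unfolding j_def using k by (simp add: prod_pos)
    ultimately show "\<exists>j::nat. j > 0 \<and> x [^] j \<in> ?B" by blast
  qed
  then show ?case by (rule finite_index_in_trans[OF _ Suc Kc _ subgroup_self]) (use BK Kc in blast)
qed

lemma (in group) commutator_restrict:
  assumes "subgroup H G" "x \<in> H" "y \<in> H"
  shows "commutator (G\<lparr>carrier := H\<rparr>) x y = commutator G x y"
  using assms by (simp add: commutator_def)

lemma additive_on_restrict [simp]: "additive_on (G\<lparr>carrier := H\<rparr>) K f \<longleftrightarrow> additive_on G K f"
  by (simp add: additive_on_def)

lemma (in group) additive_on_derived_eq_zero:
  assumes K: "subgroup K G" "lower_central G 1 \<subseteq> K" and f: "additive_on G K f"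
    and zero: "\<And>x y. x \<in> carrier G \<Longrightarrow> y \<in> carrier G \<Longrightarrow> f (commutator G x y) = 0"
    and z: "z \<in> lower_central G 1"
  shows "f z = 0"
proof -
  have mem: "commutator G x y \<in> K" if "x \<in> carrier G" "y \<in> carrier G" for x y
    using commutator_in_lower_central(1)[of x 0 y] that K(2) by auto
  have "z \<in> generate G {commutator G z y | z y. z \<in> lower_central G 0 \<and> y \<in> carrier G}"
    using z lower_central_Suc[of 0] by simp
  then have "z \<in> K \<and> f z = 0"
  proof (induction rule: generate.induct)
    case one then show ?case using additive_on_one[OF f K(1)] subgroup.one_closed[OF K(1)] by simp
  next
    case (incl h) then show ?case using zero mem by auto
  next
    case (inv h)
    then have "h \<in> K" "f h = 0" using zero mem by auto
    then show ?case using additive_on_inv[OF f K(1)] subgroup.m_inv_closed[OF K(1)] by simp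
  next
    case (eng h1 h2)
    then show ?case using additive_on_mult[OF f] subgroup.m_closed[OF K(1)] by simp
  qed
  then show ?thesis by blast
qed

text \<open>Since \<open>lower_central G 0\<close> is the whole group, \<open>lower_central G 1\<close> is the commutator subgroup. If some
  element of it has no positive power in the next term, then it is detected by an additive
  function. By the vanishing of \<open>f\<close> on \<open>lower_central G 2\<close>, the map \<open>f (commutator G x y)\<close> is additive in
  both arguments.\<close>

lemma (in group) nilpotent_center_or_form:
  assumes gens: "finite Y'" "Y' \<subseteq> carrier G" "generate G Y' = carrier G"
    and nil: "lower_central G n = {\<one>}"
  obtains (center) "finite_index_in G (central_mod G {\<one>}) (carrier G)"
  | (form) f x y where "additive_on G (lower_central G 1) f"
      "\<And>z. z \<in> lower_central G 2 \<Longrightarrow> f z = 0"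
      "x \<in> carrier G" "y \<in> carrier G" "f (commutator G x y) \<noteq> 0"
proof (cases "\<forall>z\<in>lower_central G 1. \<exists>k::nat. k > 0 \<and> z [^] k \<in> lower_central G 2")
  case True
  have "lower_central G (Suc n) = {\<one>}"
    using lower_central_antimono[of n] nil subgroup.one_closed[OF lower_central_subgroup, of "Suc n"] by blast
  then show thesis using central_mod_finite_index[OF gens, of n] True center by simp
next
  case False
  then obtain a where a: "a \<in> lower_central G 1" "\<And>k::nat. k > 0 \<Longrightarrow> a [^] k \<notin> lower_central G 2" by blast
  let ?H = "lower_central G 1" and ?K = "lower_central G 2"
  have KS: "?K = lower_central G (Suc (Suc 0))" and HS: "?H = lower_central G (Suc 0)"
    by (simp_all add: numeral_2_eq_2)
  have H: "subgroup ?H G" and K: "subgroup ?K G" by (rule lower_central_subgroup)+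
  have KH: "?K \<subseteq> ?H" using lower_central_antimono KS HS by metis
  interpret N: group "G\<lparr>carrier := ?H\<rparr>" using H by (rule subgroup_imp_group)
  obtain f where f: "additive_on G ?H f" "\<And>x. x \<in> ?K \<Longrightarrow> f x = 0" "f a = 1"
  proof (rule N.additive_on_detecting_infinite_order)
    show "subgroup ?K (G\<lparr>carrier := ?H\<rparr>)" using subgroup_incl[OF K H KH] .
    show "a \<in> carrier (G\<lparr>carrier := ?H\<rparr>)" using a by simp
    show "commutator (G\<lparr>carrier := ?H\<rparr>) x y \<in> ?K"
      if "x \<in> carrier (G\<lparr>carrier := ?H\<rparr>)" "y \<in> carrier (G\<lparr>carrier := ?H\<rparr>)" for x y
      using that commutator_restrict[OF H, of x y] commutator_in_lower_central(1)[of x 1 y]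
        lower_central_closed[of y 1] KS by simp
    show "a [^]\<^bsub>G\<lparr>carrier := ?H\<rparr>\<^esub> k \<notin> ?K" if "k > 0" for k :: nat
      using a(2)[OF that] by (simp add: nat_pow_consistent [symmetric])
  qed auto
  have "\<exists>x\<in>carrier G. \<exists>y\<in>carrier G. f (commutator G x y) \<noteq> 0"
  proof (rule ccontr)
    assume "\<not> ?thesis"
    then have zero: "\<And>x y. x \<in> carrier G \<Longrightarrow> y \<in> carrier G \<Longrightarrow> f (commutator G x y) = 0" by blast
    then have "f a = 0" using additive_on_derived_eq_zero[OF H subset_refl f(1) _ a(1)] by blast
    then show False using f(3) by simp
  qed
  then show thesis using form f(1,2) by blast
qed

lemma (in group) commutator_form_additive:
  assumes f: "additive_on G (lower_central G 1) f" "\<And>z. z \<in> lower_central G 2 \<Longrightarrow> f z = 0"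
    and c: "x \<in> carrier G" "x' \<in> carrier G" "y \<in> carrier G"
  shows "f (commutator G (x \<otimes> x') y) = f (commutator G x y) + f (commutator G x' y)"
    and "f (commutator G y (x \<otimes> x')) = f (commutator G y x) + f (commutator G y x')"
    and "f (commutator G x y) = - f (commutator G y x)"
proof -
  have H: "subgroup (lower_central G 1) G" by (rule lower_central_subgroup)
  have mem: "commutator G x y \<in> lower_central G 1" if "x \<in> carrier G" "y \<in> carrier G" for x y
    using commutator_in_lower_central(1)[of x 0 y] that by simp
  have conj: "x \<otimes> z \<otimes> inv x \<in> lower_central G 1 \<and> f (x \<otimes> z \<otimes> inv x) = f z"
    if x: "x \<in> carrier G" and z: "z \<in> lower_central G 1" for x z
  proof -
    have w: "commutator G x z \<in> lower_central G 2"
      using commutator_in_lower_central(2)[OF z x] by (simp add: numeral_2_eq_2)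
    have "lower_central G 2 \<subseteq> lower_central G 1"
      using lower_central_antimono[of 1] by (simp add: numeral_2_eq_2)
    then show ?thesis
      using w additive_on_mult[OF f(1), of "commutator G x z" z] z f(2)[OF w] subgroup.m_closed[OF H]
        conj_eq_commutator_mult[OF x lower_central_closed[OF z]] by auto
  qed
  show "f (commutator G (x \<otimes> x') y) = f (commutator G x y) + f (commutator G x' y)"
    using c additive_on_mult[OF f(1)] mem conj[of x "commutator G x' y"] by (simp add: commutator_mult_left)
  show "f (commutator G y (x \<otimes> x')) = f (commutator G y x) + f (commutator G y x')"
    using c additive_on_mult[OF f(1)] mem conj[of x "commutator G y x'"] by (simp add: commutator_mult_right)
  show "f (commutator G x y) = - f (commutator G y x)"
    using c additive_on_inv[OF f(1) H mem[OF c(3,1)]] by (simp add: inv_commutator)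
qed

section \<open>Word metrics\<close>

locale cayley_graph = group G for G (structure) +
  fixes S
  assumes finite_S: "finite S" and symmetric_S: "symmetric_subset G S"
    and generate_S: "generate G S = carrier G" and one_notin_S: "\<one> \<notin> S"
begin

abbreviation d :: "'a \<Rightarrow> 'a \<Rightarrow> nat" where "d \<equiv> cayley_dist G S"

abbreviation edges :: "('a \<times> 'a) set" where "edges \<equiv> cayley_edges G S"

lemma S_closed: "s \<in> S \<Longrightarrow> s \<in> carrier G"
  using symmetric_S by (auto simp: symmetric_subset_def)

lemma inv_S: "s \<in> S \<Longrightarrow> inv s \<in> S"
  using symmetric_S unfolding symmetric_subset_def by blast

lemma edge_iff: "(g, h) \<in> edges \<longleftrightarrow> g \<in> carrier G \<and> (\<exists>s\<in>S. h = g \<otimes> s)"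
proof
  assume "(g, h) \<in> edges"
  then have "g \<in> carrier G" "h = g \<otimes> (inv g \<otimes> h)" "inv g \<otimes> h \<in> S"
    by (auto simp: cayley_edges_def)
  then show "g \<in> carrier G \<and> (\<exists>s\<in>S. h = g \<otimes> s)" by blast
next
  assume "g \<in> carrier G \<and> (\<exists>s\<in>S. h = g \<otimes> s)"
  then show "(g, h) \<in> edges" using S_closed by (auto simp: cayley_edges_def)
qed

lemma edge_closed: "(g, h) \<in> edges \<Longrightarrow> g \<in> carrier G \<and> h \<in> carrier G"
  by (simp add: cayley_edges_def)

lemma edgeD:
  assumes "(g, h) \<in> edges" shows "S \<noteq> {}" "g \<in> carrier G" "h \<in> carrier G"
proof -
  obtain s where "s \<in> S" using assms unfolding edge_iff by blast
  then show "S \<noteq> {}" by blast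
  show "g \<in> carrier G" "h \<in> carrier G" using edge_closed[OF assms] by blast+
qed

lemma connected:
  assumes "g \<in> carrier G" "h \<in> carrier G" shows "\<exists>n. (g, h) \<in> edges ^^ n"
proof -
  have *: "\<forall>g\<in>carrier G. \<exists>n. (g, g \<otimes> k) \<in> edges ^^ n" if "k \<in> generate G S" for k
    using that
  proof (induction rule: generate.induct)
    case one show ?case by (auto intro!: exI[of _ 0])
  next
    case (incl h) show ?case using incl by (auto intro!: exI[of _ 1] simp: edge_iff)
  next
    case (inv h) show ?case using inv_S[OF inv] by (auto intro!: exI[of _ 1] simp: edge_iff)
  next
    case (eng k1 k2)
    have c: "k1 \<in> carrier G" "k2 \<in> carrier G" using eng.hyps generate_S by auto
    show ?case
    proof
      fix g assume g: "g \<in> carrier G"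
      obtain n where n: "(g, g \<otimes> k1) \<in> edges ^^ n" using eng.IH(1) g by blast
      obtain m where m: "(g \<otimes> k1, g \<otimes> k1 \<otimes> k2) \<in> edges ^^ m" using eng.IH(2) g c by blast
      have "(g, g \<otimes> k1 \<otimes> k2) \<in> edges ^^ (n + m)" using n m by (auto simp: relpow_add)
      then show "\<exists>n. (g, g \<otimes> (k1 \<otimes> k2)) \<in> edges ^^ n" using g c by (auto simp: m_assoc)
    qed
  qed
  have "inv g \<otimes> h \<in> generate G S" using assms generate_S by simp
  then have "\<exists>n. (g, g \<otimes> (inv g \<otimes> h)) \<in> edges ^^ n" using * assms(1) by blast
  then show ?thesis using assms by simp
qed

lemma d_walk: "g \<in> carrier G \<Longrightarrow> h \<in> carrier G \<Longrightarrow> (g, h) \<in> edges ^^ d g h"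
  unfolding cayley_dist_def using connected by (rule LeastI_ex)

lemma d_le: "(g, h) \<in> edges ^^ n \<Longrightarrow> d g h \<le> n"
  unfolding cayley_dist_def by (rule Least_le)

lemma d_self [simp]: "d g g = 0"
  using d_le[of g g 0] by simp

lemma d_triangle:
  assumes "x \<in> carrier G" "y \<in> carrier G" "z \<in> carrier G"
  shows "d x z \<le> d x y + d y z"
proof -
  have "(x, z) \<in> edges ^^ (d x y + d y z)" using d_walk assms by (auto simp: relpow_add)
  then show ?thesis by (rule d_le)
qed

lemma d_zeroD: "g \<in> carrier G \<Longrightarrow> h \<in> carrier G \<Longrightarrow> d g h = 0 \<Longrightarrow> g = h"
  using d_walk[of g h] by simp

lemma d_edge_le: "(g, h) \<in> edges \<Longrightarrow> d g h \<le> 1"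
  using d_le[of g h 1] by simp

lemma d_edge: "(g, h) \<in> edges \<Longrightarrow> d g h = 1"
proof -
  assume e: "(g, h) \<in> edges"
  have "g \<noteq> h" using e one_notin_S by (auto simp: cayley_edges_def)
  then have "d g h \<noteq> 0" using d_zeroD edge_closed[OF e] by blast
  then show "d g h = 1" using d_edge_le[OF e] by simp
qed

lemma edge_translate:
  assumes "x \<in> carrier G" "(g, h) \<in> edges" shows "(x \<otimes> g, x \<otimes> h) \<in> edges"
proof -
  obtain s where "g \<in> carrier G" "s \<in> S" "h = g \<otimes> s" using assms(2) edge_iff by blast
  then show ?thesis using assms(1) S_closed by (auto simp: edge_iff m_assoc)
qed

lemma walk_translate: "x \<in> carrier G \<Longrightarrow> (g, h) \<in> edges ^^ n \<Longrightarrow> (x \<otimes> g, x \<otimes> h) \<in> edges ^^ n"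
  by (induction n arbitrary: h) (auto intro: edge_translate)

lemma d_translate:
  assumes "x \<in> carrier G" "g \<in> carrier G" "h \<in> carrier G"
  shows "d (x \<otimes> g) (x \<otimes> h) = d g h"
proof (rule antisym)
  show "d (x \<otimes> g) (x \<otimes> h) \<le> d g h"
    using d_le[OF walk_translate[OF assms(1) d_walk[OF assms(2,3)]]] .
  have "(inv x \<otimes> (x \<otimes> g), inv x \<otimes> (x \<otimes> h)) \<in> edges ^^ d (x \<otimes> g) (x \<otimes> h)"
    using walk_translate[OF inv_closed[OF assms(1)]
        d_walk[OF m_closed[OF assms(1,2)] m_closed[OF assms(1,3)]]] .
  then show "d g h \<le> d (x \<otimes> g) (x \<otimes> h)" using assms d_le by simp
qed

lemma d_sym:
  assumes "g \<in> carrier G" "h \<in> carrier G" shows "d g h = d h g"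
proof -
  have sym: "(y, x) \<in> edges" if "(x, y) \<in> edges" for x y
  proof -
    have "inv (inv x \<otimes> y) \<in> S" "x \<in> carrier G" "y \<in> carrier G"
      using that inv_S by (auto simp: cayley_edges_def)
    then show ?thesis by (simp add: cayley_edges_def inv_mult_group)
  qed
  have *: "(y, x) \<in> edges ^^ n" if "(x, y) \<in> edges ^^ n" for x y n
    using that
  proof (induction n arbitrary: y)
    case (Suc n)
    then obtain z where "(x, z) \<in> edges ^^ n" "(z, y) \<in> edges" by auto
    then show ?case using Suc.IH sym by (metis relpow_Suc_I2)
  qed simp
  show ?thesis using *[OF d_walk] assms d_le by (metis antisym)
qed

lemma d_step_le: "g \<in> carrier G \<Longrightarrow> x \<in> insert \<one> S \<Longrightarrow> d g (g \<otimes> x) \<le> 1"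
  using d_edge_le[of g "g \<otimes> x"] by (auto simp: edge_iff)

lemma finite_ball: "finite {h \<in> carrier G. d g h \<le> n}" if g: "g \<in> carrier G"
proof -
  have fin: "finite {h. (g, h) \<in> edges ^^ k}" for k
  proof (induction k)
    case 0 then show ?case by simp
  next
    case (Suc k)
    have "{h. (g, h) \<in> edges ^^ Suc k} \<subseteq> (\<lambda>(h, s). h \<otimes> s) ` ({h. (g, h) \<in> edges ^^ k} \<times> S)"
      by (auto simp: edge_iff)
    then show ?case using Suc finite_S by (meson finite_SigmaI finite_surj)
  qed
  have "{h \<in> carrier G. d g h \<le> n} \<subseteq> (\<Union>k\<in>{..n}. {h. (g, h) \<in> edges ^^ k})"
    using d_walk[OF g] by blast
  then show ?thesis using fin by (meson finite_UN finite_atMost finite_subset)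
qed

lemma geodesic:
  assumes g: "g \<in> carrier G" and h: "h \<in> carrier G"
  obtains p where "p 0 = g" "p (d g h) = h" "\<And>i. i < d g h \<Longrightarrow> (p i, p (Suc i)) \<in> edges"
    "\<And>i. i \<le> d g h \<Longrightarrow> p i \<in> carrier G"
    "\<And>i j. i \<le> j \<Longrightarrow> j \<le> d g h \<Longrightarrow> d (p i) (p j) = j - i"
proof -
  obtain p where p: "p 0 = g" "p (d g h) = h" "\<And>i. i < d g h \<Longrightarrow> (p i, p (Suc i)) \<in> edges"
    using d_walk[OF g h] unfolding relpow_fun_conv by blast
  have c: "p i \<in> carrier G" if "i \<le> d g h" for i
  proof (cases i)
    case 0 then show ?thesis using p(1) g by simp
  next
    case (Suc n) then show ?thesis using that p(3)[of n] edge_closed by auto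
  qed
  have le: "d (p i) (p (i + k)) \<le> k" if "i + k \<le> d g h" for i k
    using that
  proof (induction k)
    case (Suc k)
    have "d (p i) (p (i + Suc k)) \<le> d (p i) (p (i + k)) + d (p (i + k)) (p (i + Suc k))"
      using Suc.prems c by (intro d_triangle) auto
    also have "\<dots> \<le> k + 1" using Suc d_edge_le[OF p(3)[of "i + k"]] by (intro add_mono) auto
    finally show ?case by simp
  qed simp
  have "d (p i) (p j) = j - i" if ij: "i \<le> j" "j \<le> d g h" for i j
  proof (rule antisym)
    show "d (p i) (p j) \<le> j - i" using le[of i "j - i"] ij by simp
    have "d g h \<le> d g (p i) + d (p i) (p j) + d (p j) h"
      using d_triangle[of g "p i" h] d_triangle[of "p i" "p j" h] g h c ij by fastforce
    moreover have "d g (p i) \<le> i" using le[of 0 i] p ij by simp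
    moreover have "d (p j) h \<le> d g h - j" using le[of j "d g h - j"] p ij by simp
    ultimately show "j - i \<le> d (p i) (p j)" using ij by linarith
  qed
  then show thesis using that p c by blast
qed

section \<open>The lazy random walk and couplings\<close>

abbreviation walk :: "'a \<Rightarrow> 'a pmf" where "walk \<equiv> lazy_walk G S"

text \<open>An index set carrying the uniform distribution behind the lazy walk: one index for each
  element of \<open>insert \<one> S\<close>, and \<open>card S - 1\<close> further indices for staying in place.\<close>

definition step_index :: "('a + nat) set" where
  "step_index = Inl ` insert \<one> S \<union> Inr ` {..<card S - 1}"

definition step_of :: "'a + nat \<Rightarrow> 'a" where
  "step_of i = (case i of Inl x \<Rightarrow> x | Inr _ \<Rightarrow> \<one>)"

lemma step_index: "finite step_index" "step_index \<noteq> {}"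
  "S \<noteq> {} \<Longrightarrow> card step_index = 2 * card S"
proof -
  show "finite step_index" "step_index \<noteq> {}" using finite_S by (auto simp: step_index_def)
  assume "S \<noteq> {}"
  then have "card S > 0" using finite_S by (simp add: card_gt_0_iff)
  moreover have "card step_index = card (Inl ` insert \<one> S :: ('a + nat) set)
      + card (Inr ` {..<card S - 1} :: ('a + nat) set)"
    unfolding step_index_def using finite_S by (intro card_Un_disjoint) auto
  moreover have "card (Inl ` insert \<one> S :: ('a + nat) set) = Suc (card S)"
    by (subst card_image) (use one_notin_S finite_S in auto)
  moreover have "card (Inr ` {..<card S - 1} :: ('a + nat) set) = card S - 1"
    by (subst card_image) auto
  ultimately show "card step_index = 2 * card S" by simp
qed

lemma walk_eq_uniform:
  assumes S: "S \<noteq> {}" and g: "g \<in> carrier G"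
  shows "walk g = map_pmf (\<lambda>i. g \<otimes> step_of i) (pmf_of_set step_index)"
proof (rule pmf_eqI)
  fix k
  have N: "card S > 0" using S finite_S by (simp add: card_gt_0_iff)
  let ?A = "step_index \<inter> (\<lambda>i. g \<otimes> step_of i) -` {k}"
  have R: "pmf (map_pmf (\<lambda>i. g \<otimes> step_of i) (pmf_of_set step_index)) k = card ?A / (2 * card S)"
    using step_index S by (simp add: pmf_map measure_pmf_of_set)
  have L: "pmf (walk g) k = lazy_walk_weight G S g k"
    using pmf_lazy_walk[OF is_group _ finite_S S one_notin_S g] S_closed by blast
  have eq: "g \<otimes> x = g \<longleftrightarrow> x = \<one>" if "x \<in> insert \<one> S" for x
    using that g S_closed by auto
  consider "k = g" | s where "s \<in> S" "k = g \<otimes> s" | "k \<noteq> g" "(g, k) \<notin> edges"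
    using g by (auto simp: edge_iff)
  then show "pmf (walk g) k = pmf (map_pmf (\<lambda>i. g \<otimes> step_of i) (pmf_of_set step_index)) k"
  proof cases
    case 1
    have "?A = insert (Inl \<one>) (Inr ` {..<card S - 1})"
      using 1 eq g by (auto simp: step_index_def step_of_def)
    then have "card ?A = card S" using N by (simp add: card_insert_if card_image image_iff)
    then show ?thesis using R L 1 N by (simp add: lazy_walk_weight_def)
  next
    case (2 s)
    have "?A = {Inl s}"
    proof -
      have "x = s" if "x \<in> insert \<one> S" "g \<otimes> x = g \<otimes> s" for x
        using that g S_closed 2(1) by auto
      moreover have "g \<otimes> \<one> \<noteq> g \<otimes> s" using g S_closed[OF 2(1)] 2(1) one_notin_S by auto
      ultimately show ?thesis using 2 by (auto simp: step_index_def step_of_def)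
    qed
    moreover have "k \<noteq> g" "(g, k) \<in> edges" using 2 g eq[of s] one_notin_S by (auto simp: edge_iff)
    ultimately show ?thesis using R L by (simp add: lazy_walk_weight_def)
  next
    case 3
    have "?A = {}" using 3 g by (auto simp: step_index_def step_of_def edge_iff)
    then have "card ?A = 0" by (metis card.empty)
    then show ?thesis using R L 3 by (simp add: lazy_walk_weight_def)
  qed
qed

lemma set_walk:
  assumes "S \<noteq> {}" "g \<in> carrier G" shows "set_pmf (walk g) = (\<lambda>x. g \<otimes> x) ` insert \<one> S"
proof -
  have "step_of ` step_index = insert \<one> S"
    unfolding step_index_def image_Un image_image by (auto simp: step_of_def)
  then show ?thesis
    using walk_eq_uniform[OF assms] step_index by (simp add: image_image [symmetric])
qed

lemma set_walk_closed: "S \<noteq> {} \<Longrightarrow> g \<in> carrier G \<Longrightarrow> set_pmf (walk g) \<subseteq> carrier G"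
  using set_walk S_closed by auto

lemma finite_set_walk: "S \<noteq> {} \<Longrightarrow> g \<in> carrier G \<Longrightarrow> finite (set_pmf (walk g))"
  using set_walk finite_S by simp

lemma walk_translate_eq:
  assumes S: "S \<noteq> {}" and g: "g \<in> carrier G" and x: "x \<in> carrier G"
  shows "walk (x \<otimes> g) = map_pmf (\<lambda>y. x \<otimes> y) (walk g)"
proof -
  have "x \<otimes> g \<otimes> step_of i = x \<otimes> (g \<otimes> step_of i)" if "i \<in> step_index" for i
    using that g x S_closed by (auto simp: step_index_def step_of_def m_assoc)
  then show ?thesis
    unfolding walk_eq_uniform[OF S g] walk_eq_uniform[OF S m_closed[OF x g]] map_pmf_comp
    using step_index by (intro map_pmf_cong refl) simp
qed

lemma coupling_support:
  assumes "\<pi> \<in> couplings \<mu> \<nu>" "(x, y) \<in> set_pmf \<pi>"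
  shows "x \<in> set_pmf \<mu>" "y \<in> set_pmf \<nu>"
  using assms unfolding couplings_def by force+

lemma finite_coupling:
  assumes "\<pi> \<in> couplings \<mu> \<nu>" "finite (set_pmf \<mu>)" "finite (set_pmf \<nu>)"
  shows "finite (set_pmf \<pi>)"
proof -
  have "set_pmf \<pi> \<subseteq> set_pmf \<mu> \<times> set_pmf \<nu>" using coupling_support[OF assms(1)] by auto
  then show ?thesis using assms(2,3) by (meson finite_SigmaI finite_subset)
qed

lemma W1_nonneg_bdd: "bdd_below ((\<lambda>\<pi>. measure_pmf.expectation \<pi> (\<lambda>(g, h). real (d g h))) ` couplings \<mu> \<nu>)"
  by (rule bdd_belowI[of _ 0]) (auto intro!: integral_nonneg_AE)

lemma W1_le:
  "\<pi> \<in> couplings \<mu> \<nu> \<Longrightarrow> W1 G S \<mu> \<nu> \<le> measure_pmf.expectation \<pi> (\<lambda>(g, h). real (d g h))"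
  unfolding W1_def by (rule cINF_lower[OF W1_nonneg_bdd])

lemma couplings_nonempty: "couplings \<mu> \<nu> \<noteq> {}"
proof -
  have "pair_pmf \<mu> \<nu> \<in> couplings \<mu> \<nu>"
    by (simp add: couplings_def map_fst_pair_pmf map_snd_pair_pmf)
  then show ?thesis by blast
qed

lemma nonneg_curvature_iff:
  "nonneg_ollivier_ricci G S \<longleftrightarrow> (\<forall>(g, h)\<in>edges. W1 G S (walk g) (walk h) \<le> 1)"
  unfolding nonneg_ollivier_ricci_def ollivier_ricci_def using d_edge by fastforce

lemma near_optimal_coupling:
  assumes "nonneg_ollivier_ricci G S" "(g, h) \<in> edges" "\<epsilon> > 0"
  obtains \<pi> where "\<pi> \<in> couplings (walk g) (walk h)"
    "measure_pmf.expectation \<pi> (\<lambda>(g, h). real (d g h)) < 1 + \<epsilon>"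
proof -
  have "W1 G S (walk g) (walk h) < 1 + \<epsilon>"
    using assms nonneg_curvature_iff by fastforce
  then show thesis
    using that cINF_less_iff[OF couplings_nonempty W1_nonneg_bdd] unfolding W1_def by metis
qed

end

section \<open>Lipschitz functions under non-negative curvature\<close>

locale lipschitz_function = cayley_graph G S for G (structure) and S +
  fixes f :: "'a \<Rightarrow> real" and \<mu> :: real
  assumes mu_pos: "0 < \<mu>"
    and lipschitz: "x \<in> carrier G \<Longrightarrow> y \<in> carrier G \<Longrightarrow> f y - f x \<le> \<mu> * d x y"
begin

text \<open>Calibrated pairs are those between which \<open>f\<close> grows at the maximal rate. This relation is
  transitive, because concatenated geodesics between calibrated pairs are again geodesics.\<close>

definition calibrated :: "'a \<Rightarrow> 'a \<Rightarrow> bool" where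
  "calibrated x y \<longleftrightarrow> f y - f x = \<mu> * d x y"

definition up :: "'a set \<Rightarrow> 'a set" where
  "up A = {y \<in> carrier G. \<exists>x\<in>A. calibrated x y}"

lemma calibrated_trans:
  assumes "x \<in> carrier G" "y \<in> carrier G" "z \<in> carrier G" "calibrated x y" "calibrated y z"
  shows "calibrated x z"
proof -
  have "\<mu> * real (d x z) \<le> \<mu> * (real (d x y) + real (d y z))"
    using d_triangle[OF assms(1-3)] mu_pos by simp
  then show ?thesis
    using assms(4,5) lipschitz[OF assms(1,3)] unfolding calibrated_def by (simp add: algebra_simps)
qed

lemma up_up: "A \<subseteq> carrier G \<Longrightarrow> up (up A) \<subseteq> up A"
  unfolding up_def using calibrated_trans by blast

lemma subset_up: "A \<subseteq> carrier G \<Longrightarrow> A \<subseteq> up A"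
  by (force simp: up_def calibrated_def)

abbreviation walk_mean :: "'a \<Rightarrow> real" where
  "walk_mean g \<equiv> measure_pmf.expectation (walk g) f"

lemma coupling_slack:
  assumes \<pi>: "\<pi> \<in> couplings (walk g) (walk h)" and e: "(g, h) \<in> edges"
    and cost: "measure_pmf.expectation \<pi> (\<lambda>(x, y). real (d x y)) < 1 + \<epsilon>"
  shows "measure_pmf.expectation \<pi> (\<lambda>(x, y). \<mu> * d x y - (f y - f x))
           < \<mu> * (1 + \<epsilon>) - (walk_mean h - walk_mean g)"
proof -
  have S: "S \<noteq> {}" and g: "g \<in> carrier G" and h: "h \<in> carrier G"
    using edgeD[OF e] by simp_all
  have fin: "finite (set_pmf \<pi>)"
    by (rule finite_coupling[OF \<pi> finite_set_walk[OF S g] finite_set_walk[OF S h]])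
  note int = integrable_measure_pmf_finite[OF fin]
  have "walk_mean g = measure_pmf.expectation \<pi> (\<lambda>p. f (fst p))"
    using \<pi> integral_map_pmf[of fst \<pi> f] by (simp add: couplings_def)
  moreover have "walk_mean h = measure_pmf.expectation \<pi> (\<lambda>p. f (snd p))"
    using \<pi> integral_map_pmf[of snd \<pi> f] by (simp add: couplings_def)
  moreover have "measure_pmf.expectation \<pi> (\<lambda>(x, y). \<mu> * d x y - (f y - f x))
      = \<mu> * measure_pmf.expectation \<pi> (\<lambda>(x, y). real (d x y))
        - (measure_pmf.expectation \<pi> (\<lambda>p. f (snd p)) - measure_pmf.expectation \<pi> (\<lambda>p. f (fst p)))"
    by (simp add: case_prod_beta' int)
  moreover have "\<mu> * measure_pmf.expectation \<pi> (\<lambda>(x, y). real (d x y)) < \<mu> * (1 + \<epsilon>)"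
    using cost mu_pos by simp
  ultimately show ?thesis by simp
qed

lemma slack_nonneg:
  assumes \<pi>: "\<pi> \<in> couplings (walk g) (walk h)" and e: "(g, h) \<in> edges" and p: "(x, y) \<in> set_pmf \<pi>"
  shows "x \<in> carrier G" "y \<in> carrier G" "0 \<le> \<mu> * d x y - (f y - f x)"
proof -
  have S: "S \<noteq> {}" and g: "g \<in> carrier G" and h: "h \<in> carrier G"
    using edgeD[OF e] by simp_all
  show "x \<in> carrier G" "y \<in> carrier G"
    using coupling_support[OF \<pi> p] set_walk_closed[OF S g] set_walk_closed[OF S h] by blast+
  then show "0 \<le> \<mu> * d x y - (f y - f x)" using lipschitz[of x y] by simp
qed

lemma walk_mean_lipschitz:
  assumes "nonneg_ollivier_ricci G S" and e: "(g, h) \<in> edges"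
  shows "walk_mean h - walk_mean g \<le> \<mu>"
proof (rule field_le_epsilon)
  fix \<delta> :: real assume \<delta>: "0 < \<delta>"
  obtain \<pi> where \<pi>: "\<pi> \<in> couplings (walk g) (walk h)"
    "measure_pmf.expectation \<pi> (\<lambda>(g, h). real (d g h)) < 1 + \<delta> / \<mu>"
    using near_optimal_coupling[OF assms, of "\<delta> / \<mu>"] \<delta> mu_pos by auto
  have "0 \<le> measure_pmf.expectation \<pi> (\<lambda>(x, y). \<mu> * d x y - (f y - f x))"
    by (rule integral_nonneg_AE) (use slack_nonneg(3)[OF \<pi>(1) e] in \<open>auto simp: AE_measure_pmf_iff\<close>)
  then have "0 < \<mu> * (1 + \<delta> / \<mu>) - (walk_mean h - walk_mean g)"
    using coupling_slack[OF \<pi>(1) e \<pi>(2)] by simp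
  moreover have "\<mu> * (1 + \<delta> / \<mu>) = \<mu> + \<delta>" using mu_pos by (simp add: field_simps)
  ultimately show "walk_mean h - walk_mean g \<le> \<mu> + \<delta>" by simp
qed

text \<open>If the mean of \<open>f\<close> grows by the largest possible amount along an edge, then almost optimal
  couplings put almost no mass on pairs that are not calibrated, because the slack of
  these pairs takes only finitely many positive values.\<close>

lemma mass_moves_up:
  assumes curv: "nonneg_ollivier_ricci G S" and e: "(g, h) \<in> edges"
    and eq: "walk_mean h - walk_mean g = \<mu>"
  shows "measure (walk g) A \<le> measure (walk h) (up A)"
proof (rule field_le_epsilon)
  fix \<delta> :: real assume \<delta>: "0 < \<delta>"
  have S: "S \<noteq> {}" and g: "g \<in> carrier G" and h: "h \<in> carrier G"
    using edgeD[OF e] by simp_all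
  let ?sl = "\<lambda>(x, y). \<mu> * d x y - (f y - f x)"
  define V where "V = {v \<in> ?sl ` (set_pmf (walk g) \<times> set_pmf (walk h)). v > 0}"
  have finV: "finite V" unfolding V_def using finite_set_walk[OF S g] finite_set_walk[OF S h] by simp
  \<comment> \<open>The least positive slack; the number 1 covers the case that there is none.\<close>
  define \<eta> where "\<eta> = Min (insert 1 V)"
  have "\<eta> \<in> insert 1 V" unfolding \<eta>_def using finV by (intro Min_in) auto
  then have \<eta>: "0 < \<eta>" unfolding V_def by auto
  have \<eta>_le: "\<eta> \<le> v" if "v \<in> V" for v unfolding \<eta>_def using finV that by (intro Min_le) auto
  obtain \<pi> where \<pi>: "\<pi> \<in> couplings (walk g) (walk h)"
    "measure_pmf.expectation \<pi> (\<lambda>(g, h). real (d g h)) < 1 + \<delta> * \<eta> / \<mu>"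
    using near_optimal_coupling[OF curv e, of "\<delta> * \<eta> / \<mu>"] \<delta> \<eta> mu_pos by auto
  have fin: "finite (set_pmf \<pi>)"
    by (rule finite_coupling[OF \<pi>(1) finite_set_walk[OF S g] finite_set_walk[OF S h]])
  define Z where "Z = {p. ?sl p > 0}"
  have "\<eta> * measure \<pi> Z = measure_pmf.expectation \<pi> (\<lambda>p. \<eta> * indicator Z p)" by simp
  also have "\<dots> \<le> measure_pmf.expectation \<pi> ?sl"
  proof (rule integral_mono_AE)
    show "AE p in measure_pmf \<pi>. \<eta> * indicator Z p \<le> ?sl p"
      unfolding AE_measure_pmf_iff
    proof
      fix p assume p: "p \<in> set_pmf \<pi>"
      obtain x y where xy: "p = (x, y)" by fastforce
      show "\<eta> * indicator Z p \<le> ?sl p"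
      proof (cases "p \<in> Z")
        case True
        have "?sl p \<in> V"
          using True coupling_support[OF \<pi>(1)] p xy unfolding V_def Z_def by blast
        then show ?thesis using \<eta>_le True by simp
      next
        case False then show ?thesis using slack_nonneg(3)[OF \<pi>(1) e] p xy by simp
      qed
    qed
  qed (rule integrable_measure_pmf_finite[OF fin])+
  also have "\<dots> < \<mu> * (1 + \<delta> * \<eta> / \<mu>) - \<mu>" using coupling_slack[OF \<pi>(1) e \<pi>(2)] eq by simp
  also have "\<dots> = \<delta> * \<eta>" using mu_pos by (simp add: field_simps)
  finally have Z: "measure \<pi> Z < \<delta>" using \<eta> by (simp add: mult.commute)
  have "measure (walk g) A = measure \<pi> (fst -` A)"
    using \<pi>(1) measure_map_pmf[of fst \<pi> A] by (simp add: couplings_def)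
  also have "\<dots> = measure \<pi> (fst -` A \<inter> set_pmf \<pi>)" by (simp add: measure_Int_set_pmf)
  also have "\<dots> \<le> measure \<pi> (snd -` up A \<union> Z)"
  proof (rule measure_pmf.finite_measure_mono)
    show "fst -` A \<inter> set_pmf \<pi> \<subseteq> snd -` up A \<union> Z"
    proof
      fix p assume p: "p \<in> fst -` A \<inter> set_pmf \<pi>"
      obtain x y where xy: "p = (x, y)" by fastforce
      show "p \<in> snd -` up A \<union> Z"
        using slack_nonneg[OF \<pi>(1) e, of x y] p xy unfolding up_def calibrated_def Z_def by fastforce
    qed
  qed simp
  also have "\<dots> \<le> measure \<pi> (snd -` up A) + measure \<pi> Z"
    by (rule measure_Un_le) auto
  also have "measure \<pi> (snd -` up A) = measure (walk h) (up A)"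
    using \<pi>(1) measure_map_pmf[of snd \<pi> "up A"] by (simp add: couplings_def)
  finally show "measure (walk g) A \<le> measure (walk h) (up A) + \<delta>" using Z by simp
qed

end

text \<open>By equivariance the mean of \<open>f\<close> grows by \<open>\<phi> n\<close> over a period \<open>n\<close>, as it would for a harmonic
  function.\<close>

locale equivariant_lipschitz_function = lipschitz_function G S f \<mu>
  for G (structure) and S and f :: "'a \<Rightarrow> real" and \<mu> +
  fixes N and \<phi> :: "'a \<Rightarrow> real"
  assumes N: "subgroup N G"
    and equivariant: "n \<in> N \<Longrightarrow> g \<in> carrier G \<Longrightarrow> f (n \<otimes> g) = \<phi> n + f g"
    and curvature: "nonneg_ollivier_ricci G S"
begin

lemma N_closed: "n \<in> N \<Longrightarrow> n \<in> carrier G"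
  using subgroup.mem_carrier[OF N] .

lemma calibrated_translate:
  "n \<in> N \<Longrightarrow> x \<in> carrier G \<Longrightarrow> y \<in> carrier G \<Longrightarrow> calibrated (n \<otimes> x) (n \<otimes> y) \<longleftrightarrow> calibrated x y"
  using d_translate N_closed by (simp add: calibrated_def equivariant)

lemma walk_mean_translate:
  assumes S: "S \<noteq> {}" and n: "n \<in> N" and g: "g \<in> carrier G"
  shows "walk_mean (n \<otimes> g) = \<phi> n + walk_mean g"
proof -
  have "walk_mean (n \<otimes> g) = measure_pmf.expectation (walk g) (\<lambda>y. f (n \<otimes> y))"
    by (simp add: walk_translate_eq[OF S g N_closed[OF n]])
  also have "\<dots> = measure_pmf.expectation (walk g) (\<lambda>y. \<phi> n + f y)"
    by (rule integral_cong_AE)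
      (use set_walk_closed[OF S g] equivariant[OF n] in \<open>auto simp: AE_measure_pmf_iff\<close>)
  also have "\<dots> = \<phi> n + walk_mean g"
    by (simp add: integrable_measure_pmf_finite[OF finite_set_walk[OF S g]])
  finally show ?thesis .
qed

text \<open>Along a geodesic from \<open>g\<close> to \<open>n \<otimes> g\<close> the mean of \<open>f\<close> grows by at most \<open>\<mu>\<close> per edge, and by the maximal
  total amount by equivariance. So it grows by exactly \<open>\<mu>\<close> along every edge.\<close>

lemma mass_moves_up_along_period:
  assumes S: "S \<noteq> {}" and n: "n \<in> N" and g: "g \<in> carrier G" and A: "A \<subseteq> carrier G"
    and period: "\<phi> n = \<mu> * d g (n \<otimes> g)"
  shows "measure (walk g) A \<le> measure (walk (n \<otimes> g)) (up A)"
proof -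
  have ng: "n \<otimes> g \<in> carrier G" using N_closed n g by blast
  let ?l = "d g (n \<otimes> g)"
  obtain p where p: "p 0 = g" "p ?l = n \<otimes> g" "\<And>i. i < ?l \<Longrightarrow> (p i, p (Suc i)) \<in> edges"
    "\<And>i. i \<le> ?l \<Longrightarrow> p i \<in> carrier G"
    using geodesic[OF g ng] by metis
  let ?\<Delta> = "\<lambda>i. walk_mean (p (Suc i)) - walk_mean (p i)"
  have le: "?\<Delta> i \<le> \<mu>" if "i < ?l" for i using walk_mean_lipschitz[OF curvature p(3)[OF that]] .
  have "(\<Sum>i<?l. \<mu> - ?\<Delta> i) = \<mu> * ?l - (walk_mean (p ?l) - walk_mean (p 0))"
    using sum_subtractf[of "\<lambda>_. \<mu>" ?\<Delta> "{..<?l}"] sum_lessThan_telescope[of "\<lambda>i. walk_mean (p i)" ?l]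
    by (simp add: mult.commute)
  also have "\<dots> = 0" using walk_mean_translate[OF S n g] p period by simp
  finally have "\<forall>i\<in>{..<?l}. \<mu> - ?\<Delta> i = 0"
    using le sum_nonneg_eq_0_iff[of "{..<?l}" "\<lambda>i. \<mu> - ?\<Delta> i"] by simp
  then have eq: "?\<Delta> i = \<mu>" if "i < ?l" for i using that by simp
  have "measure (walk g) A \<le> measure (walk (p i)) (up A)" if "i \<le> ?l" for i
    using that
  proof (induction i)
    case 0
    show ?case using p(1) subset_up[OF A] by (simp add: measure_pmf.finite_measure_mono)
  next
    case (Suc i)
    have "measure (walk g) A \<le> measure (walk (p i)) (up A)" using Suc by simp
    also have "\<dots> \<le> measure (walk (p (Suc i))) (up (up A))"
      using mass_moves_up[OF curvature p(3) eq] Suc.prems by simp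
    also have "\<dots> \<le> measure (walk (p (Suc i))) (up A)"
      by (rule measure_pmf.finite_measure_mono[OF up_up[OF A]]) simp
    finally show ?case .
  qed
  from this[of ?l] show ?thesis using p(2) by simp
qed

text \<open>A recurrence argument: the set \<open>A\<close> of points that are calibrated from \<open>x\<close>, modulo powers of \<open>n\<close>, does not
  lose mass when it is moved along the period. So it has the same mass as its subset \<open>A'\<close> of points reached
  with a positive power. Since \<open>x\<close> has positive mass, it belongs to \<open>A'\<close>.\<close>

lemma period_at_neighbour:
  assumes n: "n \<in> N" and g: "g \<in> carrier G" and period: "\<phi> n = \<mu> * d g (n \<otimes> g)" and s: "s \<in> S"
  obtains j :: nat where "j > 0" "\<phi> (n [^] j) = \<mu> * d (g \<otimes> s) (n [^] j \<otimes> (g \<otimes> s))"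
proof -
  define x where "x = g \<otimes> s"
  have S: "S \<noteq> {}" using s by blast
  have x: "x \<in> carrier G" using g S_closed[OF s] by (simp add: x_def)
  have nc: "n \<in> carrier G" using n N_closed by blast
  have nk: "n [^] k \<in> N" for k :: nat using subgroup.pow_mem[OF N is_group n] .
  have nkc: "n [^] k \<in> carrier G" for k :: nat using nc by simp
  define A where "A = {y \<in> carrier G. \<exists>k::nat. calibrated x (n [^] k \<otimes> y)}"
  define A' where "A' = {y \<in> carrier G. \<exists>k::nat. k > 0 \<and> calibrated x (n [^] k \<otimes> y)}"
  have A'A: "A' \<subseteq> A" and Ac: "A \<subseteq> carrier G" unfolding A_def A'_def by blast+
  have upA: "up A \<subseteq> A"
  proof
    fix z assume "z \<in> up A"
    then obtain y k where y: "z \<in> carrier G" "y \<in> carrier G" "calibrated x (n [^] (k::nat) \<otimes> y)" "calibrated y z"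
      unfolding up_def A_def by blast
    have "calibrated (n [^] k \<otimes> y) (n [^] k \<otimes> z)" using calibrated_translate[OF nk] y by simp
    then have "calibrated x (n [^] k \<otimes> z)" using calibrated_trans[OF x _ _ y(3)] y nkc by simp
    then show "z \<in> A" unfolding A_def using y by blast
  qed
  have "measure (walk g) A \<le> measure (walk (n \<otimes> g)) (up A)"
    by (rule mass_moves_up_along_period[OF S n g Ac period])
  also have "\<dots> \<le> measure (walk (n \<otimes> g)) A"
    by (rule measure_pmf.finite_measure_mono[OF upA]) simp
  also have "\<dots> = measure (walk g) ((\<lambda>y. n \<otimes> y) -` A)"
    by (simp add: walk_translate_eq[OF S g nc] measure_map_pmf)
  also have "\<dots> = measure (walk g) ((\<lambda>y. n \<otimes> y) -` A \<inter> set_pmf (walk g))"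
    by (simp add: measure_Int_set_pmf)
  also have "\<dots> \<le> measure (walk g) A'"
  proof (rule measure_pmf.finite_measure_mono)
    show "(\<lambda>y. n \<otimes> y) -` A \<inter> set_pmf (walk g) \<subseteq> A'"
    proof
      fix y assume y: "y \<in> (\<lambda>y. n \<otimes> y) -` A \<inter> set_pmf (walk g)"
      then have yc: "y \<in> carrier G" using set_walk_closed[OF S g] by blast
      obtain k where "calibrated x (n [^] (k::nat) \<otimes> (n \<otimes> y))" using y unfolding A_def by blast
      then have "calibrated x (n [^] Suc k \<otimes> y)" using nc yc by (simp add: m_assoc)
      then show "y \<in> A'" unfolding A'_def using yc by blast
    qed
  qed simp
  finally have "measure (walk g) A \<le> measure (walk g) A'" .
  moreover have "measure (walk g) A = measure (walk g) A' + measure (walk g) (A - A')"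
    using measure_pmf.finite_measure_Diff[of A "walk g" A'] A'A by simp
  ultimately have "measure (walk g) (A - A') = 0"
    using measure_nonneg[of "walk g" "A - A'"] by simp
  moreover have "x \<in> set_pmf (walk g)" using set_walk[OF S g] s by (auto simp: x_def)
  ultimately have "x \<notin> A - A'" by (metis measure_pmf_zero_iff disjoint_iff)
  moreover have "x \<in> A" unfolding A_def calibrated_def using x by (auto intro!: exI[of _ 0])
  ultimately obtain k where k: "(k::nat) > 0" "calibrated x (n [^] k \<otimes> x)" unfolding A'_def by blast
  have "\<phi> (n [^] k) = \<mu> * d x (n [^] k \<otimes> x)"
    using k(2) equivariant[OF nk x] unfolding calibrated_def by simp
  then show thesis using that k(1) x_def by blast
qed

end

section \<open>Elements of maximal slope\<close>

locale cayley_graph_subgroup = cayley_graph G S + normal N G for G (structure) and S and N +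
  assumes finite_rcosets: "finite (rcosets N)"
begin

abbreviation index :: nat where "index \<equiv> card (rcosets N)"

lemma N_closed: "n \<in> N \<Longrightarrow> n \<in> carrier G" using subset by blast

lemma one_carrier: "\<one> \<in> carrier G" by simp

lemma d_conj:
  assumes "g \<in> carrier G" "n \<in> carrier G" "h \<in> carrier G"
  shows "d (g \<otimes> h) (n \<otimes> (g \<otimes> h)) = d h (inv g \<otimes> n \<otimes> g \<otimes> h)"
proof -
  have "d (inv g \<otimes> (g \<otimes> h)) (inv g \<otimes> (n \<otimes> (g \<otimes> h))) = d (g \<otimes> h) (n \<otimes> (g \<otimes> h))"
    using assms by (intro d_translate) auto
  then show ?thesis using assms by (simp add: m_assoc)
qed

text \<open>A long geodesic visits some coset of \<open>N\<close> twice, and the part between the two visits can be cut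
  out.\<close>

lemma remove_loop:
  assumes g: "g \<in> carrier G" and n: "n \<in> N" and long: "index < d g (n \<otimes> g)"
  obtains u v x k where "u \<in> N" "v \<in> N" "n = u \<otimes> v" "x \<in> carrier G" "0 < k" "k \<le> index"
    "d x (u \<otimes> x) = k" "d g (v \<otimes> g) \<le> d g (n \<otimes> g) - k" "d g (u \<otimes> g) \<le> 2 * index"
proof -
  have nc: "n \<in> carrier G" using n N_closed by blast
  then have ng: "n \<otimes> g \<in> carrier G" using g by simp
  let ?l = "d g (n \<otimes> g)"
  obtain p where p: "p 0 = g" "p ?l = n \<otimes> g" "\<And>i. i \<le> ?l \<Longrightarrow> p i \<in> carrier G"
    "\<And>i j. i \<le> j \<Longrightarrow> j \<le> ?l \<Longrightarrow> d (p i) (p j) = j - i"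
    using geodesic[OF g ng] by metis
  have img: "(\<lambda>i. N #> p i) ` {..index} \<subseteq> rcosets N"
    using p(3) long rcosetsI[OF subset] by (intro image_subsetI) simp
  have "\<not> inj_on (\<lambda>i. N #> p i) {..index}"
  proof
    assume "inj_on (\<lambda>i. N #> p i) {..index}"
    then have "card {..index} \<le> index" using card_inj_on_le[OF _ img finite_rcosets] by blast
    then show False by simp
  qed
  then obtain i j where "i \<le> index" "j \<le> index" "N #> p i = N #> p j" "i \<noteq> j"
    unfolding inj_on_def by auto
  then obtain i j where ij: "i < j" "j \<le> index" "N #> p i = N #> p j"
    by (metis linorder_neqE_nat)
  have c: "p i \<in> carrier G" "p j \<in> carrier G" using p(3) ij long by auto
  define u where "u = p j \<otimes> inv (p i)"
  have "p j \<in> N #> p i" using ij(3) rcos_self[OF c(2) subgroup_axioms] by simp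
  then obtain h where "h \<in> N" "p j = h \<otimes> p i" by (auto simp: r_coset_def)
  then have u: "u \<in> N" using c N_closed by (simp add: u_def m_assoc)
  have uc: "u \<in> carrier G" using u N_closed by blast
  define v where "v = inv u \<otimes> n"
  have v: "v \<in> N" using u n by (simp add: v_def)
  have vc: "v \<in> carrier G" using v N_closed by blast
  have up: "u \<otimes> p i = p j" using c by (simp add: u_def m_assoc)
  have dj: "d g (p j) = j" using p(4)[of 0 j] p(1) ij long by simp
  have di: "d g (p i) = i" using p(4)[of 0 i] p(1) ij long by simp
  show thesis
  proof
    show "n = u \<otimes> v" using uc nc by (simp add: v_def)
    show "0 < j - i" "j - i \<le> index" using ij by auto
    show "d (p i) (u \<otimes> p i) = j - i" using up p(4)[of i j] ij long by simp
    have "d (p i) (v \<otimes> g) = d (u \<otimes> p i) (u \<otimes> (v \<otimes> g))"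
      using d_translate[OF uc c(1), of "v \<otimes> g"] vc g by simp
    also have "u \<otimes> (v \<otimes> g) = p ?l" using uc nc g p(2) by (simp add: v_def m_assoc)
    also have "d (u \<otimes> p i) (p ?l) = ?l - j" using up p(4)[of j ?l] ij long by simp
    finally have 1: "d (p i) (v \<otimes> g) = ?l - j" .
    then show "d g (v \<otimes> g) \<le> ?l - (j - i)"
      using d_triangle[OF g c(1), of "v \<otimes> g"] vc g di ij long by simp
    have "d (p j) (u \<otimes> g) = d (p i) g" using d_translate[OF uc c(1) g] up by simp
    then have "d g (u \<otimes> g) \<le> j + i"
      using d_triangle[OF g c(2), of "u \<otimes> g"] uc g dj di d_sym[OF g c(1)] by simp
    then show "d g (u \<otimes> g) \<le> 2 * index" using ij by simp
  qed (use u v c in auto)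
qed

end

text \<open>Invariance under conjugation by the whole group, and not only by \<open>N\<close>, is what makes the norm comparable
  with displacements \<open>d g (n \<otimes> g)\<close> at all vertices \<open>g\<close> with the same constant.\<close>

locale invariant_norm = cayley_graph_subgroup G S N for G (structure) and S and N +
  fixes H :: "('a \<Rightarrow> real) set"
  assumes finite_H: "finite H"
    and additive_H: "\<eta> \<in> H \<Longrightarrow> additive_on G N \<eta>"
    and norm_conj: "n \<in> N \<Longrightarrow> g \<in> carrier G \<Longrightarrow>
      L2_set (\<lambda>\<eta>. \<eta> (g \<otimes> n \<otimes> inv g)) H = L2_set (\<lambda>\<eta>. \<eta> n) H"
begin

definition nrm :: "'a \<Rightarrow> real" where "nrm n = L2_set (\<lambda>\<eta>. \<eta> n) H"

lemma nrm_nonneg: "0 \<le> nrm n" by (simp add: nrm_def L2_set_nonneg)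

lemma nrm_mult_le: "u \<in> N \<Longrightarrow> v \<in> N \<Longrightarrow> nrm (u \<otimes> v) \<le> nrm u + nrm v"
proof -
  assume "u \<in> N" "v \<in> N"
  then have "nrm (u \<otimes> v) = L2_set (\<lambda>\<eta>. \<eta> u + \<eta> v) H"
    unfolding nrm_def using additive_on_mult[OF additive_H] by (intro L2_set_cong) auto
  then show ?thesis unfolding nrm_def using L2_set_triangle_ineq by metis
qed

lemma nrm_conj:
  assumes "n \<in> N" "g \<in> carrier G" shows "nrm (inv g \<otimes> n \<otimes> g) = nrm n"
  using norm_conj[OF assms(1), of "inv g"] assms(2) by (simp add: nrm_def)

lemma nrm_one: "nrm \<one> = 0"
proof -
  have "\<eta> \<one> = 0" if "\<eta> \<in> H" for \<eta> using additive_on_one[OF additive_H[OF that] subgroup_axioms] .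
  then have "(\<Sum>\<eta>\<in>H. (\<eta> \<one>)\<^sup>2) = 0" by (intro sum.neutral ballI) (metis zero_power2)
  then show ?thesis by (simp add: nrm_def L2_set_def)
qed

text \<open>By cutting loops out of geodesics, the ratio of norm and word length is bounded by its values on the
  finitely many elements of length at most the index of \<open>N\<close>.\<close>

lemma max_slope:
  assumes a: "a \<in> N" "nrm a > 0"
  obtains M :: real and c where "M > 0" "c \<in> N" "d \<one> c > 0" "nrm c = M * d \<one> c"
    "\<And>n g. n \<in> N \<Longrightarrow> g \<in> carrier G \<Longrightarrow> nrm n \<le> M * d g (n \<otimes> g)"
proof -
  define F where "F = {n \<in> N. 0 < d \<one> n \<and> d \<one> n \<le> index}"
  have "F \<subseteq> {h \<in> carrier G. d \<one> h \<le> index}" using N_closed by (auto simp: F_def)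
  then have finF: "finite F" using finite_ball[OF one_carrier] finite_subset by blast
  \<comment> \<open>The 0 covers the case that \<open>F\<close> is empty.\<close>
  define M where "M = Max (insert 0 ((\<lambda>n. nrm n / d \<one> n) ` F))"
  have M0: "0 \<le> M" unfolding M_def using finF by (intro Max_ge) auto
  have MF: "nrm n \<le> M * d \<one> n" if "n \<in> F" for n
  proof -
    have "nrm n / d \<one> n \<le> M" unfolding M_def using finF that by (intro Max_ge) auto
    then show ?thesis using that by (simp add: F_def field_simps)
  qed
  have base: "nrm n \<le> M * d \<one> n" if "n \<in> N" for n
    using that
  proof (induction "d \<one> n" arbitrary: n rule: less_induct)
    case less
    note n = less.prems
    have nc: "n \<in> carrier G" using n N_closed by blast
    consider "d \<one> n = 0" | "n \<in> F" | "index < d \<one> n" using n unfolding F_def by force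
    then show ?case
    proof cases
      case 1
      then have "n = \<one>" using d_zeroD[OF one_carrier nc] by simp
      then show ?thesis using nrm_one by simp
    next
      case 2 then show ?thesis by (rule MF)
    next
      case 3
      have "index < d \<one> (n \<otimes> \<one>)" using 3 nc by simp
      then obtain u v x k where l: "u \<in> N" "v \<in> N" "n = u \<otimes> v" "x \<in> carrier G" "0 < k" "k \<le> index"
        "d x (u \<otimes> x) = k" "d \<one> (v \<otimes> \<one>) \<le> d \<one> (n \<otimes> \<one>) - k"
        using remove_loop[OF one_carrier n] by metis
      have uc: "u \<in> carrier G" "v \<in> carrier G" using l N_closed by blast+
      let ?w = "inv x \<otimes> u \<otimes> x"
      have w: "?w \<in> N" using inv_op_closed1[OF l(4,1)] .
      have dw: "d \<one> ?w = k" using d_conj[OF l(4) uc(1) one_carrier] l(4,7) uc by simp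
      have "nrm u = nrm ?w" using nrm_conj[OF l(1,4)] by simp
      also have "\<dots> \<le> M * k" using less.hyps[OF _ w] dw 3 l(6) by simp
      finally have 1: "nrm u \<le> M * k" .
      have dv: "d \<one> v \<le> d \<one> n - k" using l(8) uc nc by simp
      have "nrm v \<le> M * d \<one> v" using less.hyps[OF _ l(2)] dv l(5) 3 by simp
      also have "\<dots> \<le> M * (d \<one> n - k)" using dv M0 by (simp add: mult_left_mono)
      finally have "nrm n \<le> M * k + M * (d \<one> n - k)" using nrm_mult_le[OF l(1,2)] 1 l(3) by simp
      also have "\<dots> = M * d \<one> n" using 3 l(6) by (simp add: algebra_simps of_nat_diff)
      finally show ?thesis .
    qed
  qed
  have all: "nrm n \<le> M * d g (n \<otimes> g)" if n: "n \<in> N" and g: "g \<in> carrier G" for n g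
  proof -
    have nc: "n \<in> carrier G" using n N_closed by blast
    have "nrm n = nrm (inv g \<otimes> n \<otimes> g)" using nrm_conj[OF n g] by simp
    also have "\<dots> \<le> M * d \<one> (inv g \<otimes> n \<otimes> g)" by (rule base[OF inv_op_closed1[OF g n]])
    also have "d \<one> (inv g \<otimes> n \<otimes> g) = d g (n \<otimes> g)" using d_conj[OF g nc one_carrier] g nc by simp
    finally show ?thesis .
  qed
  have "M \<noteq> 0" using base[OF a(1)] a(2) by auto
  then have Mpos: "M > 0" using M0 by simp
  have "M \<in> insert 0 ((\<lambda>n. nrm n / d \<one> n) ` F)" unfolding M_def using finF by (intro Max_in) auto
  then obtain c where "c \<in> F" "M = nrm c / d \<one> c" using Mpos by auto
  then have "c \<in> N" "d \<one> c > 0" "nrm c = M * d \<one> c" by (auto simp: F_def)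
  then show thesis by (rule that[OF Mpos]) (rule all)
qed

end

text \<open>From here on \<open>c\<close> is an element of maximal slope seen from the base point \<open>b\<close>. Pairing with
  \<open>c\<close> gives the additive function \<open>\<phi>\<close>.\<close>

locale maximal_slope = invariant_norm G S N H for G (structure) and S and N and H +
  fixes M :: real and b and c
  assumes M_pos: "M > 0" and b: "b \<in> carrier G" and c: "c \<in> N" and c_pos: "d b (c \<otimes> b) > 0"
    and nrm_c: "nrm c = M * d b (c \<otimes> b)"
    and slope_le: "n \<in> N \<Longrightarrow> g \<in> carrier G \<Longrightarrow> nrm n \<le> M * d g (n \<otimes> g)"
    and curvature: "nonneg_ollivier_ricci G S"
begin

definition \<phi> :: "'a \<Rightarrow> real" where "\<phi> n = (\<Sum>\<eta>\<in>H. \<eta> n * \<eta> c)"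

definition \<mu> :: real where "\<mu> = M\<^sup>2 * d b (c \<otimes> b)"

lemma mu_pos: "\<mu> > 0" using M_pos c_pos by (simp add: \<mu>_def)

lemma additive_phi: "additive_on G N \<phi>"
  unfolding additive_on_def
proof (intro ballI)
  fix x y assume xy: "x \<in> N" "y \<in> N"
  have "\<phi> (x \<otimes> y) = (\<Sum>\<eta>\<in>H. \<eta> x * \<eta> c + \<eta> y * \<eta> c)"
    unfolding \<phi>_def
  proof (rule sum.cong)
    fix \<eta> assume "\<eta> \<in> H"
    then show "\<eta> (x \<otimes> y) * \<eta> c = \<eta> x * \<eta> c + \<eta> y * \<eta> c"
      using additive_on_mult[OF additive_H[OF \<open>\<eta> \<in> H\<close>] xy] by (simp add: distrib_right)
  qed simp
  then show "\<phi> (x \<otimes> y) = \<phi> x + \<phi> y" by (simp add: \<phi>_def sum.distrib)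
qed

lemma phi_le:
  assumes n: "n \<in> N" and g: "g \<in> carrier G" shows "\<phi> n \<le> \<mu> * d g (n \<otimes> g)"
proof -
  have "\<phi> n \<le> (\<Sum>\<eta>\<in>H. \<bar>\<eta> n\<bar> * \<bar>\<eta> c\<bar>)"
    unfolding \<phi>_def by (rule sum_mono) (metis abs_ge_self abs_mult)
  also have "\<dots> \<le> nrm n * nrm c" unfolding nrm_def by (rule L2_set_mult_ineq)
  also have "\<dots> \<le> (M * d g (n \<otimes> g)) * nrm c"
    using slope_le[OF n g] nrm_nonneg by (rule mult_right_mono)
  also have "\<dots> = \<mu> * d g (n \<otimes> g)" by (simp add: nrm_c \<mu>_def power2_eq_square)
  finally show ?thesis .
qed

lemma phi_c: "\<phi> c = \<mu> * d b (c \<otimes> b)"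
proof -
  have "\<phi> c = (nrm c)\<^sup>2" by (simp add: \<phi>_def nrm_def L2_set_def sum_nonneg power2_eq_square)
  then show ?thesis by (simp add: nrm_c \<mu>_def power2_eq_square)
qed

text \<open>The equality case of the Cauchy--Schwarz inequality.\<close>

lemma parallel_to_c:
  assumes n: "n \<in> N" and g: "g \<in> carrier G" and eq: "\<phi> n = \<mu> * d g (n \<otimes> g)" and \<eta>: "\<eta> \<in> H"
  shows "\<eta> n = (d g (n \<otimes> g) / d b (c \<otimes> b)) * \<eta> c"
proof -
  define l where "l = real (d b (c \<otimes> b))"
  define k where "k = real (d g (n \<otimes> g))"
  have sq: "(\<Sum>\<eta>\<in>H. (\<eta> n)\<^sup>2) = (nrm n)\<^sup>2" for n
    by (simp add: nrm_def L2_set_def sum_nonneg)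
  have nn: "(nrm n)\<^sup>2 \<le> (M * k)\<^sup>2"
    using slope_le[OF n g] nrm_nonneg by (intro power_mono) (auto simp: k_def)
  have "(\<Sum>\<eta>\<in>H. (l * \<eta> n - k * \<eta> c)\<^sup>2)
      = (\<Sum>\<eta>\<in>H. l\<^sup>2 * (\<eta> n)\<^sup>2 - 2 * l * k * (\<eta> n * \<eta> c) + k\<^sup>2 * (\<eta> c)\<^sup>2)"
    by (rule sum.cong) (auto simp: power2_eq_square algebra_simps)
  also have "\<dots> = l\<^sup>2 * (nrm n)\<^sup>2 - 2 * l * k * \<phi> n + k\<^sup>2 * (nrm c)\<^sup>2"
    by (simp add: sum.distrib sum_subtractf sum_distrib_left [symmetric] sq \<phi>_def)
  also have "\<dots> \<le> l\<^sup>2 * (M * k)\<^sup>2 - 2 * l * k * \<phi> n + k\<^sup>2 * (nrm c)\<^sup>2"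
    using nn by (simp add: mult_left_mono)
  also have "\<dots> = 0"
    by (simp add: eq nrm_c \<mu>_def flip: l_def k_def) (simp add: power2_eq_square algebra_simps)
  finally have "(\<Sum>\<eta>\<in>H. (l * \<eta> n - k * \<eta> c)\<^sup>2) = 0"
    using sum_nonneg[of H "\<lambda>\<eta>. (l * \<eta> n - k * \<eta> c)\<^sup>2"] by simp
  then have "(l * \<eta> n - k * \<eta> c)\<^sup>2 = 0"
    using sum_nonneg_eq_0_iff[OF finite_H, of "\<lambda>\<eta>. (l * \<eta> n - k * \<eta> c)\<^sup>2"] \<eta> by simp
  then have "l * \<eta> n = k * \<eta> c" by simp
  moreover have "l > 0" using c_pos by (simp add: l_def)
  ultimately show ?thesis by (simp add: field_simps flip: l_def k_def)
qed

text \<open>The largest Lipschitz function that is at most \<open>\<phi>\<close> on \<open>N\<close>.\<close>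

definition potential :: "'a \<Rightarrow> real" where
  "potential g = (INF n\<in>N. \<phi> n + \<mu> * d n g)"

lemma potential_bdd: "g \<in> carrier G \<Longrightarrow> bdd_below ((\<lambda>n. \<phi> n + \<mu> * d n g) ` N)"
proof (rule bdd_belowI2)
  fix n assume g: "g \<in> carrier G" and n: "n \<in> N"
  have nc: "n \<in> carrier G" using n N_closed by blast
  have "- \<phi> n = \<phi> (inv n)" using additive_on_inv[OF additive_phi subgroup_axioms n] by simp
  also have "\<dots> \<le> \<mu> * d n (inv n \<otimes> n)" by (rule phi_le[OF _ nc]) (use n in simp)
  also have "\<dots> = \<mu> * d n \<one>" using nc by simp
  also have "\<dots> \<le> \<mu> * (d n g + d g \<one>)" using d_triangle[OF nc g one_carrier] mu_pos by simp
  finally show "- (\<mu> * d g \<one>) \<le> \<phi> n + \<mu> * d n g" by (simp add: algebra_simps)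
qed

lemma potential_le: "g \<in> carrier G \<Longrightarrow> n \<in> N \<Longrightarrow> potential g \<le> \<phi> n + \<mu> * d n g"
  unfolding potential_def by (rule cINF_lower[OF potential_bdd])

lemma potential_greatest:
  "(\<And>n. n \<in> N \<Longrightarrow> r \<le> \<phi> n + \<mu> * d n g) \<Longrightarrow> r \<le> potential g"
  unfolding potential_def using c by (intro cINF_greatest) auto

lemma potential_translate_ge:
  assumes n: "n \<in> N" and g: "g \<in> carrier G" shows "\<phi> n + potential g \<le> potential (n \<otimes> g)"
proof (rule potential_greatest)
  fix m assume m: "m \<in> N"
  have mc: "m \<in> carrier G" and nc: "n \<in> carrier G" using m n N_closed by blast+
  have "potential g \<le> \<phi> (inv n \<otimes> m) + \<mu> * d (inv n \<otimes> m) g"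
    using n m by (intro potential_le[OF g]) simp
  also have "d (inv n \<otimes> m) g = d m (n \<otimes> g)"
    using d_translate[OF nc, of "inv n \<otimes> m" g] mc nc g by simp
  also have "\<phi> (inv n \<otimes> m) = - \<phi> n + \<phi> m"
    using n m additive_on_mult[OF additive_phi, of "inv n" m] additive_on_inv[OF additive_phi subgroup_axioms n] by simp
  finally show "\<phi> n + potential g \<le> \<phi> m + \<mu> * d m (n \<otimes> g)" by simp
qed

sublocale potential: equivariant_lipschitz_function G S potential \<mu> N \<phi>
proof
  show "0 < \<mu>" by (rule mu_pos)
  show "nonneg_ollivier_ricci G S" by (rule curvature)
  show "potential y - potential x \<le> \<mu> * d x y" if x: "x \<in> carrier G" and y: "y \<in> carrier G" for x y
  proof -
    have "potential y - \<mu> * d x y \<le> potential x"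
    proof (rule potential_greatest)
      fix n assume n: "n \<in> N"
      have nc: "n \<in> carrier G" using n N_closed by blast
      have "\<mu> * d n y \<le> \<mu> * (d n x + d x y)" using d_triangle[OF nc x y] mu_pos by simp
      then show "potential y - \<mu> * d x y \<le> \<phi> n + \<mu> * d n x"
        using potential_le[OF y n] by (simp add: algebra_simps)
    qed
    then show ?thesis by simp
  qed
  show "potential (n \<otimes> g) = \<phi> n + potential g" if n: "n \<in> N" and g: "g \<in> carrier G" for n g
  proof (rule antisym)
    have nc: "n \<in> carrier G" using n N_closed by blast
    show "\<phi> n + potential g \<le> potential (n \<otimes> g)" by (rule potential_translate_ge[OF n g])
    have "\<phi> (inv n) + potential (n \<otimes> g) \<le> potential (inv n \<otimes> (n \<otimes> g))"
      using n g nc by (intro potential_translate_ge) auto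
    then show "potential (n \<otimes> g) \<le> \<phi> n + potential g"
      using additive_on_inv[OF additive_phi subgroup_axioms n] nc g by simp
  qed
qed

lemma c_closed: "c \<in> carrier G" using c N_closed by blast

lemma phi_c_pow: "\<phi> (c [^] (j::nat)) = \<mu> * (j * d b (c \<otimes> b))"
  using additive_on_pow(2)[OF additive_phi subgroup_axioms c, of j] phi_c by simp

text \<open>By recurrence along the edges of the graph, some power of \<open>c\<close> has maximal slope seen from any
  given vertex.\<close>

lemma maximal_slope_everywhere:
  assumes x: "x \<in> carrier G"
  obtains j :: nat where "j > 0" "\<phi> (c [^] j) = \<mu> * d x (c [^] j \<otimes> x)"
proof -
  have "\<exists>j::nat. j > 0 \<and> \<phi> (c [^] j) = \<mu> * d y (c [^] j \<otimes> y)" if "(b, y) \<in> edges ^^ n" for n y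
    using that
  proof (induction n arbitrary: y)
    case 0 then show ?case using phi_c c_closed by (intro exI[of _ 1]) simp
  next
    case (Suc n)
    then obtain z where z: "(b, z) \<in> edges ^^ n" "(z, y) \<in> edges" by auto
    obtain j where j: "(j::nat) > 0" "\<phi> (c [^] j) = \<mu> * d z (c [^] j \<otimes> z)" using Suc.IH[OF z(1)] by blast
    obtain s where s: "z \<in> carrier G" "s \<in> S" "y = z \<otimes> s" using z(2) edge_iff by blast
    obtain i where "(i::nat) > 0" "\<phi> ((c [^] j) [^] i) = \<mu> * d y ((c [^] j) [^] i \<otimes> y)"
      using potential.period_at_neighbour[OF pow_mem[OF is_group c] s(1) j(2) s(2)] s(3) by metis
    then show ?case using j(1) c_closed by (intro exI[of _ "j * i"]) (simp add: nat_pow_pow)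
  qed
  then show thesis using d_walk[OF b x] that by blast
qed

text \<open>The elements that are parallel to \<open>c\<close> up to the kernel of the norm.\<close>

definition L :: "'a set" where
  "L = {n \<in> N. \<exists>r. \<forall>\<eta>\<in>H. \<eta> n = r * \<eta> c}"

lemma L_subgroup: "subgroup L G"
proof (rule subgroupI)
  show "L \<subseteq> carrier G" using N_closed by (auto simp: L_def)
  have "\<forall>\<eta>\<in>H. \<eta> c = 1 * \<eta> c" by simp
  then show "L \<noteq> {}" using c unfolding L_def by blast
  fix x assume "x \<in> L"
  then obtain r where x: "x \<in> N" "\<forall>\<eta>\<in>H. \<eta> x = r * \<eta> c" by (auto simp: L_def)
  have "\<forall>\<eta>\<in>H. \<eta> (inv x) = (- r) * \<eta> c"
    using additive_on_inv[OF additive_H subgroup_axioms x(1)] x(2) by simp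
  then show "inv x \<in> L" using x(1) unfolding L_def by blast
  fix y assume "y \<in> L"
  then obtain r' where y: "y \<in> N" "\<forall>\<eta>\<in>H. \<eta> y = r' * \<eta> c" by (auto simp: L_def)
  have "\<forall>\<eta>\<in>H. \<eta> (x \<otimes> y) = (r + r') * \<eta> c"
    using additive_on_mult[OF additive_H x(1) y(1)] x(2) y(2) by (simp add: algebra_simps)
  then show "x \<otimes> y \<in> L" using x(1) y(1) unfolding L_def by blast
qed

lemma maximal_slope_in_L:
  assumes "n \<in> N" "g \<in> carrier G" "\<phi> n = \<mu> * d g (n \<otimes> g)" shows "n \<in> L"
  using parallel_to_c[OF assms] assms(1) unfolding L_def by blast

text \<open>Cutting loops out of a geodesic from \<open>b\<close> to \<open>n \<otimes> b\<close> writes an element of maximal slope as a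
  product of elements from a finite set, with at most as many factors as the length.\<close>

lemma additive_le_length:
  assumes \<Psi>: "additive_on G L \<Psi>"
  obtains A :: real where "\<And>n. n \<in> N \<Longrightarrow> \<phi> n = \<mu> * d b (n \<otimes> b) \<Longrightarrow> \<Psi> n \<le> A * d b (n \<otimes> b)"
proof -
  define D where "D = {n \<in> N. d b (n \<otimes> b) \<le> 2 * index}"
  have "inj_on (\<lambda>n. n \<otimes> b) D" using N_closed b by (auto simp: inj_on_def D_def)
  moreover have "(\<lambda>n. n \<otimes> b) ` D \<subseteq> {h \<in> carrier G. d b h \<le> 2 * index}"
    using N_closed b by (auto simp: D_def)
  ultimately have finD: "finite D" using finite_ball[OF b] by (meson finite_imageD finite_subset)
  define A where "A = (\<Sum>n\<in>D. \<bar>\<Psi> n\<bar>)"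
  have A0: "0 \<le> A" by (simp add: A_def sum_nonneg)
  have AD: "\<Psi> n \<le> A" if "n \<in> D" for n
    using member_le_sum[OF that, of "\<lambda>n. \<bar>\<Psi> n\<bar>"] finD by (simp add: A_def)
  have "\<Psi> n \<le> A * d b (n \<otimes> b)" if "n \<in> N" "\<phi> n = \<mu> * d b (n \<otimes> b)" for n
    using that
  proof (induction "d b (n \<otimes> b)" arbitrary: n rule: less_induct)
    case less
    note n = less.prems
    have nc: "n \<in> carrier G" using n N_closed by blast
    let ?l = "d b (n \<otimes> b)"
    consider "?l = 0" | "0 < ?l" "?l \<le> index" | "index < ?l" by force
    then show ?case
    proof cases
      case 1
      then have "n \<otimes> b = b" using d_zeroD[OF b, of "n \<otimes> b"] nc b by simp
      then have "n = \<one>" using nc b by simp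
      then show ?thesis using additive_on_one[OF \<Psi> L_subgroup] 1 by simp
    next
      case 2
      have "\<Psi> n \<le> A * 1" using AD[of n] 2 n(1) by (simp add: D_def)
      also have "\<dots> \<le> A * ?l" using A0 2 by (intro mult_left_mono) auto
      finally show ?thesis .
    next
      case 3
      then obtain u v x k where l: "u \<in> N" "v \<in> N" "n = u \<otimes> v" "x \<in> carrier G" "0 < k" "k \<le> index"
        "d x (u \<otimes> x) = k" "d b (v \<otimes> b) \<le> ?l - k" "d b (u \<otimes> b) \<le> 2 * index"
        using remove_loop[OF b n(1)] by metis
      have "\<phi> u + \<phi> v = \<mu> * ?l" using additive_on_mult[OF additive_phi l(1,2)] l(3) n(2) by simp
      moreover have u: "\<phi> u \<le> \<mu> * k" using phi_le[OF l(1,4)] l(7) by simp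
      moreover have v: "\<phi> v \<le> \<mu> * d b (v \<otimes> b)" by (rule phi_le[OF l(2) b])
      moreover have vk: "\<mu> * d b (v \<otimes> b) \<le> \<mu> * (?l - k)" using l(8) mu_pos by simp
      moreover have "\<mu> * real (?l - k) = \<mu> * ?l - \<mu> * k" using 3 l(6) by (simp add: of_nat_diff algebra_simps)
      ultimately have eq: "\<phi> u = \<mu> * k" "\<phi> v = \<mu> * d b (v \<otimes> b)" "\<mu> * d b (v \<otimes> b) = \<mu> * (?l - k)"
        by linarith+
      have dv: "d b (v \<otimes> b) = ?l - k" using eq(3) mu_pos by simp
      have uL: "u \<in> L" using maximal_slope_in_L[OF l(1,4)] eq(1) l(7) by simp
      have vL: "v \<in> L" using maximal_slope_in_L[OF l(2) b eq(2)] .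
      have "\<Psi> v \<le> A * (?l - k)" using less.hyps[OF _ l(2) eq(2)] dv l(5) 3 by simp
      moreover have "\<Psi> u \<le> A" using AD[of u] l(1,9) by (simp add: D_def)
      moreover have "A * 1 \<le> A * k" using A0 l(5) by (intro mult_left_mono) auto
      moreover have "A * real (?l - k) = A * ?l - A * k" using 3 l(6) by (simp add: of_nat_diff algebra_simps)
      ultimately show ?thesis using additive_on_mult[OF \<Psi> uL vL] l(3) by simp
    qed
  qed
  note bound = this
  show thesis by (rule that[of A]) (rule bound)
qed

text \<open>Conjugating a suitable power of \<open>c\<close> by \<open>x\<^sup>i\<close> gives an element of maximal slope of the same length. Its
  value under \<open>\<Psi>\<close>, relative to the length, would grow with \<open>i\<close>.\<close>

lemma no_shear:
  assumes \<Psi>: "additive_on G L \<Psi>" and x: "x \<in> N" and \<delta>: "\<delta> > 0"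
    and shear: "\<And>i j. commutator G (inv (c [^] (j::nat))) (inv (x [^] (i::nat))) \<in> L \<and>
      \<Psi> (commutator G (inv (c [^] (j::nat))) (inv (x [^] (i::nat)))) = real i * real j * \<delta>"
  shows False
proof -
  obtain A :: real where A: "\<And>n. n \<in> N \<Longrightarrow> \<phi> n = \<mu> * d b (n \<otimes> b) \<Longrightarrow> \<Psi> n \<le> A * d b (n \<otimes> b)"
    using additive_le_length[OF \<Psi>] by blast
  have cL: "c \<in> L" using maximal_slope_in_L[OF c b phi_c] .
  have xc: "x \<in> carrier G" using x N_closed by blast
  have bound: "\<Psi> c + i * \<delta> \<le> A * d b (c \<otimes> b)" for i :: nat
  proof -
    let ?x = "x [^] i"
    have xi: "?x \<in> N" "?x \<in> carrier G" using pow_mem[OF is_group x] xc by auto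
    obtain j where j: "(j::nat) > 0" "\<phi> (c [^] j) = \<mu> * d (?x \<otimes> b) (c [^] j \<otimes> (?x \<otimes> b))"
      using maximal_slope_everywhere[of "?x \<otimes> b"] xi b by blast
    have cj: "c [^] j \<in> N" "c [^] j \<in> carrier G" using pow_mem[OF is_group c] c_closed by auto
    let ?n = "inv ?x \<otimes> c [^] j \<otimes> ?x"
    have n: "?n \<in> N" using inv_op_closed1[OF xi(2) cj(1)] .
    have dn: "d (?x \<otimes> b) (c [^] j \<otimes> (?x \<otimes> b)) = d b (?n \<otimes> b)"
      using d_conj[OF xi(2) cj(2) b] .
    have phin: "\<phi> ?n = \<phi> (c [^] j)"
      using additive_on_conj[OF additive_phi subgroup_axioms _ cj(1), of "inv ?x"] xi by simp
    then have "\<mu> * d b (?n \<otimes> b) = \<mu> * (j * d b (c \<otimes> b))" using j(2) phi_c_pow[of j] unfolding dn by linarith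
    then have len: "real (d b (?n \<otimes> b)) = j * d b (c \<otimes> b)" using mu_pos by simp
    have "?n = c [^] j \<otimes> commutator G (inv (c [^] j)) (inv ?x)"
      using cj(2) xi(2) by (simp add: commutator_def group_word_simps)
    then have "\<Psi> ?n = \<Psi> (c [^] j) + i * j * \<delta>"
      using additive_on_mult[OF \<Psi> additive_on_pow(1)[OF \<Psi> L_subgroup cL, of j]] shear[of j i] by simp
    then have "j * \<Psi> c + i * j * \<delta> \<le> A * (j * d b (c \<otimes> b))"
      using A[OF n] phin j(2) dn len additive_on_pow(2)[OF \<Psi> L_subgroup cL, of j] by simp
    then have "real j * (\<Psi> c + i * \<delta>) \<le> real j * (A * d b (c \<otimes> b))" by (simp add: algebra_simps)
    then show ?thesis using j(1) by simp
  qed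
  obtain i where "(A * d b (c \<otimes> b) - \<Psi> c) / \<delta> < real i" using reals_Archimedean2 by blast
  then have "A * d b (c \<otimes> b) - \<Psi> c < real i * \<delta>" using \<delta> by (simp add: field_simps)
  then show False using bound[of i] by simp
qed

end

section \<open>Non-negative curvature forces virtual commutativity\<close>

lemma (in group) virtually_abelian_of_central_mod:
  assumes N: "N \<lhd> G" and fin: "finite (rcosets N)"
    and Z: "finite_index_in G (central_mod (G\<lparr>carrier := N\<rparr>) {\<one>}) N"
  shows "virtually_abelian G"
proof -
  interpret N: normal N G by (rule N)
  interpret NG: group "G\<lparr>carrier := N\<rparr>" using N.subgroup_axioms by (rule subgroup_imp_group)
  define Z where "Z = central_mod (G\<lparr>carrier := N\<rparr>) {\<one>}"
  have Z_iff: "x \<in> Z \<longleftrightarrow> x \<in> N \<and> (\<forall>y\<in>N. x \<otimes> y = y \<otimes> x)" for x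
    using NG.commuting_if_commutator_one[of x] by (auto simp: Z_def central_mod_def)
  have ZN: "Z \<subseteq> N" using Z_iff by blast
  have Nc: "x \<in> carrier G" if "x \<in> N" for x using that N.subset by blast
  have conj: "g \<otimes> x \<otimes> inv g \<in> Z" if x: "x \<in> Z" and g: "g \<in> carrier G" for x g
    unfolding Z_iff
  proof (intro conjI ballI)
    show "g \<otimes> x \<otimes> inv g \<in> N" using N.inv_op_closed2 g x ZN by blast
    fix y assume y: "y \<in> N"
    have xc: "x \<in> carrier G" "y \<in> carrier G" using x y ZN Nc by blast+
    have "x \<otimes> (inv g \<otimes> y \<otimes> g) = (inv g \<otimes> y \<otimes> g) \<otimes> x" using x N.inv_op_closed1[OF g y] Z_iff by blast
    then have "g \<otimes> (x \<otimes> (inv g \<otimes> y \<otimes> g)) \<otimes> inv g = g \<otimes> ((inv g \<otimes> y \<otimes> g) \<otimes> x) \<otimes> inv g" by simp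
    then show "g \<otimes> x \<otimes> inv g \<otimes> y = y \<otimes> (g \<otimes> x \<otimes> inv g)" using xc g by (simp add: m_assoc)
  qed
  have "subgroup Z (G\<lparr>carrier := N\<rparr>)"
    unfolding Z_def using normal.central_mod_subgroup[OF NG.one_is_normal] by simp
  then have sub: "subgroup Z G" by (rule incl_subgroup[OF N.subgroup_axioms])
  have "Z \<lhd> G" unfolding normal_inv_iff using sub conj by blast
  moreover have "finite (rcosets Z)"
    unfolding finite_index_in_iff_finite_rcosets[OF sub, symmetric]
    by (rule finite_index_in_trans[OF Z[folded Z_def] _ N.subset _ subgroup_self])
      (use fin ZN N.subset finite_index_in_iff_finite_rcosets[OF N.subgroup_axioms] in auto)
  moreover have "comm_group (G\<lparr>carrier := Z\<rparr>)"
  proof (rule group.group_comm_groupI[OF subgroup_imp_group[OF sub]])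
    fix x y assume "x \<in> carrier (G\<lparr>carrier := Z\<rparr>)" "y \<in> carrier (G\<lparr>carrier := Z\<rparr>)"
    then have "x \<in> Z" "y \<in> N" using ZN by auto
    then show "x \<otimes>\<^bsub>G\<lparr>carrier := Z\<rparr>\<^esub> y = y \<otimes>\<^bsub>G\<lparr>carrier := Z\<rparr>\<^esub> x" using Z_iff by simp
  qed
  ultimately show ?thesis unfolding virtually_abelian_def by blast
qed

locale commutator_form = cayley_graph_subgroup G S N for G (structure) and S and N +
  fixes f :: "'a \<Rightarrow> real" and gens
  assumes f_additive: "additive_on G (lower_central (G\<lparr>carrier := N\<rparr>) 1) f"
    and f_zero: "z \<in> lower_central (G\<lparr>carrier := N\<rparr>) 2 \<Longrightarrow> f z = 0"
    and gens: "finite gens" "gens \<subseteq> N" "generate G gens = N"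
begin

abbreviation NG where "NG \<equiv> G\<lparr>carrier := N\<rparr>"

sublocale NG: group NG
  using subgroup_axioms by (rule subgroup_imp_group)

definition form :: "'a \<Rightarrow> 'a \<Rightarrow> real" where "form x y = f (commutator G x y)"

lemma commutator_N: "x \<in> N \<Longrightarrow> y \<in> N \<Longrightarrow> commutator NG x y = commutator G x y"
  using commutator_restrict[OF subgroup_axioms] .

lemma commutator_in_derived: "x \<in> N \<Longrightarrow> y \<in> N \<Longrightarrow> commutator G x y \<in> lower_central NG 1"
  using NG.commutator_in_lower_central(1)[of x 0 y] commutator_N by simp

lemma form_left:
  assumes "x \<in> N" "x' \<in> N" "y \<in> N" shows "form (x \<otimes> x') y = form x y + form x' y"
  using NG.commutator_form_additive(1)[of f x x' y] assms f_additive f_zero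
  by (simp add: form_def commutator_N)

lemma form_right:
  assumes "x \<in> N" "x' \<in> N" "y \<in> N" shows "form y (x \<otimes> x') = form y x + form y x'"
  using NG.commutator_form_additive(2)[of f x x' y] assms f_additive f_zero
  by (simp add: form_def commutator_N)

lemma form_swap:
  assumes "x \<in> N" "y \<in> N" shows "form x y = - form y x"
  using NG.commutator_form_additive(3)[of f x x y] assms f_additive f_zero
  by (simp add: form_def commutator_N)

lemma additive_form_left: "y \<in> N \<Longrightarrow> additive_on G N (\<lambda>x. form x y)"
  by (simp add: additive_on_def form_left)

lemma additive_form_right: "x \<in> N \<Longrightarrow> additive_on G N (form x)"
  by (simp add: additive_on_def form_right)

lemma additive_eq_of_generators:
  assumes u: "additive_on G N u" and v: "additive_on G N v"
    and eq: "\<And>y. y \<in> gens \<Longrightarrow> u y = v y" and y: "y \<in> N"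
  shows "u y = v y"
proof -
  have "y \<in> generate G gens" using y gens(3) by simp
  then have "y \<in> N \<and> u y = v y"
  proof (induction rule: generate.induct)
    case one
    then show ?case using additive_on_one[OF u subgroup_axioms] additive_on_one[OF v subgroup_axioms] by simp
  next
    case (incl h) then show ?case using gens(2) eq by blast
  next
    case (inv h)
    then have h: "h \<in> N" using gens(2) by blast
    then show ?case using additive_on_inv[OF u subgroup_axioms h] additive_on_inv[OF v subgroup_axioms h]
        eq[OF inv] by simp
  next
    case (eng h1 h2)
    then show ?case using additive_on_mult[OF u] additive_on_mult[OF v] by simp
  qed
  then show ?thesis by blast
qed

text \<open>The functions obtained from the form by fixing a generator in one argument, together with
  their conjugates. They are zero outside \<open>N\<close>, which makes conjugation act on this set.\<close>

definition conj_form :: "'a \<Rightarrow> 'a \<Rightarrow> 'a \<Rightarrow> real" where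
  "conj_form g y = (\<lambda>n. if n \<in> N then form (g \<otimes> n \<otimes> inv g) y else 0)"

definition H :: "('a \<Rightarrow> real) set" where
  "H = {conj_form g y | g y. g \<in> carrier G \<and> y \<in> gens}"

lemma conj_form_mult:
  assumes "g \<in> carrier G" "h \<in> carrier G" "n \<in> N"
  shows "conj_form g y (h \<otimes> n \<otimes> inv h) = conj_form (g \<otimes> h) y n"
  using assms inv_op_closed2[OF assms(2,3)] N_closed by (simp add: conj_form_def group_word_simps)

lemma additive_conj_form:
  assumes g: "g \<in> carrier G" and y: "y \<in> N" shows "additive_on G N (conj_form g y)"
  unfolding additive_on_def
proof (intro ballI)
  fix n m assume nm: "n \<in> N" "m \<in> N"
  then have c: "n \<in> carrier G" "m \<in> carrier G" using N_closed by blast+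
  have "g \<otimes> (n \<otimes> m) \<otimes> inv g = (g \<otimes> n \<otimes> inv g) \<otimes> (g \<otimes> m \<otimes> inv g)"
    using c g by (simp add: m_assoc)
  then show "conj_form g y (n \<otimes> m) = conj_form g y n + conj_form g y m"
    using form_left[OF inv_op_closed2[OF g nm(1)] inv_op_closed2[OF g nm(2)] y] nm
    by (simp add: conj_form_def)
qed

lemma finite_H: "finite H"
proof -
  obtain R where R: "finite R" "R \<subseteq> carrier G" "\<forall>k\<in>carrier G. \<exists>r\<in>R. \<exists>m\<in>N. k = m \<otimes> r"
    by (rule coset_representatives[OF is_group finite_rcosets])
  have "H \<subseteq> (\<lambda>(g, y). conj_form g y) ` (R \<times> gens)"
  proof
    fix \<eta> assume "\<eta> \<in> H"
    then obtain g y where g: "g \<in> carrier G" "y \<in> gens" "\<eta> = conj_form g y" by (auto simp: H_def)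
    obtain r m where r: "r \<in> R" "m \<in> N" "g = m \<otimes> r" using R(3) g(1) by blast
    have c: "r \<in> carrier G" "m \<in> carrier G" using r R(2) N_closed by blast+
    have yN: "y \<in> N" using g(2) gens(2) by blast
    have "conj_form g y n = conj_form r y n" for n
    proof (cases "n \<in> N")
      case True
      have "g \<otimes> n \<otimes> inv g = m \<otimes> (r \<otimes> n \<otimes> inv r) \<otimes> inv m"
        using c N_closed[OF True] r(3) by (simp add: group_word_simps)
      then show ?thesis
        using additive_on_conj[OF additive_form_left[OF yN] subgroup_axioms r(2) inv_op_closed2[OF c(1) True]] True
        by (simp add: conj_form_def)
    qed (simp add: conj_form_def)
    then have "\<eta> = conj_form r y" unfolding g(3) by (rule ext)
    then show "\<eta> \<in> (\<lambda>(g, y). conj_form g y) ` (R \<times> gens)"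
      using r(1) g(2) by (intro image_eqI[of _ _ "(r, y)"]) auto
  qed
  then show ?thesis using R(1) gens(1) by (meson finite_SigmaI finite_surj)
qed

lemma H_conj_invariant:
  assumes n: "n \<in> N" and h: "h \<in> carrier G"
  shows "L2_set (\<lambda>\<eta>. \<eta> (h \<otimes> n \<otimes> inv h)) H = L2_set (\<lambda>\<eta>. \<eta> n) H"
proof -
  define T where "T h \<eta> = (\<lambda>n. if n \<in> N then \<eta> (h \<otimes> n \<otimes> inv h) else (0::real))" for h and \<eta> :: "'a \<Rightarrow> real"
  have Tconj: "T h (conj_form g y) = conj_form (g \<otimes> h) y" if "g \<in> carrier G" "h \<in> carrier G" for g h y
    using conj_form_mult[OF that] by (auto simp: T_def conj_form_def fun_eq_iff)
  have TH: "T h \<eta> \<in> H" if \<eta>: "\<eta> \<in> H" and h: "h \<in> carrier G" for \<eta> h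
  proof -
    obtain g y where g: "g \<in> carrier G" "y \<in> gens" "\<eta> = conj_form g y" using \<eta> by (auto simp: H_def)
    have "T h \<eta> = conj_form (g \<otimes> h) y" using Tconj[OF g(1) h] g(3) by simp
    moreover have "g \<otimes> h \<in> carrier G" using g(1) h by simp
    ultimately show ?thesis using g(2) unfolding H_def by blast
  qed
  have TT: "T (inv h) (T h \<eta>) = \<eta>" if \<eta>: "\<eta> \<in> H" and h: "h \<in> carrier G" for \<eta> h
  proof -
    obtain g y where g: "g \<in> carrier G" "y \<in> gens" "\<eta> = conj_form g y" using \<eta> by (auto simp: H_def)
    have "T (inv h) (T h \<eta>) = conj_form (g \<otimes> h \<otimes> inv h) y"
      using Tconj[OF g(1) h] Tconj[of "g \<otimes> h" "inv h" y] g h by simp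
    then show ?thesis using g h by (simp add: m_assoc)
  qed
  have bij: "bij_betw (T h) H H"
  proof (rule bij_betw_byWitness[of _ "T (inv h)"])
    show "\<forall>\<eta>\<in>H. T (inv h) (T h \<eta>) = \<eta>" using TT h by blast
    show "\<forall>\<eta>\<in>H. T h (T (inv h) \<eta>) = \<eta>" using TT[of _ "inv h"] h by simp
    show "T h ` H \<subseteq> H" "T (inv h) ` H \<subseteq> H" using TH h by auto
  qed
  have "(\<Sum>\<eta>\<in>H. (\<eta> (h \<otimes> n \<otimes> inv h))\<^sup>2) = (\<Sum>\<eta>\<in>H. (T h \<eta> n)\<^sup>2)"
    using n by (simp add: T_def)
  also have "\<dots> = (\<Sum>\<eta>\<in>H. (\<eta> n)\<^sup>2)"
    by (rule sum.reindex_bij_betw[OF bij, of "\<lambda>\<eta>. (\<eta> n)\<^sup>2"])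
  finally show ?thesis by (simp add: L2_set_def)
qed

sublocale invariant_norm G S N H
proof
  show "finite H" by (rule finite_H)
  show "additive_on G N \<eta>" if "\<eta> \<in> H" for \<eta>
    using that additive_conj_form gens(2) by (auto simp: H_def)
qed (rule H_conj_invariant)

lemma form_mem_H: "y \<in> gens \<Longrightarrow> n \<in> N \<Longrightarrow> \<exists>\<eta>\<in>H. \<eta> n = form n y \<and> (\<forall>m\<in>N. \<eta> m = form m y)"
  using N_closed by (intro bexI[of _ "conj_form \<one> y"]) (auto simp: conj_form_def H_def)

lemma nrm_pos:
  assumes n: "n \<in> N" and \<eta>: "\<eta> \<in> H" "\<eta> n \<noteq> 0" shows "nrm n > 0"
proof -
  have "\<bar>\<eta> n\<bar> \<le> nrm n"
    using member_le_L2_set[OF finite_H \<eta>(1), of "\<lambda>\<eta>. \<bar>\<eta> n\<bar>"] by (simp add: nrm_def L2_set_def)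
  then show ?thesis using \<eta>(2) by simp
qed

text \<open>The additive functions in \<open>H\<close> control the form in one argument, so \<open>L\<close>, whose elements are parallel
  to \<open>c\<close> up to the radical, is isotropic. Therefore \<open>f\<close> extends from the commutator subgroup to an
  additive function on \<open>L\<close>, and the bound of additive functions by the length applies to it.\<close>

lemma form_zero_of_nonneg_curvature:
  assumes curvature: "nonneg_ollivier_ricci G S" and x: "x \<in> N" and y: "y \<in> N"
  shows "form x y = 0"
proof (rule ccontr)
  assume "form x y \<noteq> 0"
  then have "\<exists>y\<in>gens. form x y \<noteq> 0"
    using additive_eq_of_generators[OF additive_form_right[OF x], of "\<lambda>_. 0" y] y
    by (auto simp: additive_on_def)
  then obtain y0 where "y0 \<in> gens" "form x y0 \<noteq> 0" by blast
  then have "nrm x > 0" using form_mem_H[OF _ x] nrm_pos[OF x] by metis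
  then obtain M :: real and c0 where c0: "M > 0" "c0 \<in> N" "d \<one> c0 > 0" "nrm c0 = M * d \<one> c0"
    and slope: "\<And>n g. n \<in> N \<Longrightarrow> g \<in> carrier G \<Longrightarrow> nrm n \<le> M * d g (n \<otimes> g)"
    using max_slope[OF x] by metis
  have "\<exists>\<eta>\<in>H. \<eta> c0 \<noteq> 0"
  proof (rule ccontr)
    assume "\<not> ?thesis"
    then have "(\<Sum>\<eta>\<in>H. (\<eta> c0)\<^sup>2) = 0" by (intro sum.neutral) auto
    then show False using c0 by (simp add: nrm_def L2_set_def)
  qed
  then obtain b y1 where y1: "b \<in> carrier G" "y1 \<in> gens" "form (b \<otimes> c0 \<otimes> inv b) y1 \<noteq> 0"
    using c0(2) by (auto simp: H_def conj_form_def)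
  \<comment> \<open>Taking \<open>b\<close> instead of \<open>\<one>\<close> as the base point compensates for the conjugation by \<open>b\<close>.\<close>
  define c where "c = b \<otimes> c0 \<otimes> inv b"
  have c: "c \<in> N" unfolding c_def by (rule inv_op_closed2[OF y1(1) c0(2)])
  have c0c: "c0 \<in> carrier G" and cc: "c \<in> carrier G" using c0(2) c N_closed by blast+
  have db: "d b (c \<otimes> b) = d \<one> c0"
    using d_translate[OF y1(1) one_carrier c0c] y1(1) c0c by (simp add: c_def m_assoc)
  have nrmc: "nrm c = nrm c0" using norm_conj[OF c0(2) y1(1)] by (simp add: nrm_def c_def)
  interpret maximal_slope G S N H M b c
    by unfold_locales (use c0 y1(1) c db nrmc slope curvature in auto)
  let ?D = "lower_central NG 1"
  have par: "\<exists>r. \<forall>m\<in>N. form n m = r * form c m" if "n \<in> L" for n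
  proof -
    obtain r where n: "n \<in> N" and r: "\<And>\<eta>. \<eta> \<in> H \<Longrightarrow> \<eta> n = r * \<eta> c" using \<open>n \<in> L\<close> unfolding L_def by blast
    have "form n m = r * form c m" if "m \<in> N" for m
    proof (rule additive_eq_of_generators[OF additive_form_right[OF n] _ _ that])
      show "additive_on G N (\<lambda>m. r * form c m)"
        using form_right c by (simp add: additive_on_def algebra_simps)
      show "form n y = r * form c y" if "y \<in> gens" for y
        using form_mem_H[OF that n] r n c by fastforce
    qed
    then show ?thesis by blast
  qed
  have isotropic: "form n m = 0" if n: "n \<in> L" and m: "m \<in> L" for n m
  proof -
    have N: "n \<in> N" "m \<in> N" using n m by (auto simp: L_def)
    obtain r r' where r: "form n m = r * form c m" "form m c = r' * form c c" using par n m N c by metis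
    have "form c c = 0" using form_swap[OF c c] by simp
    then show ?thesis using r form_swap[OF c N(2)] by simp
  qed
  have DL: "?D \<subseteq> L"
  proof
    fix z assume z: "z \<in> ?D"
    have "\<eta> z = 0 * \<eta> c" if \<eta>: "\<eta> \<in> H" for \<eta>
    proof -
      have "\<eta> (commutator G x y) = 0" if "x \<in> N" "y \<in> N" for x y
        using additive_on_commutator[OF additive_H[OF \<eta>] subgroup_axioms that] .
      then show ?thesis
        using NG.additive_on_derived_eq_zero[OF NG.subgroup_self _ _ _ z, of \<eta>] additive_H[OF \<eta>]
          NG.lower_central_closed[of _ 1] commutator_N by (simp add: subset_iff)
    qed
    moreover have "z \<in> N" using NG.lower_central_closed[OF z] by simp
    ultimately show "z \<in> L" unfolding L_def by blast
  qed
  have LN: "L \<subseteq> N" by (auto simp: L_def)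
  interpret LG: group "G\<lparr>carrier := L\<rparr>" using L_subgroup by (rule subgroup_imp_group)
  have D: "subgroup ?D G"
    using incl_subgroup[OF subgroup_axioms NG.lower_central_subgroup] .
  obtain \<Psi> where \<Psi>: "additive_on (G\<lparr>carrier := L\<rparr>) (carrier (G\<lparr>carrier := L\<rparr>)) \<Psi>"
    "\<And>z. z \<in> ?D \<Longrightarrow> \<Psi> z = f z"
  proof (rule LG.additive_on_extend)
    show "subgroup ?D (G\<lparr>carrier := L\<rparr>)" by (rule subgroup_incl[OF D L_subgroup DL])
    show "additive_on (G\<lparr>carrier := L\<rparr>) ?D f" using f_additive by simp
    fix u v assume "u \<in> carrier (G\<lparr>carrier := L\<rparr>)" "v \<in> carrier (G\<lparr>carrier := L\<rparr>)"
    then have uv: "u \<in> L" "v \<in> L" by simp_all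
    then show "commutator (G\<lparr>carrier := L\<rparr>) u v \<in> ?D \<and> f (commutator (G\<lparr>carrier := L\<rparr>) u v) = 0"
      using isotropic[OF uv] commutator_in_derived LN commutator_restrict[OF L_subgroup uv]
      by (auto simp: form_def)
  qed (rule that)
  have \<Psi>L: "additive_on G L \<Psi>" using \<Psi>(1) by simp
  have y1N: "y1 \<in> N" using y1(2) gens(2) by blast
  obtain w where w: "w \<in> N" "form c w > 0"
  proof (cases "form c y1 > 0")
    case True then show ?thesis using that y1N by blast
  next
    case False
    then have "form c (inv y1) > 0"
      using y1(3) additive_on_inv[OF additive_form_right[OF c] subgroup_axioms y1N] by (simp add: c_def)
    then show ?thesis using that y1N by blast
  qed
  show False
  proof (rule no_shear[OF \<Psi>L w(1) w(2)])
    fix i j :: nat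
    have N: "inv (c [^] j) \<in> N" "c [^] j \<in> N" "inv (w [^] i) \<in> N" "w [^] i \<in> N"
      using pow_mem[OF is_group c] pow_mem[OF is_group w(1)] by auto
    have "form (inv (c [^] j)) (inv (w [^] i)) = form (c [^] j) (w [^] i)"
      using additive_on_inv[OF additive_form_left[OF N(3)] subgroup_axioms N(2)]
        additive_on_inv[OF additive_form_right[OF N(2)] subgroup_axioms N(4)] by simp
    also have "\<dots> = real j * form c (w [^] i)"
      using additive_on_pow(2)[OF additive_form_left[OF N(4)] subgroup_axioms c] .
    also have "\<dots> = real i * real j * form c w"
      using additive_on_pow(2)[OF additive_form_right[OF c] subgroup_axioms w(1)] by simp
    finally have "form (inv (c [^] j)) (inv (w [^] i)) = real i * real j * form c w" .
    moreover have "commutator G (inv (c [^] j)) (inv (w [^] i)) \<in> ?D"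
      using commutator_in_derived N by blast
    ultimately show "commutator G (inv (c [^] j)) (inv (w [^] i)) \<in> L \<and>
      \<Psi> (commutator G (inv (c [^] j)) (inv (w [^] i))) = real i * real j * form c w"
      using DL \<Psi>(2) by (auto simp: form_def)
  qed
qed

end

lemma (in cayley_graph) virtually_abelian_of_nonneg_curvature:
  assumes nil: "virtually_nilpotent G" and curvature: "nonneg_ollivier_ricci G S"
  shows "virtually_abelian G"
proof -
  obtain N where N: "N \<lhd> G" "finite (rcosets N)" "nilpotent_group (G\<lparr>carrier := N\<rparr>)"
    using nil unfolding virtually_nilpotent_def by blast
  interpret N: normal N G by (rule N(1))
  interpret cayley_graph_subgroup G S N by unfold_locales (rule N(2))
  interpret NG: group "G\<lparr>carrier := N\<rparr>" using N.subgroup_axioms by (rule subgroup_imp_group)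
  obtain k where k: "lower_central (G\<lparr>carrier := N\<rparr>) k = {\<one>}"
    using N(3) unfolding nilpotent_group_def by auto
  obtain Y where Y: "finite Y" "Y \<subseteq> N" "generate G Y = N"
    using schreier[OF finite_S _ generate_S[symmetric] N.subgroup_axioms N.subset]
      S_closed N(2) finite_index_in_iff_finite_rcosets[OF N.subgroup_axioms] by blast
  have gen: "generate (G\<lparr>carrier := N\<rparr>) Y = N"
    using generate_consistent[OF Y(2) N.subgroup_axioms] Y(3) by simp
  show ?thesis
  proof (rule NG.nilpotent_center_or_form[of Y k])
    show "finite Y" "Y \<subseteq> carrier (G\<lparr>carrier := N\<rparr>)"
      "generate (G\<lparr>carrier := N\<rparr>) Y = carrier (G\<lparr>carrier := N\<rparr>)"
      "lower_central (G\<lparr>carrier := N\<rparr>) k = {\<one>\<^bsub>G\<lparr>carrier := N\<rparr>\<^esub>}"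
      using Y gen k by simp_all
    assume "finite_index_in (G\<lparr>carrier := N\<rparr>) (central_mod (G\<lparr>carrier := N\<rparr>) {\<one>\<^bsub>G\<lparr>carrier := N\<rparr>\<^esub>})
      (carrier (G\<lparr>carrier := N\<rparr>))"
    then show ?thesis using virtually_abelian_of_central_mod[OF N(1,2)]
      by (simp add: finite_index_in_def)
  next
    fix f x y
    assume f: "additive_on (G\<lparr>carrier := N\<rparr>) (lower_central (G\<lparr>carrier := N\<rparr>) 1) f"
      "\<And>z. z \<in> lower_central (G\<lparr>carrier := N\<rparr>) 2 \<Longrightarrow> f z = 0"
      and xy: "x \<in> carrier (G\<lparr>carrier := N\<rparr>)" "y \<in> carrier (G\<lparr>carrier := N\<rparr>)"
      "f (commutator (G\<lparr>carrier := N\<rparr>) x y) \<noteq> 0"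
    interpret commutator_form G S N f Y
      by unfold_locales (use f Y in auto)
    have "form x y = 0" using form_zero_of_nonneg_curvature[OF curvature] xy by simp
    then show ?thesis using xy commutator_N by (simp add: form_def)
  qed
qed

section \<open>Generating sets of non-negative curvature\<close>

text \<open>A coupling of the lazy walks at \<open>g\<close> and \<open>g \<otimes> s\<close> at distance at most one: a bijection of
  \<open>insert \<one> S\<close> moves the mass of one lazy step, and the remaining mass moves from \<open>g\<close> to \<open>g \<otimes> s\<close>.\<close>

lemma (in cayley_graph) nonneg_curvature_of_bijections:
  assumes bij: "\<And>s. s \<in> S \<Longrightarrow> \<exists>\<tau>. bij_betw \<tau> (insert \<one> S) (insert \<one> S) \<and>
      (\<forall>x\<in>insert \<one> S. inv x \<otimes> s \<otimes> \<tau> x \<in> insert \<one> S)"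
  shows "nonneg_ollivier_ricci G S"
  unfolding nonneg_curvature_iff
proof clarify
  fix g h assume e: "(g, h) \<in> edges"
  obtain s where s: "s \<in> S" "h = g \<otimes> s" using e edge_iff by blast
  have S: "S \<noteq> {}" and g: "g \<in> carrier G" and h: "h \<in> carrier G" using edgeD[OF e] by simp_all
  have sc: "s \<in> carrier G" using S_closed[OF s(1)] .
  obtain \<tau> where \<tau>: "bij_betw \<tau> (insert \<one> S) (insert \<one> S)"
    "\<And>x. x \<in> insert \<one> S \<Longrightarrow> inv x \<otimes> s \<otimes> \<tau> x \<in> insert \<one> S" using bij[OF s(1)] by blast
  define \<tau>' where "\<tau>' = (map_sum \<tau> id :: 'a + nat \<Rightarrow> 'a + nat)"
  have \<tau>'_image: "\<tau>' ` step_index = step_index"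
  proof -
    have "\<tau>' ` step_index = Inl ` (\<tau> ` insert \<one> S) \<union> Inr ` {..<card S - 1}"
      unfolding step_index_def image_Un image_image \<tau>'_def by simp
    then show ?thesis unfolding bij_betw_imp_surj_on[OF \<tau>(1)] step_index_def .
  qed
  have \<tau>'_bij: "bij_betw \<tau>' step_index step_index"
    using eq_card_imp_inj_on[OF step_index(1), of \<tau>'] \<tau>'_image by (simp add: bij_betw_def)
  let ?U = "pmf_of_set step_index"
  define \<pi> where "\<pi> = map_pmf (\<lambda>i. (g \<otimes> step_of i, h \<otimes> step_of (\<tau>' i))) ?U"
  have "map_pmf snd \<pi> = map_pmf (\<lambda>i. h \<otimes> step_of i) (map_pmf \<tau>' ?U)"
    by (simp add: \<pi>_def map_pmf_comp)
  also have "\<dots> = walk h"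
    using map_pmf_of_set_bij_betw[OF \<tau>'_bij] step_index walk_eq_uniform[OF S h] by simp
  finally have "map_pmf snd \<pi> = walk h" .
  moreover have "map_pmf fst \<pi> = walk g" by (simp add: \<pi>_def map_pmf_comp walk_eq_uniform[OF S g])
  ultimately have \<pi>: "\<pi> \<in> couplings (walk g) (walk h)" by (simp add: couplings_def)
  have dist: "d (g \<otimes> step_of i) (h \<otimes> step_of (\<tau>' i)) \<le> 1" if i: "i \<in> step_index" for i
  proof -
    have step: "d (g \<otimes> x) (h \<otimes> y) \<le> 1"
      if x: "x \<in> carrier G" and y: "y \<in> carrier G" and xy: "inv x \<otimes> s \<otimes> y \<in> insert \<one> S" for x y
    proof -
      have "g \<otimes> x \<otimes> (inv x \<otimes> s \<otimes> y) = h \<otimes> y" using x y g sc s(2) by (simp add: m_assoc)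
      then show ?thesis using d_step_le[OF _ xy, of "g \<otimes> x"] x g by simp
    qed
    show ?thesis
    proof (cases i)
      case (Inl x)
      then have x: "x \<in> insert \<one> S" using i by (auto simp: step_index_def)
      have "\<tau> x \<in> insert \<one> S" using bij_betwE[OF \<tau>(1)] x by blast
      then have "x \<in> carrier G" "\<tau> x \<in> carrier G" using x S_closed by auto
      then show ?thesis using step[OF _ _ \<tau>(2)[OF x]] Inl by (simp add: \<tau>'_def step_of_def)
    next
      case (Inr k)
      then show ?thesis using step[of \<one> \<one>] s(1) sc by (simp add: \<tau>'_def step_of_def)
    qed
  qed
  have "W1 G S (walk g) (walk h) \<le> measure_pmf.expectation \<pi> (\<lambda>(x, y). real (d x y))"
    by (rule W1_le[OF \<pi>])
  also have "\<dots> = measure_pmf.expectation ?U (\<lambda>i. real (d (g \<otimes> step_of i) (h \<otimes> step_of (\<tau>' i))))"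
    by (simp add: \<pi>_def)
  also have "\<dots> \<le> 1"
  proof (rule measure_pmf.integral_le_const)
    show "integrable ?U (\<lambda>i. real (d (g \<otimes> step_of i) (h \<otimes> step_of (\<tau>' i))))"
      using step_index by (intro integrable_measure_pmf_finite) simp
    show "AE i in ?U. real (d (g \<otimes> step_of i) (h \<otimes> step_of (\<tau>' i))) \<le> 1"
      using step_index dist by (simp add: AE_measure_pmf_iff)
  qed
  finally show "W1 G S (walk g) (walk h) \<le> 1" .
qed

lemma (in normal) mem_iff_inv_mult:
  assumes "x \<in> carrier G" "y \<in> carrier G" "x \<in> H"
  shows "x \<otimes> y \<in> H \<longleftrightarrow> y \<in> H" "y \<otimes> x \<in> H \<longleftrightarrow> y \<in> H"
proof -
  have "y \<in> H" if "x \<otimes> y \<in> H" using subgroup.m_closed[OF subgroup_axioms m_inv_closed[OF assms(3)] that] assms by simp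
  then show "x \<otimes> y \<in> H \<longleftrightarrow> y \<in> H"
    using subgroup.m_closed[OF subgroup_axioms assms(3)] by blast
  have "y \<in> H" if "y \<otimes> x \<in> H" using subgroup.m_closed[OF subgroup_axioms that m_inv_closed[OF assms(3)]] assms
    by (simp add: m_assoc)
  then show "y \<otimes> x \<in> H \<longleftrightarrow> y \<in> H"
    using subgroup.m_closed[OF subgroup_axioms _ assms(3)] by blast
qed

lemma (in normal) mult_mem_commute:
  assumes "x \<in> carrier G" "y \<in> carrier G" shows "x \<otimes> y \<in> H \<longleftrightarrow> y \<otimes> x \<in> H"
proof -
  have "y \<otimes> x \<in> H" if "x \<in> carrier G" "y \<in> carrier G" "x \<otimes> y \<in> H" for x y
    using inv_op_closed1[OF that(1,3)] that by (simp add: m_assoc)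
  then show ?thesis using assms by blast
qed

lemma (in normal) left_coset_eq_image:
  assumes g: "g \<in> carrier G" shows "{x \<in> carrier G. inv g \<otimes> x \<in> H} = (\<lambda>h. g \<otimes> h) ` H"
proof
  show "{x \<in> carrier G. inv g \<otimes> x \<in> H} \<subseteq> (\<lambda>h. g \<otimes> h) ` H"
  proof
    fix x assume "x \<in> {x \<in> carrier G. inv g \<otimes> x \<in> H}"
    then show "x \<in> (\<lambda>h. g \<otimes> h) ` H" using g by (intro image_eqI[of _ _ "inv g \<otimes> x"]) auto
  qed
  show "(\<lambda>h. g \<otimes> h) ` H \<subseteq> {x \<in> carrier G. inv g \<otimes> x \<in> H}" using g subset by auto
qed

text \<open>A coset that is its own inverse contains an element \<open>t\<close> different from its inverse, or all its
  elements are involutions. Either way it contains two elements that are permuted by inversion; in the other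
  cosets two elements are chosen in one of the two mutually inverse cosets.\<close>

lemma (in normal) symmetric_transversal_of_infinite:
  assumes fin: "finite (rcosets H)" and inf: "infinite H"
  obtains T where "finite T" "T \<subseteq> carrier G - H" "\<And>t. t \<in> T \<Longrightarrow> inv t \<in> T"
    "\<And>g. g \<in> carrier G - H \<Longrightarrow> card {t \<in> T. inv g \<otimes> t \<in> H} = 2"
proof -
  define cl where "cl g = {x \<in> carrier G. inv g \<otimes> x \<in> H}" for g
  define J where "J C = (\<lambda>x. inv x) ` C" for C :: "'a set"
  have cl_image: "cl g = (\<lambda>h. g \<otimes> h) ` H" if g: "g \<in> carrier G" for g
    using left_coset_eq_image[OF g] by (simp add: cl_def)
  have cl_inf: "infinite (cl g)" if g: "g \<in> carrier G" for g
  proof -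
    have "inj_on (\<lambda>h. g \<otimes> h) H" using g subset by (auto simp: inj_on_def)
    then show ?thesis using inf finite_imageD cl_image[OF g] by auto
  qed
  have cl_self: "g \<in> cl g" if "g \<in> carrier G" for g using that by (simp add: cl_def)
  have cl_eq: "cl x = cl g" if x: "x \<in> cl g" and g: "g \<in> carrier G" for x g
  proof -
    have xc: "x \<in> carrier G" "inv g \<otimes> x \<in> H" using x by (auto simp: cl_def)
    have "inv x \<otimes> y \<in> H \<longleftrightarrow> inv g \<otimes> y \<in> H" if y: "y \<in> carrier G" for y
    proof -
      have "inv g \<otimes> y = (inv g \<otimes> x) \<otimes> (inv x \<otimes> y)" using g xc y by (simp add: m_assoc)
      then show ?thesis using mem_iff_inv_mult(1)[of "inv g \<otimes> x" "inv x \<otimes> y"] g xc y by simp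
    qed
    then show ?thesis by (auto simp: cl_def)
  qed
  have J_cl: "J (cl g) = cl (inv g)" if g: "g \<in> carrier G" for g
  proof -
    have sub: "J (cl g) \<subseteq> cl (inv g)" if g: "g \<in> carrier G" for g
    proof
      fix y assume "y \<in> J (cl g)"
      then obtain x where x: "x \<in> carrier G" "inv g \<otimes> x \<in> H" "y = inv x" by (auto simp: J_def cl_def)
      have "x \<otimes> inv g \<in> H" using mult_mem_commute[of "inv g" x] x g by simp
      then have "inv (x \<otimes> inv g) \<in> H" by simp
      then show "y \<in> cl (inv g)" using x g by (simp add: cl_def inv_mult_group)
    qed
    have "cl (inv g) \<subseteq> J (cl g)"
    proof
      fix y assume y: "y \<in> cl (inv g)"
      then have "inv y \<in> cl (inv (inv g))" using sub[of "inv g"] g by (auto simp: J_def)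
      then show "y \<in> J (cl g)" using g y by (auto simp: J_def cl_def intro!: image_eqI[of _ _ "inv y"])
    qed
    then show ?thesis using sub[OF g] by blast
  qed
  define Q where "Q = cl ` (carrier G - H)"
  have "Q \<subseteq> rcosets H"
  proof -
    have "cl g = H #> g" if "g \<in> carrier G" for g
      using cl_image[OF that] coset_eq that by (auto simp: l_coset_def)
    then show ?thesis using subset by (auto simp: Q_def RCOSETS_def)
  qed
  then have finQ: "finite Q" using fin finite_subset by blast
  have Qc: "C \<subseteq> carrier G" if "C \<in> Q" for C using that by (auto simp: Q_def cl_def)
  have Q_H: "C \<inter> H = {}" if C: "C \<in> Q" for C
  proof -
    obtain g where g: "g \<in> carrier G" "g \<notin> H" "C = cl g" using C by (auto simp: Q_def)
    have False if x: "x \<in> cl g" "x \<in> H" for x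
    proof -
      have "inv g \<in> H" using mem_iff_inv_mult(2)[of x "inv g"] x g(1) subset by (auto simp: cl_def)
      then show False using m_inv_closed[of "inv g"] g by simp
    qed
    then show ?thesis using g(3) by blast
  qed
  have Q_eq: "C = cl x" if C: "C \<in> Q" and x: "x \<in> C" for C x
    using cl_eq C x by (auto simp: Q_def)
  have QJ: "J C \<in> Q" if C: "C \<in> Q" for C
  proof -
    obtain g where g: "g \<in> carrier G" "g \<notin> H" "C = cl g" using C by (auto simp: Q_def)
    have "inv g \<notin> H" using m_inv_closed[of "inv g"] g by auto
    then show ?thesis using g J_cl[OF g(1)] by (auto simp: Q_def)
  qed
  have JJ: "J (J C) = C" if "C \<subseteq> carrier G" for C
    using that unfolding J_def image_image by (force simp: subset_iff image_iff)
  have card_J: "card (J C) = card C" if "C \<subseteq> carrier G" for C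
    unfolding J_def using that by (intro card_image inj_onI) (metis inv_inv subsetD)
  have two: "\<exists>P. P \<subseteq> C \<and> card P = 2" if "C \<in> Q" for C
    using infinite_arbitrarily_large[of C 2] cl_inf that by (auto simp: Q_def)
  have "\<exists>P. P \<subseteq> C \<and> card P = 2 \<and> (J C = C \<longrightarrow> J P = P)" if C: "C \<in> Q" for C
  proof (cases "\<exists>t\<in>C. J C = C \<and> inv t \<noteq> t")
    case True
    then obtain t where t: "t \<in> C" "J C = C" "inv t \<noteq> t" by blast
    have "{t, inv t} \<subseteq> C" "J {t, inv t} = {t, inv t}" using t Qc[OF C] by (auto simp: J_def)
    then show ?thesis using t by (intro exI[of _ "{t, inv t}"]) auto
  next
    case False
    obtain P where P: "P \<subseteq> C" "card P = 2" using two[OF C] by blast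
    have "J P = P" if "J C = C" using False that P(1) unfolding J_def by force
    then show ?thesis using P by blast
  qed
  then obtain P0 where P0: "\<And>C. C \<in> Q \<Longrightarrow> P0 C \<subseteq> C \<and> card (P0 C) = 2 \<and> (J C = C \<longrightarrow> J (P0 C) = P0 C)"
    by metis
  define sel where "sel C = (SOME D. D \<in> {C, J C})" for C
  have sel: "sel C = C \<or> sel C = J C" for C
    unfolding sel_def using someI_ex[of "\<lambda>D. D \<in> {C, J C}"] by blast
  have selJ: "sel (J C) = sel C" if "C \<in> Q" for C
    using JJ[OF Qc[OF that]] by (simp add: sel_def insert_commute)
  define P where "P C = (if sel C = C then P0 C else J (P0 (J C)))" for C
  have P_sub: "P C \<subseteq> C" if C: "C \<in> Q" for C
  proof -
    have "J (P0 (J C)) \<subseteq> J (J C)" using P0[OF QJ[OF C]] unfolding J_def by blast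
    then show ?thesis using P0[OF C] JJ[OF Qc[OF C]] by (simp add: P_def)
  qed
  have P_card: "card (P C) = 2" if C: "C \<in> Q" for C
    using P0[OF C] P0[OF QJ[OF C]] card_J[of "P0 (J C)"] Qc[OF QJ[OF C]] by (auto simp: P_def)
  have JP: "J (P C) = P (J C)" if C: "C \<in> Q" for C
  proof (cases "J C = C")
    case True
    then have "P C = P0 C" using sel[of C] by (simp add: P_def)
    then show ?thesis using P0[OF C] True by simp
  next
    case False
    show ?thesis
    proof (cases "sel C = C")
      case True
      then show ?thesis using False selJ[OF C] JJ[OF Qc[OF C]] by (simp add: P_def)
    next
      case F: False
      then have "sel C = J C" using sel by blast
      moreover have "P0 (J C) \<subseteq> carrier G" using P0[OF QJ[OF C]] Qc[OF QJ[OF C]] by blast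
      ultimately show ?thesis using F selJ[OF C] JJ by (simp add: P_def)
    qed
  qed
  define T where "T = (\<Union>C\<in>Q. P C)"
  show thesis
  proof
    have "finite (P C)" if "C \<in> Q" for C using P_card[OF that] by (metis card.infinite zero_neq_numeral)
    then show "finite T" unfolding T_def using finQ by blast
    show "T \<subseteq> carrier G - H" unfolding T_def using P_sub Qc Q_H by blast
    show "inv t \<in> T" if t: "t \<in> T" for t
    proof -
      obtain C where C: "C \<in> Q" "t \<in> P C" using t by (auto simp: T_def)
      then have "inv t \<in> J (P C)" by (simp add: J_def)
      then show ?thesis using JP[OF C(1)] QJ[OF C(1)] unfolding T_def by blast
    qed
    fix g assume g: "g \<in> carrier G - H"
    then have C: "cl g \<in> Q" by (simp add: Q_def)
    have "{t \<in> T. inv g \<otimes> t \<in> H} = P (cl g)"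
    proof
      show "P (cl g) \<subseteq> {t \<in> T. inv g \<otimes> t \<in> H}" using P_sub[OF C] C unfolding T_def cl_def by blast
      show "{t \<in> T. inv g \<otimes> t \<in> H} \<subseteq> P (cl g)"
      proof
        fix t assume t: "t \<in> {t \<in> T. inv g \<otimes> t \<in> H}"
        then obtain D where D: "D \<in> Q" "t \<in> P D" by (auto simp: T_def)
        have tD: "t \<in> D" using P_sub D by blast
        then have "t \<in> cl g" using t Qc[OF D(1)] by (auto simp: cl_def)
        then have "D = cl g" using Q_eq[OF D(1) tD] Q_eq[OF C] by simp
        then show "t \<in> P (cl g)" using D(2) by simp
      qed
    qed
    then show "card {t \<in> T. inv g \<otimes> t \<in> H} = 2" using P_card[OF C] by simp
  qed
qed

lemma (in normal) symmetric_transversal: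
  assumes fin: "finite (rcosets H)"
  obtains T k where "finite T" "T \<subseteq> carrier G - H" "\<And>t. t \<in> T \<Longrightarrow> inv t \<in> T" "(k::nat) > 0"
    "\<And>g. g \<in> carrier G - H \<Longrightarrow> card {t \<in> T. inv g \<otimes> t \<in> H} = k"
proof (cases "finite H")
  case False
  show thesis
    by (rule symmetric_transversal_of_infinite[OF fin False], rule that[of _ 2]) simp_all
next
  case True
  obtain R where R: "finite R" "R \<subseteq> carrier G" "\<forall>k\<in>carrier G. \<exists>r\<in>R. \<exists>b\<in>H. k = b \<otimes> r"
    by (rule coset_representatives[OF is_group fin])
  have "carrier G \<subseteq> (\<lambda>(b, r). b \<otimes> r) ` (H \<times> R)" using R(3) by force
  then have fin_carrier: "finite (carrier G)" using True R(1) by (meson finite_SigmaI finite_surj)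
  show thesis
  proof
    show "finite (carrier G - H)" using fin_carrier by simp
    show "carrier G - H \<subseteq> carrier G - H" ..
    show "inv t \<in> carrier G - H" if "t \<in> carrier G - H" for t
      using that m_inv_closed[of "inv t"] by auto
    have "H \<noteq> {}" using subgroup.one_closed[OF subgroup_axioms] by blast
    then show "0 < card H" using True by (simp add: card_gt_0_iff)
    fix g assume g: "g \<in> carrier G - H"
    have "t \<notin> H" if "t \<in> carrier G" "inv g \<otimes> t \<in> H" for t
      using that g mem_iff_inv_mult(2)[of t "inv g"] m_inv_closed[of "inv g"] by auto
    then have "{t \<in> carrier G - H. inv g \<otimes> t \<in> H} = (\<lambda>h. g \<otimes> h) ` H"
      using left_coset_eq_image[of g] g by blast
    moreover have "inj_on (\<lambda>h. g \<otimes> h) H" using g subset by (auto simp: inj_on_def)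
    ultimately show "card {t \<in> carrier G - H. inv g \<otimes> t \<in> H} = card H" by (simp add: card_image)
  qed
qed

text \<open>Conjugacy classes of elements of an abelian normal subgroup of finite index are finite.\<close>

lemma (in normal) finite_conj_closure:
  assumes fin: "finite (rcosets H)" and ab: "\<And>x y. x \<in> H \<Longrightarrow> y \<in> H \<Longrightarrow> x \<otimes> y = y \<otimes> x"
    and F: "finite F" "F \<subseteq> H"
  obtains B where "finite B" "F \<subseteq> B" "B \<subseteq> H" "\<And>x. x \<in> B \<Longrightarrow> inv x \<in> B"
    "\<And>g x. g \<in> carrier G \<Longrightarrow> x \<in> B \<Longrightarrow> inv g \<otimes> x \<otimes> g \<in> B"
proof
  define F' where "F' = F \<union> (\<lambda>x. inv x) ` F"
  define B where "B = {g \<otimes> x \<otimes> inv g | g x. g \<in> carrier G \<and> x \<in> F'}"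
  have F': "finite F'" "F' \<subseteq> H" using F m_inv_closed by (auto simp: F'_def)
  have F'c: "F' \<subseteq> carrier G" and Fc: "F \<subseteq> carrier G" using F' F subset by blast+
  have F'_inv: "inv x \<in> F'" if "x \<in> F'" for x using that Fc by (auto simp: F'_def)
  obtain R where R: "finite R" "R \<subseteq> carrier G" "\<forall>k\<in>carrier G. \<exists>r\<in>R. \<exists>b\<in>H. k = b \<otimes> r"
    by (rule coset_representatives[OF is_group fin])
  have "B \<subseteq> (\<lambda>(r, x). r \<otimes> x \<otimes> inv r) ` (R \<times> F')"
  proof
    fix z assume "z \<in> B"
    then obtain g x where g: "g \<in> carrier G" "x \<in> F'" "z = g \<otimes> x \<otimes> inv g" by (auto simp: B_def)
    obtain r b where r: "r \<in> R" "b \<in> H" "g = b \<otimes> r" using R(3) g(1) by blast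
    have c: "r \<in> carrier G" "b \<in> carrier G" "x \<in> carrier G" using r R(2) subset g(2) F'c by blast+
    let ?w = "r \<otimes> x \<otimes> inv r"
    have w: "?w \<in> H" using inv_op_closed2[OF c(1), of x] g(2) F' by blast
    have "z = b \<otimes> ?w \<otimes> inv b" using g(3) r(3) c by (simp add: group_word_simps)
    also have "\<dots> = ?w" using ab[OF r(2) w] c by (simp add: m_assoc)
    finally show "z \<in> (\<lambda>(r, x). r \<otimes> x \<otimes> inv r) ` (R \<times> F')"
      using r(1) g(2) by (intro image_eqI[of _ _ "(r, x)"]) auto
  qed
  then show "finite B" using R(1) F'(1) by (meson finite_SigmaI finite_surj)
  show "F \<subseteq> B"
  proof
    fix x assume "x \<in> F"
    then have "x \<in> F'" "x = \<one> \<otimes> x \<otimes> inv \<one>" using Fc by (auto simp: F'_def)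
    then show "x \<in> B" unfolding B_def using is_group group.is_monoid monoid.one_closed by blast
  qed
  show "B \<subseteq> H" using inv_op_closed2 F'(2) by (auto simp: B_def)
  show "inv z \<in> B" if z: "z \<in> B" for z
  proof -
    obtain g x where g: "g \<in> carrier G" "x \<in> F'" "z = g \<otimes> x \<otimes> inv g" using z by (auto simp: B_def)
    have "inv z = g \<otimes> inv x \<otimes> inv g" using g F'c by (auto simp: group_word_simps)
    then show ?thesis using g(1) F'_inv[OF g(2)] unfolding B_def by blast
  qed
  show "inv h \<otimes> z \<otimes> h \<in> B" if h: "h \<in> carrier G" and z: "z \<in> B" for h z
  proof -
    obtain g x where g: "g \<in> carrier G" "x \<in> F'" "z = g \<otimes> x \<otimes> inv g" using z by (auto simp: B_def)
    have "x \<in> carrier G" using g(2) F'c by blast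
    then have "inv h \<otimes> z \<otimes> h = (inv h \<otimes> g) \<otimes> x \<otimes> inv (inv h \<otimes> g)"
      using g h by (simp add: group_word_simps)
    moreover have "inv h \<otimes> g \<in> carrier G" using g h by simp
    ultimately show ?thesis using g(2) unfolding B_def by blast
  qed
qed

text \<open>The generating set: a small transversal \<open>T\<close> together with a set \<open>B\<close> in the abelian subgroup that is
  invariant under conjugation and large compared with \<open>T\<close>.\<close>

locale transversal_and_box = normal A G for A and G (structure) +
  fixes T B k
  assumes finite_T: "finite T" and T_sub: "T \<subseteq> carrier G - A" and inv_T: "t \<in> T \<Longrightarrow> inv t \<in> T"
    and card_T: "g \<in> carrier G - A \<Longrightarrow> card {t \<in> T. inv g \<otimes> t \<in> A} = k" and k_pos: "(k::nat) > 0"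
    and finite_B: "finite B" and B_sub: "B \<subseteq> A" and inv_B: "x \<in> B \<Longrightarrow> inv x \<in> B"
    and conj_B: "g \<in> carrier G \<Longrightarrow> x \<in> B \<Longrightarrow> inv g \<otimes> x \<otimes> g \<in> B"
    and products_in_B: "x \<in> insert \<one> T \<Longrightarrow> y \<in> insert \<one> T \<Longrightarrow> z \<in> insert \<one> T \<Longrightarrow> w \<in> insert \<one> T \<Longrightarrow>
      x \<otimes> y \<otimes> z \<otimes> w \<in> A \<Longrightarrow> x \<otimes> y \<otimes> z \<otimes> w \<in> B"
begin

lemma T_closed: "t \<in> T \<Longrightarrow> t \<in> carrier G" using T_sub by blast

lemma T_notin: "t \<in> T \<Longrightarrow> t \<notin> A" using T_sub by blast

lemma B_closed: "x \<in> B \<Longrightarrow> x \<in> carrier G" using B_sub subset by blast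

lemma one_in_B: "\<one> \<in> B"
  using products_in_B[of \<one> \<one> \<one> \<one>] by simp

definition near :: "'a \<Rightarrow> 'a set" where "near g = {t \<in> T. inv g \<otimes> t \<in> A}"

lemma near_eq:
  assumes "g \<in> carrier G" "h \<in> carrier G" "inv g \<otimes> h \<in> A" shows "near g = near h"
proof -
  have "inv g \<otimes> t \<in> A \<longleftrightarrow> inv h \<otimes> t \<in> A" if "t \<in> carrier G" for t
  proof -
    have "inv g \<otimes> t = (inv g \<otimes> h) \<otimes> (inv h \<otimes> t)" using assms that by (simp add: m_assoc)
    then show ?thesis using mem_iff_inv_mult(1)[of "inv g \<otimes> h" "inv h \<otimes> t"] assms that by simp
  qed
  then show ?thesis using T_closed by (auto simp: near_def)
qed

text \<open>All cosets other than \<open>A\<close> contain equally many elements of \<open>T\<close>, so the elements of \<open>T\<close> can be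
  matched along the map of cosets that is induced by \<open>s\<close>.\<close>

lemma matching:
  assumes s: "s \<in> carrier G"
  obtains \<sigma> where "inj_on \<sigma> {x \<in> T. inv s \<otimes> x \<notin> A}"
    "\<And>x. x \<in> T \<Longrightarrow> inv s \<otimes> x \<notin> A \<Longrightarrow> \<sigma> x \<in> T \<and> inv x \<otimes> s \<otimes> \<sigma> x \<in> A"
proof -
  have "\<exists>e. bij_betw e (near g) {..<k}" if "g \<in> carrier G - A" for g
  proof -
    have "finite (near g)" using finite_T by (simp add: near_def)
    moreover have "card (near g) = card {..<k}" using card_T[OF that] by (simp add: near_def)
    ultimately show ?thesis using finite_same_card_bij[of "near g" "{..<k}"] by blast
  qed
  then have "\<forall>C\<in>near ` (carrier G - A). \<exists>e. bij_betw e C {..<k}" by blast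
  then obtain e where e: "\<And>g. g \<in> carrier G - A \<Longrightarrow> bij_betw (e (near g)) (near g) {..<k}"
    unfolding bchoice_iff by blast
  define \<sigma> where "\<sigma> x = inv_into (near (inv s \<otimes> x)) (e (near (inv s \<otimes> x))) (e (near x) x)" for x
  have main: "x \<in> carrier G" "e (near x) x \<in> e (near (inv s \<otimes> x)) ` near (inv s \<otimes> x)"
      "\<sigma> x \<in> near (inv s \<otimes> x)" "x \<in> near x"
    if x: "x \<in> T" "inv s \<otimes> x \<notin> A" for x
  proof -
    show xc: "x \<in> carrier G" using T_closed[OF x(1)] .
    show xn: "x \<in> near x" using x(1) xc by (simp add: near_def)
    have 1: "bij_betw (e (near x)) (near x) {..<k}"
      using e[of x] xc T_notin[OF x(1)] by simp
    have 2: "bij_betw (e (near (inv s \<otimes> x))) (near (inv s \<otimes> x)) {..<k}"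
      using e[of "inv s \<otimes> x"] xc s x(2) by simp
    show im: "e (near x) x \<in> e (near (inv s \<otimes> x)) ` near (inv s \<otimes> x)"
      unfolding bij_betw_imp_surj_on[OF 2] using bij_betwE[OF 1] xn by simp
    show "\<sigma> x \<in> near (inv s \<otimes> x)" unfolding \<sigma>_def using inv_into_into[OF im] .
  qed
  have \<sigma>_props: "\<sigma> x \<in> T \<and> inv x \<otimes> s \<otimes> \<sigma> x \<in> A" if x: "x \<in> T" "inv s \<otimes> x \<notin> A" for x
    using main(3)[OF x] main(1)[OF x] s by (simp add: near_def inv_mult_group)
  have "inj_on \<sigma> {x \<in> T. inv s \<otimes> x \<notin> A}"
  proof (rule inj_onI)
    fix x y assume "x \<in> {x \<in> T. inv s \<otimes> x \<notin> A}" "y \<in> {x \<in> T. inv s \<otimes> x \<notin> A}" and eq: "\<sigma> x = \<sigma> y"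
    then have x: "x \<in> T" "inv s \<otimes> x \<notin> A" and y: "y \<in> T" "inv s \<otimes> y \<notin> A" by auto
    have c: "x \<in> carrier G" "y \<in> carrier G" "\<sigma> x \<in> carrier G" "\<sigma> y \<in> carrier G"
      using T_closed x y \<sigma>_props by blast+
    have "inv x \<otimes> y = (inv x \<otimes> s \<otimes> \<sigma> x) \<otimes> inv (inv y \<otimes> s \<otimes> \<sigma> y)"
      using c s unfolding eq by (simp add: group_word_simps)
    then have xy: "inv x \<otimes> y \<in> A"
      using \<sigma>_props[OF x] \<sigma>_props[OF y] subgroup.m_closed[OF subgroup_axioms] m_inv_closed by metis
    have n1: "near x = near y" using near_eq[OF c(1,2) xy] .
    have n2: "near (inv s \<otimes> x) = near (inv s \<otimes> y)"
      using near_eq[of "inv s \<otimes> x" "inv s \<otimes> y"] xy c s by (simp add: group_word_simps)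
    have "e (near x) x = e (near x) y"
      using eq f_inv_into_f[OF main(2)[OF x]] f_inv_into_f[OF main(2)[OF y]] n1 n2
      unfolding \<sigma>_def by metis
    moreover have "inj_on (e (near x)) (near x)"
      using e[of x] c(1) T_notin[OF x(1)] by (simp add: bij_betw_def)
    ultimately show "x = y" using main(4)[OF x] main(4)[OF y] n1 by (metis inj_onD)
  qed
  then show thesis using \<sigma>_props by (rule that)
qed

text \<open>For \<open>s\<close> in \<open>T\<close> the naive matching \<open>x \<mapsto> inv s \<otimes> x \<otimes> s\<close> of the box \<open>B\<close> is modified on the few points \<open>x\<close>
  with \<open>x \<otimes> s \<in> T\<close>. This makes room for the elements of \<open>T\<close> in the coset of \<open>s\<close>, whose
  mass stays in place, and it reaches the elements of \<open>T\<close> in the coset of \<open>inv s\<close>.\<close>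

lemma transport_bijection:
  assumes s: "s \<in> B \<union> T"
  shows "\<exists>\<tau>. bij_betw \<tau> (B \<union> T) (B \<union> T) \<and> (\<forall>x\<in>B \<union> T. inv x \<otimes> s \<otimes> \<tau> x \<in> B \<union> T)"
proof (cases "s \<in> B")
  case True
  then show ?thesis using conj_B B_closed T_closed by (intro exI[of _ id]) auto
next
  case False
  then have sT: "s \<in> T" using s by blast
  have sc: "s \<in> carrier G" using T_closed[OF sT] .
  obtain \<sigma> where \<sigma>: "inj_on \<sigma> {x \<in> T. inv s \<otimes> x \<notin> A}"
    "\<And>x. x \<in> T \<Longrightarrow> inv s \<otimes> x \<notin> A \<Longrightarrow> \<sigma> x \<in> T \<and> inv x \<otimes> s \<otimes> \<sigma> x \<in> A"
    using matching[OF sc] by blast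
  define \<tau> where "\<tau> x = (if x \<in> A then if x \<otimes> s \<in> T then inv s \<otimes> inv x else inv s \<otimes> x \<otimes> s
     else if inv s \<otimes> x \<in> A then inv s \<otimes> x else \<sigma> x)" for x
  note Am = subgroup.m_closed[OF subgroup_axioms]
  have BA: "x \<in> A" if "x \<in> B" for x using that B_sub by blast
  have c1: "\<tau> x \<in> T \<and> s \<otimes> \<tau> x \<in> A \<and> inv x \<otimes> s \<otimes> \<tau> x \<in> B \<and> \<tau> x = inv s \<otimes> inv x"
    if x: "x \<in> B" "x \<otimes> s \<in> T" for x
  proof -
    have xc: "x \<in> carrier G" "x \<in> A" using B_closed BA x by blast+
    have \<tau>x: "\<tau> x = inv s \<otimes> inv x" using x xc by (simp add: \<tau>_def)
    have 1: "\<tau> x \<in> T" using inv_T[OF x(2)] xc sc by (simp add: \<tau>x inv_mult_group)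
    have 2: "s \<otimes> \<tau> x = inv x" using xc sc by (simp add: \<tau>x)
    \<comment> \<open>The displacement \<open>inv x \<otimes> inv x\<close> is short because \<open>inv x = s \<otimes> inv (x \<otimes> s)\<close> with \<open>x \<otimes> s\<close> in \<open>T\<close>.\<close>
    have "s \<otimes> inv (x \<otimes> s) \<otimes> s \<otimes> inv (x \<otimes> s) = inv x \<otimes> inv x"
      using xc sc by (simp add: group_word_simps)
    then have "inv x \<otimes> inv x \<in> B"
      using products_in_B[of s "inv (x \<otimes> s)" s "inv (x \<otimes> s)"] sT inv_T[OF x(2)] xc(2) Am by simp
    then show ?thesis using 1 2 xc sc \<tau>x by (simp add: m_assoc)
  qed
  have c2: "\<tau> x \<in> B \<and> inv x \<otimes> s \<otimes> \<tau> x = s \<and> \<tau> x = inv s \<otimes> x \<otimes> s" if x: "x \<in> B" "x \<otimes> s \<notin> T" for x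
    using x conj_B[OF sc x(1)] BA B_closed[OF x(1)] sc by (simp add: \<tau>_def m_assoc)
  have c3: "\<tau> x \<in> B \<and> inv x \<otimes> s \<otimes> \<tau> x = \<one> \<and> \<tau> x = inv s \<otimes> x" if x: "x \<in> T" "inv s \<otimes> x \<in> A" for x
  proof -
    have xc: "x \<in> carrier G" using T_closed x by blast
    have "inv s \<otimes> x \<in> B" using products_in_B[of "inv s" x \<one> \<one>] x inv_T[OF sT] xc sc by simp
    then show ?thesis using x T_notin[OF x(1)] xc sc by (simp add: \<tau>_def m_assoc)
  qed
  have c4: "\<tau> x \<in> T \<and> s \<otimes> \<tau> x \<notin> A \<and> inv x \<otimes> s \<otimes> \<tau> x \<in> B \<and> \<tau> x = \<sigma> x"
    if x: "x \<in> T" "inv s \<otimes> x \<notin> A" for x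
  proof -
    have \<tau>x: "\<tau> x = \<sigma> x" using x T_notin[OF x(1)] by (simp add: \<tau>_def)
    have c: "x \<in> carrier G" "\<sigma> x \<in> carrier G" using T_closed x \<sigma>(2)[OF x] by blast+
    have p: "inv x \<otimes> s \<otimes> \<sigma> x \<in> B"
      using products_in_B[of "inv x" s "\<sigma> x" \<one>] \<sigma>(2)[OF x] inv_T[OF x(1)] sT c sc by simp
    have "s \<otimes> \<sigma> x \<notin> A"
    proof
      assume "s \<otimes> \<sigma> x \<in> A"
      then have "inv x \<in> A"
        using mem_iff_inv_mult(2)[of "s \<otimes> \<sigma> x" "inv x"] BA[OF p] c sc by (simp add: m_assoc)
      then show False using T_notin[OF inv_T[OF x(1)]] by blast
    qed
    then show ?thesis using \<tau>x \<sigma>(2)[OF x] p by simp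
  qed
  have disj: "x \<notin> T" if "x \<in> B" for x using that BA T_notin by blast
  define \<rho> where "\<rho> z = (if z \<in> B then if s \<otimes> z \<in> T then s \<otimes> z else s \<otimes> z \<otimes> inv s
     else if s \<otimes> z \<in> A then inv (s \<otimes> z) else inv_into {x \<in> T. inv s \<otimes> x \<notin> A} \<sigma> z)" for z
  have "\<rho> (\<tau> x) = x" if x: "x \<in> B \<union> T" for x
  proof -
    have xc: "x \<in> carrier G" using x B_closed T_closed by blast
    consider (1) "x \<in> B" "x \<otimes> s \<in> T" | (2) "x \<in> B" "x \<otimes> s \<notin> T"
      | (3) "x \<in> T" "inv s \<otimes> x \<in> A" | (4) "x \<in> T" "inv s \<otimes> x \<notin> A" using x by blast
    then show ?thesis
    proof cases
      case 1
      then have "\<tau> x \<notin> B" "s \<otimes> \<tau> x \<in> A" "s \<otimes> \<tau> x = inv x" using c1[OF 1] disj xc sc by auto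
      then show ?thesis using xc by (simp add: \<rho>_def)
    next
      case 2
      then have "\<tau> x \<in> B" "s \<otimes> \<tau> x = x \<otimes> s" using c2[OF 2] xc sc by (auto simp: m_assoc)
      then show ?thesis using 2 xc sc by (simp add: \<rho>_def m_assoc)
    next
      case 3
      then have "\<tau> x \<in> B" "s \<otimes> \<tau> x = x" using c3[OF 3] xc sc by auto
      then show ?thesis using 3 by (simp add: \<rho>_def)
    next
      case 4
      then have "\<tau> x \<notin> B" "s \<otimes> \<tau> x \<notin> A" "\<tau> x = \<sigma> x" using c4[OF 4] disj by auto
      then show ?thesis using 4 inv_into_f_f[OF \<sigma>(1), of x] by (simp add: \<rho>_def)
    qed
  qed
  then have "inj_on \<tau> (B \<union> T)" by (rule inj_on_inverseI)
  moreover have into: "\<tau> x \<in> B \<union> T \<and> inv x \<otimes> s \<otimes> \<tau> x \<in> B \<union> T" if "x \<in> B \<union> T" for x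
    using that c1[of x] c2[of x] c3[of x] c4[of x] one_in_B sT by (metis UnE UnI1 UnI2)
  moreover have "finite (B \<union> T)" using finite_B finite_T by simp
  ultimately have "bij_betw \<tau> (B \<union> T) (B \<union> T)"
    using endo_inj_surj[of "B \<union> T" \<tau>] by (auto simp: bij_betw_def image_subset_iff)
  then show ?thesis using into by blast
qed

end

lemma (in group) nonneg_curvature_of_virtually_abelian:
  assumes fg: "finitely_generated_group G" and va: "virtually_abelian G"
  obtains S where "cayley_graph G S" "nonneg_ollivier_ricci G S"
proof -
  obtain Y where Y: "finite Y" "Y \<subseteq> carrier G" "generate G Y = carrier G"
    using fg unfolding finitely_generated_group_def by blast
  obtain A where A: "A \<lhd> G" "finite (rcosets A)" "comm_group (G\<lparr>carrier := A\<rparr>)"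
    using va unfolding virtually_abelian_def by blast
  interpret A: normal A G by (rule A(1))
  have comm: "x \<otimes> y = y \<otimes> x" if "x \<in> A" "y \<in> A" for x y
    using comm_monoid.m_comm[OF comm_group.axioms(1)[OF A(3)], of x y] that by simp
  obtain T k where T: "finite T" "T \<subseteq> carrier G - A" "\<And>t. t \<in> T \<Longrightarrow> inv t \<in> T" "(k::nat) > 0"
    "\<And>g. g \<in> carrier G - A \<Longrightarrow> card {t \<in> T. inv g \<otimes> t \<in> A} = k"
    using A.symmetric_transversal[OF A(2)] by blast
  let ?T = "insert \<one> T"
  have Tc: "t \<in> carrier G" if "t \<in> T" for t using that T(2) by blast
  \<comment> \<open>The products bound the displacements in the couplings; the quotients of generators by elements of
    \<open>T\<close> ensure that the box and \<open>T\<close> generate the group.\<close>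
  define F where "F = A \<inter> ((\<lambda>(x, y, z, w). x \<otimes> y \<otimes> z \<otimes> w) ` (?T \<times> ?T \<times> ?T \<times> ?T) \<union>
    (\<lambda>(t, x). inv t \<otimes> x) ` (?T \<times> Y))"
  have F: "finite F" "F \<subseteq> A" using T(1) Y(1) by (auto simp: F_def)
  obtain B where B: "finite B" "F \<subseteq> B" "B \<subseteq> A" "\<And>x. x \<in> B \<Longrightarrow> inv x \<in> B"
    "\<And>g x. g \<in> carrier G \<Longrightarrow> x \<in> B \<Longrightarrow> inv g \<otimes> x \<otimes> g \<in> B"
    using A.finite_conj_closure[OF A(2) comm F] by blast
  interpret transversal_and_box A G T B k
  proof
    fix x y z w assume "x \<in> ?T" "y \<in> ?T" "z \<in> ?T" "w \<in> ?T" "x \<otimes> y \<otimes> z \<otimes> w \<in> A"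
    then have "x \<otimes> y \<otimes> z \<otimes> w \<in> F"
      unfolding F_def by (intro IntI UnI1 image_eqI[of _ _ "(x, y, z, w)"]) auto
    then show "x \<otimes> y \<otimes> z \<otimes> w \<in> B" using B(2) by blast
  qed (use T B in auto)
  define S where "S = (B \<union> T) - {\<one>}"
  have oneT: "\<one> \<notin> T" using T_notin[of \<one>] by auto
  have S1: "insert \<one> S = B \<union> T" using one_in_B by (auto simp: S_def)
  have Sc: "S \<subseteq> carrier G" using B_closed T_closed by (auto simp: S_def)
  have SG: "subgroup (generate G S) G" using generate_is_subgroup[OF Sc] .
  have BT: "x \<in> generate G S" if "x \<in> B \<union> T" for x
  proof (cases "x = \<one>")
    case True then show ?thesis by (simp add: generate.one)
  next
    case False then show ?thesis using that by (intro generate.incl) (simp add: S_def)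
  qed
  have "y \<in> generate G S" if y: "y \<in> Y" for y
  proof -
    have yc: "y \<in> carrier G" using y Y(2) by blast
    have "\<exists>t\<in>?T. inv t \<otimes> y \<in> A"
    proof (cases "y \<in> A")
      case True then show ?thesis using yc by (intro bexI[of _ \<one>]) auto
    next
      case False
      then have "card {t \<in> T. inv y \<otimes> t \<in> A} > 0" using T(4,5) yc by simp
      then have "{t \<in> T. inv y \<otimes> t \<in> A} \<noteq> {}" by (metis card.empty less_irrefl)
      then obtain t where t: "t \<in> T" "inv y \<otimes> t \<in> A" by blast
      have "inv (inv y \<otimes> t) \<in> A" using t(2) by simp
      then show ?thesis using t(1) Tc[OF t(1)] yc by (intro bexI[of _ t]) (auto simp: inv_mult_group)
    qed
    then obtain t where t: "t \<in> ?T" "inv t \<otimes> y \<in> A" by blast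
    then have "inv t \<otimes> y \<in> F"
      unfolding F_def using y by (intro IntI UnI2 image_eqI[of _ _ "(t, y)"]) auto
    then have 1: "inv t \<otimes> y \<in> generate G S" using B(2) BT by blast
    have 2: "t \<in> generate G S" using t(1) BT generate.one by blast
    have "t \<otimes> (inv t \<otimes> y) \<in> generate G S" by (rule generate.eng[OF 2 1])
    then show ?thesis using t(1) Tc yc by auto
  qed
  then have gen: "generate G S = carrier G"
    using generate_subgroup_incl[OF _ SG, of Y] Y(3) generate_incl[OF Sc] by blast
  have inv: "inv x \<in> S" if "x \<in> S" for x
    using that inv_B inv_T B_closed T_closed by (auto simp: S_def)
  have sym: "symmetric_subset G S"
    unfolding symmetric_subset_def
  proof (intro conjI equalityI subsetI)
    show "x \<in> (\<lambda>s. inv s) ` S" if x: "x \<in> S" for x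
      using inv[OF x] Sc x by (intro image_eqI[of _ _ "inv x"]) auto
  qed (use Sc inv in auto)
  interpret S: cayley_graph G S
    by unfold_locales (use finite_B finite_T sym gen in \<open>auto simp: S_def\<close>)
  have "nonneg_ollivier_ricci G S"
  proof (rule S.nonneg_curvature_of_bijections)
    fix s assume "s \<in> S"
    then have "s \<in> B \<union> T" by (auto simp: S_def)
    then show "\<exists>\<tau>. bij_betw \<tau> (insert \<one> S) (insert \<one> S) \<and>
      (\<forall>x\<in>insert \<one> S. inv x \<otimes> s \<otimes> \<tau> x \<in> insert \<one> S)"
      unfolding S1 by (rule transport_bijection)
  qed
  then show thesis using that S.cayley_graph_axioms by blast
qed

section \<open>The equivalence\<close>

theorem theorem1p9:
  fixes G :: "('a, 'b) monoid_scheme"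
  assumes "finitely_generated_group G"
    and "virtually_nilpotent G"
  shows "virtually_abelian G \<longleftrightarrow>
    (\<exists>S. finite S \<and> symmetric_subset G S \<and> generate G S = carrier G \<and>
         \<one>\<^bsub>G\<^esub> \<notin> S \<and> nonneg_ollivier_ricci G S)"
proof -
  interpret group G using assms(1) by (simp add: finitely_generated_group_def)
  show ?thesis
  proof
    assume "virtually_abelian G"
    then obtain S where S: "cayley_graph G S" "nonneg_ollivier_ricci G S"
      using nonneg_curvature_of_virtually_abelian[OF assms(1)] by blast
    interpret cayley_graph G S by (rule S(1))
    show "\<exists>S. finite S \<and> symmetric_subset G S \<and> generate G S = carrier G \<and>
         \<one>\<^bsub>G\<^esub> \<notin> S \<and> nonneg_ollivier_ricci G S"
      using finite_S symmetric_S generate_S one_notin_S S(2) by blast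
  next
    assume "\<exists>S. finite S \<and> symmetric_subset G S \<and> generate G S = carrier G \<and>
         \<one>\<^bsub>G\<^esub> \<notin> S \<and> nonneg_ollivier_ricci G S"
    then obtain S where S: "finite S" "symmetric_subset G S" "generate G S = carrier G"
      "\<one>\<^bsub>G\<^esub> \<notin> S" "nonneg_ollivier_ricci G S" by blast
    interpret cayley_graph G S by unfold_locales (use S in auto)
    show "virtually_abelian G"
      by (rule virtually_abelian_of_nonneg_curvature[OF assms(2) S(5)])
  qed
qed

end
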